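(* Let $X=(\omega_{i,i}^R,\omega_{i,j}^R,\omega_{i,j}^I)_{1\le i<j\le N}$ be a random vector in $\mathbb{R}^{N^2}$ with law $\mathbb{P}^N\sim ID(\beta,0,\nu)$ such that $\nu$ has bounded support. Let $R=\inf\{r>0:\nu(x:\|x\|>r)=0\}$, let $V^2=V^2(R)=\int_{\mathbb{R}^{N^2}}\|u\|^2\nu(du)$, and let $\ell(x)=(1+x)\ln(1+x)-x$ for $x>0$. Let $\mathbf{X_A}$ be the associated $N\times N$ random Hermitian matrix, $(\mathbf{X_A})_{i,j}=\frac{1}{\sqrt N}A_{i,j}\omega_{i,j}$, with $|A_{i,j}|\le a$, let $\hat\mu_A^N$ be its empirical spectral measure, and let $b>0$. (i) For any $\delta>0$, $$\mathbb{P}^N\Big(\sup_{f\in Lip_b(1)}\big|tr_N(f(\mathbf{X_A}))-\mathbb{E}^N[tr_N(f(\mathbf{X_A}))]\big|\ge\delta\Big)\le\frac{C(\delta,b)}{\delta}\exp\Big\{-\frac{V^2}{R^2}\,\ell\Big(\frac{NR\delta^2}{\sqrt2 a\,C(\delta,b)V^2}\Big)\Big\},$$ where $$C(\delta,b)=C\Big(\frac{\sqrt2 a}{\sqrt N}\Big(G_2(\gamma)+\frac{V^2}{R}\big(e^{t_0R}-1\big)\Big)+b\Big),$$ with $C$ a universal constant, with $\gamma>0$ any number such that $\bar\nu(p_\gamma)\le1/4$ (the quantity $G_2(\gamma)$ being defined in the context), and with $t_0$ the solution, in $t$, of $$\frac{V^2}{R^2}\big(tRe^{tR}-e^{tR}+1\big)=\ln\frac{12b}{\delta}.$$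 (ii) For any probability measure $\mu$ on $\mathbb{R}$ and any $\delta>0$, $$\mathbb{P}^N\big(d_W(\hat\mu_A^N,\mu)-\mathbb{E}^N[d_W(\hat\mu_A^N,\mu)]\ge\delta\big)\le\exp\Big\{\frac{N\delta}{\sqrt2 aR}-\Big(\frac{N\delta}{\sqrt2 aR}+\frac{V^2}{R^2}\Big)\ln\Big(1+\frac{NR\delta}{\sqrt2 aV^2}\Big)\Big\}.$$
   Context: Matrix model. $N\ge1$; $\mathbf{A}=(A_{i,j})_{1\le i,j\le N}$ is a non-random Hermitian matrix with $|A_{i,j}|\le a$ for all $i,j$, where $a>0$. The complex random variables $\omega_{i,j}=\omega_{i,j}^R+\sqrt{-1}\,\omega_{i,j}^I$ satisfy $\omega_{i,j}=\overline{\omega_{j,i}}$ and $\omega_{i,i}^I=0$. $\mathbf{X_A}$ is the $N\times N$ Hermitian matrix with entries $(\mathbf{X_A})_{i,j}=\frac1{\sqrt N}A_{i,j}\omega_{i,j}$. $X=(\omega_{i,i}^R,\omega_{i,j}^R,\omega_{i,j}^I)_{1\le i<j\le N}$ (with $1\le i\le N$ for $\omega_{i,i}^R$) is the vector in $\mathbb{R}^{N^2}$ of real parameters, $\mathbb{P}^N$ its law and $\mathbb{E}^N$ the expectation. $\|\cdot\|$ is the Euclidean norm. $\hat\mu_A^N=\frac1N\sum_{i=1}^N\delta_{\lambda_i}$, where $\lambda_1,\dots,\lambda_N$ are the eigenvalues of $\mathbf{X_A}$. For $f:\mathbb{R}\to\mathbb{R}$ and Hermitian $\mathbf{M}=\mathbf{U}\,\mathrm{diag}(\lambda_1,\dots,\lambda_N)\mathbf{U}^*$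 with $\mathbf U$ unitary, $f(\mathbf{M})=\mathbf{U}\,\mathrm{diag}(f(\lambda_1),\dots,f(\lambda_N))\mathbf{U}^*$, and $tr_N(\mathbf{M})=\frac1N\sum_{i=1}^N\mathbf{M}_{i,i}$. $Lip_b(1)=\{f:\mathbb{R}\to\mathbb{R}:|f(x)-f(y)|\le|x-y|\ \forall x,y,\ \|f\|_\infty\le b\}$. The Wasserstein distance between probability measures $\mu_1,\mu_2$ on $\mathbb{R}$ is here $d_W(\mu_1,\mu_2)=\sup_{f\in Lip_b(1)}\big|\int f\,d\mu_1-\int f\,d\mu_2\big|$. $X\sim ID(\beta,0,\nu)$ in $\mathbb{R}^d$ means $\mathbb{E}e^{i\langle t,X\rangle}=\exp\{i\langle t,\beta\rangle+\int_{\mathbb{R}^d}(e^{i\langle t,u\rangle}-1-i\langle t,u\rangle\mathbf{1}_{\|u\|\le1})\nu(du)\}$, where $\beta\in\mathbb{R}^d$ and the Lévy measure $\nu\not\equiv0$ is a positive Borel measure without atom at the origin with $\int(1\wedge\|u\|^2)\nu(du)<\infty$. Definition of $G_2(\gamma)$: let $V^2(x)=\int_{\|u\|\le x}\|u\|^2\nu(du)$, $\bar\nu(x)=\int_{\|u\|>x}\nu(du)$, and for $\gamma>0$ let $p_\gamma=\inf\{x>0:0<V^2(x)/x^2\le\gamma\}$. Let $k_\gamma(x)$, $x>0$, be the solution, in $y$, of $y-(y+\gamma)\ln(1+y/\gamma)=\ln x$, and $$E_\gamma=\Big(\sum_{k=1}^{N^2}\Big(\langle e_k,\beta\rangle-\int_{p_\gamma<\|y\|\le1}\langle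 e_k,y\rangle\nu(dy)+\int_{1<\|y\|\le p_\gamma}\langle e_k,y\rangle\nu(dy)\Big)^2\Big)^{1/2},$$ with $e_1,\dots,e_{N^2}$ the canonical basis of $\mathbb{R}^{N^2}$. Then $G_2(\gamma)=p_\gamma\big(\sqrt\gamma+k_\gamma(1/4)\big)+E_\gamma$. *)

theory Defs
  imports "HOL-Probability.Probability" "Jordan_Normal_Form.Schur_Decomposition"
begin

text \<open>
  The dimension \<open>N\<close> has to stay a term-level natural number, since the universal constant in the
  theorem is chosen before \<open>N\<close>. Vectors of \<open>\<real>\<^sup>I\<close>, for a finite index set \<open>I\<close>, are therefore
  functions \<open>'i \<Rightarrow> real\<close> of which only the values on \<open>I\<close> matter, with the Euclidean norm
  \<^term>\<open>L2_set x I\<close>; the Borel sigma-algebra is the finite product of the one of the reals.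
\<close>

abbreviation euclid :: "'i set \<Rightarrow> ('i \<Rightarrow> real) measure"
  where "euclid I \<equiv> PiM I (\<lambda>_. borel)"

definition ip :: "'i set \<Rightarrow> ('i \<Rightarrow> real) \<Rightarrow> ('i \<Rightarrow> real) \<Rightarrow> real"
  where "ip I x y = (\<Sum>k\<in>I. x k * y k)"

definition levy_measure :: "'i set \<Rightarrow> ('i \<Rightarrow> real) measure \<Rightarrow> bool"
  where "levy_measure I \<nu> \<longleftrightarrow>
    sets \<nu> = sets (euclid I) \<and>
    emeasure \<nu> (space \<nu>) \<noteq> 0 \<and>
    emeasure \<nu> {\<lambda>k\<in>I. 0} = 0 \<and>
    (\<integral>\<^sup>+u. ennreal (min 1 ((L2_set u I)\<^sup>2)) \<partial>\<nu>) < \<infinity>"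

definition ID :: "'i set \<Rightarrow> ('i \<Rightarrow> real) \<Rightarrow> ('i \<Rightarrow> real) measure \<Rightarrow> ('i \<Rightarrow> real) measure \<Rightarrow> bool"
  where "ID I \<beta> \<nu> P \<longleftrightarrow>
    levy_measure I \<nu> \<and> prob_space P \<and> sets P = sets (euclid I) \<and>
    (\<forall>t. (\<integral>x. iexp (ip I t x) \<partial>P) =
      exp (\<i> * complex_of_real (ip I t \<beta>) +
        (\<integral>u. (iexp (ip I t u) - 1
           - \<i> * complex_of_real (ip I t u * indicator {u. L2_set u I \<le> 1} u)) \<partial>\<nu>)))"

definition bounded_supp :: "'i set \<Rightarrow> ('i \<Rightarrow> real) measure \<Rightarrow> bool"
  where "bounded_supp I \<nu> \<longleftrightarrow> (\<exists>r>0. emeasure \<nu> {u\<in>space \<nu>. L2_set u I > r} = 0)"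

definition supp_radius :: "'i set \<Rightarrow> ('i \<Rightarrow> real) measure \<Rightarrow> real"
  where "supp_radius I \<nu> = Inf {r. r > 0 \<and> emeasure \<nu> {u\<in>space \<nu>. L2_set u I > r} = 0}"

definition Vsq :: "'i set \<Rightarrow> ('i \<Rightarrow> real) measure \<Rightarrow> real \<Rightarrow> real"
  where "Vsq I \<nu> x = (LINT u:{u\<in>space \<nu>. L2_set u I \<le> x}|\<nu>. (L2_set u I)\<^sup>2)"

text \<open>Extended-valued, because \<open>\<nu>bar 0\<close> is infinite when \<open>\<nu>\<close> is.\<close>
definition \<nu>bar :: "'i set \<Rightarrow> ('i \<Rightarrow> real) measure \<Rightarrow> real \<Rightarrow> ennreal"
  where "\<nu>bar I \<nu> x = emeasure \<nu> {u\<in>space \<nu>. L2_set u I > x}"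

definition p_gamma :: "'i set \<Rightarrow> ('i \<Rightarrow> real) measure \<Rightarrow> real \<Rightarrow> real"
  where "p_gamma I \<nu> \<gamma> = Inf {x. x > 0 \<and> 0 < Vsq I \<nu> x / x\<^sup>2 \<and> Vsq I \<nu> x / x\<^sup>2 \<le> \<gamma>}"

text \<open>
  For \<open>exp (- \<gamma>) < x < 1\<close> the equation also has a root in \<open>{- \<gamma><..<0}\<close>; the nonnegative root,
  which exists and is unique for \<open>0 < x \<le> 1\<close>, is the one that is meant.
\<close>
definition k_gamma :: "real \<Rightarrow> real \<Rightarrow> real"
  where "k_gamma \<gamma> x = (THE y. y \<ge> 0 \<and> y - (y + \<gamma>) * ln (1 + y / \<gamma>) = ln x)"

definition E_gamma :: "'i set \<Rightarrow> ('i \<Rightarrow> real) \<Rightarrow> ('i \<Rightarrow> real) measure \<Rightarrow> real \<Rightarrow> real"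
  where "E_gamma I \<beta> \<nu> \<gamma> = (let p = p_gamma I \<nu> \<gamma> in
    sqrt (\<Sum>k\<in>I. (\<beta> k
      - (LINT y:{y\<in>space \<nu>. p < L2_set y I \<and> L2_set y I \<le> 1}|\<nu>. y k)
      + (LINT y:{y\<in>space \<nu>. 1 < L2_set y I \<and> L2_set y I \<le> p}|\<nu>. y k))\<^sup>2))"

definition G2 :: "'i set \<Rightarrow> ('i \<Rightarrow> real) \<Rightarrow> ('i \<Rightarrow> real) measure \<Rightarrow> real \<Rightarrow> real"
  where "G2 I \<beta> \<nu> \<gamma> =
    p_gamma I \<nu> \<gamma> * (sqrt \<gamma> + k_gamma \<gamma> (1/4)) + E_gamma I \<beta> \<nu> \<gamma>"

definition ell :: "real \<Rightarrow> real"
  where "ell x = (1 + x) * ln (1 + x) - x"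

text \<open>
  Coordinates of \<open>\<real>\<^bsup>N\<^sup>2\<^esup>\<close>: for \<open>i < j\<close>, the coordinate \<open>(i, j)\<close> is the real part and the
  coordinate \<open>(j, i)\<close> the imaginary part of the entry \<open>\<omega>\<^sub>i\<^sub>j\<close>; \<open>(i, i)\<close> is the real entry \<open>\<omega>\<^sub>i\<^sub>i\<close>.
\<close>
abbreviation idx :: "nat \<Rightarrow> (nat \<times> nat) set"
  where "idx N \<equiv> {..<N} \<times> {..<N}"

definition omega :: "(nat \<times> nat \<Rightarrow> real) \<Rightarrow> nat \<Rightarrow> nat \<Rightarrow> complex"
  where "omega x i j =
    (if i = j then Complex (x (i, i)) 0
     else if i < j then Complex (x (i, j)) (x (j, i))
     else cnj (Complex (x (j, i)) (x (i, j))))"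

definition X_mat :: "nat \<Rightarrow> complex mat \<Rightarrow> (nat \<times> nat \<Rightarrow> real) \<Rightarrow> complex mat"
  where "X_mat N A x =
    Matrix.mat N N (\<lambda>(i, j). complex_of_real (1 / sqrt (real N)) * A $$ (i, j) * omega x i j)"

definition hermitian :: "complex mat \<Rightarrow> bool"
  where "hermitian M \<longleftrightarrow> mat_adjoint M = M"

definition unitary :: "nat \<Rightarrow> complex mat \<Rightarrow> bool"
  where "unitary n U \<longleftrightarrow> U \<in> carrier_mat n n \<and> U * mat_adjoint U = 1\<^sub>m n"

text \<open>Meaningful for Hermitian \<open>M\<close>; the result does not depend on the diagonalization.\<close>
definition mat_fun :: "(real \<Rightarrow> real) \<Rightarrow> complex mat \<Rightarrow> complex mat"
  where "mat_fun f M = (THE B. \<exists>U l. unitary (dim_row M) U \<and>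
    M = U * mat_diag (dim_row M) (\<lambda>i. complex_of_real (l i)) * mat_adjoint U \<and>
    B = U * mat_diag (dim_row M) (\<lambda>i. complex_of_real (f (l i))) * mat_adjoint U)"

text \<open>\<open>Re\<close> only converts the type: the trace of a Hermitian matrix is real.\<close>
definition tr_N :: "complex mat \<Rightarrow> real"
  where "tr_N M = (1 / real (dim_row M)) * Re (\<Sum>i<dim_row M. M $$ (i, i))"

text \<open>
  The roots of the characteristic polynomial, counted with multiplicity, each get mass
  \<open>1 / N\<close>; they are real for Hermitian \<open>M\<close>.
\<close>
definition emp_spectral :: "complex mat \<Rightarrow> real measure"
  where "emp_spectral M =
    distr (measure_pmf (pmf_of_multiset (proots (char_poly M)))) borel Re"

definition Lip_b :: "real \<Rightarrow> (real \<Rightarrow> real) set"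
  where "Lip_b b = {f. 1-lipschitz_on UNIV f \<and> (\<forall>x. \<bar>f x\<bar> \<le> b)}"

definition d_W :: "real \<Rightarrow> real measure \<Rightarrow> real measure \<Rightarrow> real"
  where "d_W b \<mu>1 \<mu>2 = (SUP f\<in>Lip_b b. \<bar>(\<integral>x. f x \<partial>\<mu>1) - (\<integral>x. f x \<partial>\<mu>2)\<bar>)"

end

theory Submission
  imports Defs
begin

text \<open>
  A law \<open>ID(\<beta>, 0, \<nu>)\<close> with jumps bounded by \<open>R\<close> is a weak limit of laws of random walks whose
  steps are rare jumps distributed according to \<open>\<nu>\<close> away from the origin. If \<open>G\<close> is the conditional
  mean of a 1-Lipschitz \<open>F\<close> over one further step \<open>\<xi>\<close>, then
  \<open>E exp (t F(x + \<xi>)) \<le> exp (t G(x) + E (exp (t \<parallel>\<xi>\<parallel>) - 1 - t \<parallel>\<xi>\<parallel>))\<close> and \<open>G\<close> is 1-Lipschitz again. Induction over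
  the steps gives \<open>E exp (t (F - E F)) \<le> exp (V\<^sup>2 / R\<^sup>2 (exp (t R) - 1 - t R))\<close>, with no constant lost; this
  passes to the limit and yields the Chernoff bound with rate \<open>ell\<close>.

  For a Lipschitz \<open>f\<close>, the map taking \<open>x\<close> to \<open>tr_N (f(X_A(x)))\<close> is Lipschitz with constant \<open>sqrt 2 a / N\<close>,
  because the squared moduli of the scalar products of two orthonormal eigenbases form a doubly
  stochastic matrix. This gives (ii) at once. For (i), every \<open>f\<close> in \<open>Lip_b b\<close> is replaced, on an interval of
  length comparable to \<open>C(\<delta>, b)\<close>, by a combination of order \<open>C(\<delta>, b) / \<delta>\<close> ramps that do not depend on \<open>f\<close>, and the
  bound for one function is applied to each ramp with deviation of order \<open>\<delta>\<^sup>2 / C(\<delta>, b)\<close>. The eigenvalues outside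
  the interval are controlled by a Chernoff bound for \<open>\<parallel>X\<parallel>\<close>, whose mean is related to \<open>G2 \<gamma>\<close> by comparing \<open>X\<close>
  with its part having jumps of size at most \<open>p_gamma\<close>.
\<close>

section \<open>Lipschitz functions and Gaussian smoothing\<close>

text \<open>Everything is proved for bounded Lipschitz functions: these, together with
  \<open>exp (t * F)\<close>, pass to weak limits. The norm is unbounded and enters only truncated,
  with bounds that are free of the truncation level. Convergence of characteristic functions becomes
  convergence of such means after adding a small Gaussian noise: the noisy laws have densities that
  converge pointwise, hence in L1 by Scheffe.

  The mean of the norm is estimated on the walks, not on their limit. There, discarding the jumps
  above \<open>p_gamma\<close> means replacing each step, at a total cost of 1/4; adding Chebyshev's
  1/4 bounds a median, and the lower tail bound leads from the median to the mean.

  In (i) the supremum of the centred traces is itself a Lipschitz function of the entries, but its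
  mean is unknown and would have to be compared with \<delta>; the union bound over fixed ramps
  avoids this mean. The equation for t0 makes the Chernoff bound for the norm equal to \<delta> /
  (12 b): outside the interval a member of \<open>Lip_b b\<close> and its interpolant differ by up
  to 2 b, so that these eigenvalues contribute to means only a fraction of \<delta>.\<close>

definition lip :: "'i set \<Rightarrow> real \<Rightarrow> (('i \<Rightarrow> real) \<Rightarrow> real) \<Rightarrow> bool"
  where "lip I L F \<longleftrightarrow> (\<forall>x y. \<bar>F x - F y\<bar> \<le> L * L2_set (\<lambda>k. x k - y k) I)"

lemma lipD: "lip I L F \<Longrightarrow> \<bar>F x - F y\<bar> \<le> L * L2_set (\<lambda>k. x k - y k) I"
  by (simp add: lip_def)

lemma L2_set_measurable [measurable]:
  "(\<lambda>x. L2_set x I) \<in> borel_measurable (euclid I)"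
  unfolding L2_set_def by measurable

lemma L2_set_diff_measurable [measurable]:
  "(\<lambda>x. L2_set (\<lambda>k. x k - y k) I) \<in> borel_measurable (euclid I)"
  unfolding L2_set_def by measurable

lemma ip_measurable [measurable]: "ip I t \<in> borel_measurable (euclid I)"
  unfolding ip_def by measurable

lemma L2_set_minus_commute: "L2_set (\<lambda>k. x k - y k) I = L2_set (\<lambda>k. y k - x k) I"
  unfolding L2_set_def by (simp add: power2_commute)

lemma lip_L2_set: "lip I 1 (\<lambda>x. L2_set x I)"
proof -
  have *: "L2_set x I \<le> L2_set y I + L2_set (\<lambda>k. x k - y k) I" for x y
    using L2_set_triangle_ineq[of y "\<lambda>k. x k - y k" I] by simp
  have "\<bar>L2_set x I - L2_set y I\<bar> \<le> 1 * L2_set (\<lambda>k. x k - y k) I" for x y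
    using *[of x y] *[of y x] L2_set_minus_commute[of x y I] by (simp add: abs_le_iff)
  then show ?thesis by (simp add: lip_def)
qed

text \<open>F is the infimum of countably many measurable cones \<open>F q + K * |w - q|\<close>
  with rational apex q. F depends on the coordinates in I alone, because points that agree on I have
  distance 0, so finitely many rational coordinates suffice.\<close>

lemma lip_measurable:
  assumes fin: "finite I" and F: "lip I L F"
  shows "F \<in> borel_measurable (euclid I)"
proof (subst borel_measurable_iff_less, intro allI)
  fix c :: real
  define Q where "Q = PiE I (\<lambda>_. \<rat>::real set)"
  have L0: "lip I (max L 0) F"
    unfolding lip_def using lipD[OF F] L2_set_nonneg
    by (meson max.cobounded1 mult_right_mono order_trans)
  define K where "K = max L 0"
  have K: "K \<ge> 0" "\<And>x y. \<bar>F x - F y\<bar> \<le> K * L2_set (\<lambda>k. x k - y k) I"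
    using lipD[OF L0] by (auto simp: K_def)
  have "countable Q" unfolding Q_def using fin countable_rat by (intro countable_PiE) auto
  have "{w \<in> space (euclid I). F w < c} =
      (\<Union>q\<in>Q. {w \<in> space (euclid I). F q + K * L2_set (\<lambda>k. w k - q k) I < c})"
  proof (intro equalityI subsetI)
    fix w assume w: "w \<in> {w \<in> space (euclid I). F w < c}"
    \<comment> \<open>The factor 2 is there because the distance to the apex is paid twice, once in
      \<open>F q'\<close> and once in the cone. The summands 1 avoid division by zero for K = 0 or
      empty I.\<close>
    define e where "e = (c - F w) / (2 * (K + 1) * (card I + 1))"
    have e: "e > 0" using w K by (auto simp: e_def)
    have "\<exists>q. q \<in> \<rat> \<and> \<bar>w k - q\<bar> < e" for k
    proof -
      have "w k - e < w k + e" using e by simp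
      then obtain q where "q \<in> \<rat>" "w k - e < q" "q < w k + e"
        using Rats_dense_in_real by blast
      then show ?thesis by (intro exI[of _ q]) auto
    qed
    then have "\<forall>k. \<exists>q. q \<in> \<rat> \<and> \<bar>w k - q\<bar> < e" by blast
    from choice[OF this] obtain q where q: "\<And>k. q k \<in> \<rat>" "\<And>k. \<bar>w k - q k\<bar> < e"
      by blast
    define q' where "q' = restrict q I"
    have "L2_set (\<lambda>k. w k - q' k) I \<le> (\<Sum>k\<in>I. \<bar>w k - q' k\<bar>)" by (rule L2_set_le_sum_abs)
    also have "\<dots> \<le> (\<Sum>k\<in>I. e)" using q(2) by (intro sum_mono) (auto simp: q'_def less_imp_le)
    also have "\<dots> \<le> (card I + 1) * e" using e by (simp add: algebra_simps)
    finally have *: "L2_set (\<lambda>k. w k - q' k) I \<le> (card I + 1) * e" .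
    have "F q' \<le> F w + K * L2_set (\<lambda>k. w k - q' k) I" using K(2)[of w q'] by linarith
    then have "F q' + K * L2_set (\<lambda>k. w k - q' k) I \<le> F w + 2 * K * ((card I + 1) * e)"
      using mult_left_mono[OF * K(1)] by linarith
    also have "2 * K * ((card I + 1) * e) = (c - F w) * (K / (K + 1))"
      using K by (simp add: e_def divide_simps)
    also have "F w + \<dots> < c"
    proof -
      have "(c - F w) * (K / (K + 1)) < (c - F w) * 1"
        using w K by (intro mult_strict_left_mono) auto
      then show ?thesis by simp
    qed
    finally have "F q' + K * L2_set (\<lambda>k. w k - q' k) I < c" .
    moreover have "q' \<in> Q" using q by (auto simp: Q_def q'_def)
    ultimately show "w \<in> (\<Union>q\<in>Q. {w \<in> space (euclid I). F q + K * L2_set (\<lambda>k. w k - q k) I < c})"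
      using w by auto
  next
    fix w assume "w \<in> (\<Union>q\<in>Q. {w \<in> space (euclid I). F q + K * L2_set (\<lambda>k. w k - q k) I < c})"
    then obtain q where "w \<in> space (euclid I)" "F q + K * L2_set (\<lambda>k. w k - q k) I < c" by auto
    then show "w \<in> {w \<in> space (euclid I). F w < c}" using K(2)[of w q] by auto
  qed
  also have "\<dots> \<in> sets (euclid I)"
    using \<open>countable Q\<close> by (intro sets.countable_UN') auto
  finally show "{w \<in> space (euclid I). F w < c} \<in> sets (euclid I)" .
qed

section \<open>Product Lebesgue measure and its translations\<close>

abbreviation leb :: "'i set \<Rightarrow> ('i \<Rightarrow> real) measure"
  where "leb I \<equiv> PiM I (\<lambda>_. lborel)"

lemma sets_leb: "sets (leb I) = sets (euclid I)" by (intro sets_PiM_cong) auto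

lemma measurable_leb: "measurable (leb I) M = measurable (euclid I) M"
  by (intro measurable_cong_sets sets_leb) auto

interpretation lborel_prod: product_sigma_finite "\<lambda>_. lborel :: real measure"
  by standard

lemma leb_translate:
  assumes fin: "finite I"
  shows "distr (leb I) (leb I) (\<lambda>y. \<lambda>k\<in>I. y k - x k) = leb I"
proof (rule lborel_prod.PiM_eqI[OF fin])
  show "sets (distr (leb I) (leb I) (\<lambda>y. \<lambda>k\<in>I. y k - x k)) = sets (leb I)" by simp
  fix A :: "'a \<Rightarrow> real set" assume A: "\<And>i. i \<in> I \<Longrightarrow> A i \<in> sets lborel"
  have meas: "(\<lambda>y. \<lambda>k\<in>I. y k - x k) \<in> measurable (leb I) (leb I)" by measurable
  have "emeasure (distr (leb I) (leb I) (\<lambda>y. \<lambda>k\<in>I. y k - x k)) (Pi\<^sub>E I A) =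
      emeasure (leb I) ((\<lambda>y. \<lambda>k\<in>I. y k - x k) -` (Pi\<^sub>E I A) \<inter> space (leb I))"
    using A fin by (intro emeasure_distr meas sets_PiM_I_finite) auto
  also have "(\<lambda>y. \<lambda>k\<in>I. y k - x k) -` (Pi\<^sub>E I A) \<inter> space (leb I) =
      Pi\<^sub>E I (\<lambda>k. (\<lambda>y. y - x k) -` A k)"
    by (auto simp: space_PiM PiE_iff)
  also have "emeasure (leb I) \<dots> = (\<Prod>k\<in>I. emeasure lborel ((\<lambda>y. y - x k) -` A k))"
  proof (rule lborel_prod.emeasure_PiM[OF fin])
    fix i assume "i \<in> I"
    then have "A i \<in> sets borel" using A by simp
    then have "(\<lambda>y. y - x i) -` A i \<inter> space borel \<in> sets borel"
      by (intro measurable_sets[of _ borel borel]) auto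
    then show "(\<lambda>y. y - x i) -` A i \<in> sets lborel" by simp
  qed
  also have "\<dots> = (\<Prod>k\<in>I. emeasure lborel (A k))"
  proof (rule prod.cong[OF refl])
    fix k assume "k \<in> I"
    then have Ak: "A k \<in> sets borel" using A by simp
    have "emeasure lborel (A k) = emeasure (distr lborel borel ((+) (- x k))) (A k)"
      by (simp add: lborel_distr_plus)
    also have "\<dots> = emeasure lborel ((+) (- x k) -` A k \<inter> space lborel)"
      using Ak by (intro emeasure_distr) auto
    also have "(+) (- x k) -` A k \<inter> space lborel = (\<lambda>y. y - x k) -` A k" by auto
    finally show "emeasure lborel ((\<lambda>y. y - x k) -` A k) = emeasure lborel (A k)" by simp
  qed
  finally show "emeasure (distr (leb I) (leb I) (\<lambda>y. \<lambda>k\<in>I. y k - x k)) (Pi\<^sub>E I A) =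
    (\<Prod>k\<in>I. emeasure lborel (A k))" .
qed

text \<open>The point \<open>\<lambda>k. y k - x k\<close> is not extensional outside I and so may
  lie outside the space of \<open>leb I\<close>; the assumption \<open>cong\<close> identifies the
  value of w there with its value at the restriction.\<close>

lemma integral_leb_translate:
  fixes w :: "('i \<Rightarrow> real) \<Rightarrow> real"
  assumes fin: "finite I" and w: "w \<in> borel_measurable (leb I)"
    and cong: "\<And>y. w (restrict y I) = w y"
  shows "(\<integral>y. w (\<lambda>k. y k - x k) \<partial>leb I) = (\<integral>y. w y \<partial>leb I)"
    and "integrable (leb I) w \<Longrightarrow> integrable (leb I) (\<lambda>y. w (\<lambda>k. y k - x k))"
proof -
  have meas: "(\<lambda>y. \<lambda>k\<in>I. y k - x k) \<in> measurable (leb I) (leb I)" by measurable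
  have eq: "w (\<lambda>k\<in>I. y k - x k) = w (\<lambda>k. y k - x k)" for y
    using cong[of "\<lambda>k. y k - x k"] by simp
  have "(\<integral>y. w y \<partial>leb I) = (\<integral>y. w y \<partial>distr (leb I) (leb I) (\<lambda>y. \<lambda>k\<in>I. y k - x k))"
    by (simp add: leb_translate[OF fin])
  also have "\<dots> = (\<integral>y. w (\<lambda>k\<in>I. y k - x k) \<partial>leb I)" by (rule integral_distr[OF meas w])
  finally show "(\<integral>y. w (\<lambda>k. y k - x k) \<partial>leb I) = (\<integral>y. w y \<partial>leb I)" by (simp add: eq)
  assume "integrable (leb I) w"
  then have "integrable (distr (leb I) (leb I) (\<lambda>y. \<lambda>k\<in>I. y k - x k)) w"
    by (simp add: leb_translate[OF fin])
  then show "integrable (leb I) (\<lambda>y. w (\<lambda>k. y k - x k))"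
    by (subst (asm) integrable_distr_eq[OF meas w]) (simp add: eq)
qed

section \<open>Gaussian kernels as averages of characters\<close>

definition mollifier :: "'i set \<Rightarrow> real \<Rightarrow> ('i \<Rightarrow> real) \<Rightarrow> real"
  where "mollifier I s z = (\<Prod>k\<in>I. normal_density 0 s (z k))"

lemma mollifier_nonneg: "mollifier I s z \<ge> 0"
  unfolding mollifier_def by (intro prod_nonneg) auto

lemma mollifier_measurable [measurable]: "mollifier I s \<in> borel_measurable (euclid I)"
  unfolding mollifier_def[abs_def] by measurable

lemma mollifier_integral:
  assumes fin: "finite I" and s: "s > 0"
  shows "integrable (leb I) (mollifier I s)" "(\<integral>z. mollifier I s z \<partial>leb I) = 1"
    and "k \<in> I \<Longrightarrow> integrable (leb I) (\<lambda>z. (z k)\<^sup>2 * mollifier I s z)"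
    and "k \<in> I \<Longrightarrow> (\<integral>z. (z k)\<^sup>2 * mollifier I s z \<partial>leb I) = s\<^sup>2"
proof -
  show "integrable (leb I) (mollifier I s)" unfolding mollifier_def[abs_def]
    using s by (intro lborel_prod.product_integrable_prod fin) auto
  have "(\<integral>z. mollifier I s z \<partial>leb I) = (\<Prod>k\<in>I. \<integral>z. normal_density 0 s z \<partial>lborel)"
    unfolding mollifier_def[abs_def]
    using s by (intro lborel_prod.product_integral_prod fin) auto
  then show "(\<integral>z. mollifier I s z \<partial>leb I) = 1" using s by simp
  assume k: "k \<in> I"
  \<comment> \<open>The square is absorbed into the factor with index k, which keeps the integrand a
    product over the coordinates.\<close>
  define f where "f = (\<lambda>j z. if j = k then z\<^sup>2 * normal_density 0 s z else normal_density 0 s z)"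
  have eq: "(z k)\<^sup>2 * mollifier I s z = (\<Prod>j\<in>I. f j (z j))" for z
    unfolding mollifier_def f_def prod.remove[OF fin k] by (auto intro!: prod.cong)
  have sq: "integrable lborel (\<lambda>z. z\<^sup>2 * normal_density 0 s z)"
      "(\<integral>z. z\<^sup>2 * normal_density 0 s z \<partial>lborel) = s\<^sup>2"
    using integrable_normal_moment[OF s, of 0 2] integral_normal_moment_even[OF s, of 0 1]
    by (auto simp: mult.commute)
  have f: "integrable lborel (f j)" for j
    using s sq(1) by (cases "j = k") (simp_all add: f_def)
  show "integrable (leb I) (\<lambda>z. (z k)\<^sup>2 * mollifier I s z)" unfolding eq
    by (intro lborel_prod.product_integrable_prod fin f)
  have "(\<integral>z. (z k)\<^sup>2 * mollifier I s z \<partial>leb I) = (\<Prod>j\<in>I. integral\<^sup>L lborel (f j))"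
    unfolding eq by (intro lborel_prod.product_integral_prod fin f)
  also have "\<dots> = s\<^sup>2" using s sq by (subst prod.remove[OF fin k]) (simp add: f_def)
  finally show "(\<integral>z. (z k)\<^sup>2 * mollifier I s z \<partial>leb I) = s\<^sup>2" .
qed

abbreviation gauss :: "'i set \<Rightarrow> ('i \<Rightarrow> real) measure"
  where "gauss I \<equiv> PiM I (\<lambda>_. std_normal_distribution)"

lemma product_prob_space_gauss: "product_prob_space (\<lambda>_. std_normal_distribution)"
proof -
  interpret real_distribution std_normal_distribution by (rule real_dist_normal_dist)
  show ?thesis by standard
qed

lemma prob_space_gauss: "prob_space (gauss I)"
proof -
  interpret gauss_prod: product_prob_space "\<lambda>_. std_normal_distribution" I
    by (rule product_prob_space_gauss)
  show ?thesis by (rule gauss_prod.prob_space_axioms)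
qed

lemma sets_gauss: "sets (gauss I) = sets (euclid I)" by (intro sets_PiM_cong) auto

lemma integral_iexp_std_normal:
  "integrable std_normal_distribution (\<lambda>\<tau>. iexp (\<tau> * z))"
  "(\<integral>\<tau>. iexp (\<tau> * z) \<partial>std_normal_distribution) = complex_of_real (exp (- z\<^sup>2 / 2))"
proof -
  interpret real_distribution std_normal_distribution by (rule real_dist_normal_dist)
  show "integrable std_normal_distribution (\<lambda>\<tau>. iexp (\<tau> * z))"
    by (intro integrable_const_bound[where B=1]) auto
  show "(\<integral>\<tau>. iexp (\<tau> * z) \<partial>std_normal_distribution) = complex_of_real (exp (- z\<^sup>2 / 2))"
    using fun_cong[OF char_std_normal_distribution, of z] unfolding char_def
    by (simp only: mult.commute[of z])
qed

text \<open>A Gaussian density is, up to a constant, a Gaussian characteristic function, coordinate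
  by coordinate. Written as an average of characters, the kernel can be integrated against a law of
  which only the characteristic function is known.\<close>

lemma mollifier_fourier:
  assumes fin: "finite I" and s: "s > 0"
  shows "complex_of_real (mollifier I s z) =
    complex_of_real ((1 / sqrt (2 * pi * s\<^sup>2)) ^ card I) *
      (\<integral>\<tau>. iexp (ip I \<tau> (\<lambda>k. z k / s)) \<partial>gauss I)"
proof -
  interpret gauss_prod: product_prob_space "\<lambda>_. std_normal_distribution" I
    by (rule product_prob_space_gauss)
  have "(\<integral>\<tau>. iexp (ip I \<tau> (\<lambda>k. z k / s)) \<partial>gauss I) =
      (\<integral>\<tau>. (\<Prod>k\<in>I. iexp (\<tau> k * (z k / s))) \<partial>gauss I)"
    by (intro Bochner_Integration.integral_cong refl)
      (simp only: ip_def of_real_sum sum_distrib_left exp_sum[OF fin])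
  also have "\<dots> = (\<Prod>k\<in>I. \<integral>\<tau>. iexp (\<tau> * (z k / s)) \<partial>std_normal_distribution)"
    by (intro gauss_prod.product_integral_prod fin integral_iexp_std_normal)
  also have "\<dots> = (\<Prod>k\<in>I. complex_of_real (exp (- ((z k / s)\<^sup>2) / 2)))"
    by (simp only: integral_iexp_std_normal)
  also have "complex_of_real ((1 / sqrt (2 * pi * s\<^sup>2)) ^ card I) * \<dots> =
      complex_of_real (\<Prod>k\<in>I. (1 / sqrt (2 * pi * s\<^sup>2)) * exp (- ((z k / s)\<^sup>2) / 2))"
    by (simp only: of_real_prod[symmetric] of_real_mult[symmetric] prod.distrib prod_constant)
  also have "\<dots> = complex_of_real (mollifier I s z)"
    unfolding mollifier_def normal_density_def by (simp add: power_divide mult.commute)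
  finally show ?thesis by simp
qed

section \<open>Levy's continuity theorem\<close>

text \<open>Fubini brings the characteristic function of Q inside the Gaussian average over
  frequencies. Pointwise convergence of characteristic functions thus becomes pointwise convergence
  of smoothed densities, by dominated convergence with bound 1.\<close>

lemma mollified_fourier:
  assumes fin: "finite I" and s: "s > 0" and Q: "prob_space Q" "sets Q = sets (euclid I)"
  shows "complex_of_real (\<integral>x. mollifier I s (\<lambda>k. y k - x k) \<partial>Q) =
    complex_of_real ((1 / sqrt (2 * pi * s\<^sup>2)) ^ card I) *
      (\<integral>\<tau>. iexp (ip I \<tau> (\<lambda>k. y k / s)) * (\<integral>x. iexp (ip I (\<lambda>k. - \<tau> k / s) x) \<partial>Q) \<partial>gauss I)"
proof -
  interpret Q: prob_space Q by fact
  interpret G: prob_space "gauss I" by (rule prob_space_gauss)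
  interpret QG: pair_prob_space Q "gauss I" by unfold_locales
  note [measurable_cong] = Q(2) sets_gauss[of I]
  have split: "iexp (ip I \<tau> (\<lambda>k. (y k - x k) / s)) =
      iexp (ip I \<tau> (\<lambda>k. y k / s)) * iexp (ip I (\<lambda>k. - \<tau> k / s) x)" for \<tau> x
  proof -
    have "ip I \<tau> (\<lambda>k. (y k - x k) / s) = ip I \<tau> (\<lambda>k. y k / s) + ip I (\<lambda>k. - \<tau> k / s) x"
      unfolding ip_def by (simp add: diff_divide_distrib right_diff_distrib sum.distrib sum_subtractf sum_negf)
    then show ?thesis by (simp only: of_real_add distrib_left exp_add)
  qed
  have int: "integrable (Q \<Otimes>\<^sub>M gauss I) (\<lambda>(x, \<tau>). iexp (ip I \<tau> (\<lambda>k. (y k - x k) / s)))"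
    unfolding ip_def by (intro QG.integrable_const_bound[where B=1]) (auto split: prod.splits)
  have "complex_of_real (\<integral>x. mollifier I s (\<lambda>k. y k - x k) \<partial>Q) =
      (\<integral>x. complex_of_real (mollifier I s (\<lambda>k. y k - x k)) \<partial>Q)" by simp
  also have "\<dots> = (\<integral>x. complex_of_real ((1 / sqrt (2 * pi * s\<^sup>2)) ^ card I) *
      (\<integral>\<tau>. iexp (ip I \<tau> (\<lambda>k. (y k - x k) / s)) \<partial>gauss I) \<partial>Q)"
    by (simp only: mollifier_fourier[OF fin s])
  also have "\<dots> = complex_of_real ((1 / sqrt (2 * pi * s\<^sup>2)) ^ card I) *
      (\<integral>x. (\<integral>\<tau>. iexp (ip I \<tau> (\<lambda>k. (y k - x k) / s)) \<partial>gauss I) \<partial>Q)"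
    by (rule integral_mult_right_zero)
  also have "(\<integral>x. (\<integral>\<tau>. iexp (ip I \<tau> (\<lambda>k. (y k - x k) / s)) \<partial>gauss I) \<partial>Q) =
      (\<integral>\<tau>. (\<integral>x. iexp (ip I \<tau> (\<lambda>k. (y k - x k) / s)) \<partial>Q) \<partial>gauss I)"
    using QG.Fubini_integral[OF int] by simp
  also have "\<dots> = (\<integral>\<tau>. iexp (ip I \<tau> (\<lambda>k. y k / s)) *
      (\<integral>x. iexp (ip I (\<lambda>k. - \<tau> k / s) x) \<partial>Q) \<partial>gauss I)"
    by (simp only: split integral_mult_right_zero)
  finally show ?thesis .
qed

lemma mollified_tendsto:
  assumes fin: "finite I" and s: "s > 0"
    and Q: "\<And>n. prob_space (Q n)" "\<And>n. sets (Q n) = sets (euclid I)"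
    and P: "prob_space P" "sets P = sets (euclid I)"
    and conv: "\<And>t. (\<lambda>n. \<integral>x. iexp (ip I t x) \<partial>Q n) \<longlonglongrightarrow> (\<integral>x. iexp (ip I t x) \<partial>P)"
  shows "(\<lambda>n. \<integral>x. mollifier I s (\<lambda>k. y k - x k) \<partial>Q n) \<longlonglongrightarrow> (\<integral>x. mollifier I s (\<lambda>k. y k - x k) \<partial>P)"
proof -
  interpret G: prob_space "gauss I" by (rule prob_space_gauss)
  note [measurable_cong] = sets_gauss[of I]
  have meas: "(\<lambda>\<tau>. \<integral>x. iexp (ip I (\<lambda>k. - \<tau> k / s) x) \<partial>R) \<in> borel_measurable (gauss I)"
    if R: "prob_space R" "sets R = sets (euclid I)" for R
  proof -
    interpret R: prob_space R by fact
    note [measurable_cong] = R(2)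
    show ?thesis unfolding ip_def by measurable
  qed
  have bound: "norm (\<integral>x. iexp (ip I t x) \<partial>R) \<le> 1" if R: "prob_space R" "sets R = sets (euclid I)" for R t
  proof -
    interpret R: prob_space R by fact
    have "norm (\<integral>x. iexp (ip I t x) \<partial>R) \<le> (\<integral>x. norm (iexp (ip I t x)) \<partial>R)" by (rule integral_norm_bound)
    then show ?thesis by (simp add: R.prob_space)
  qed
  have "(\<lambda>n. \<integral>\<tau>. iexp (ip I \<tau> (\<lambda>k. y k / s)) * (\<integral>x. iexp (ip I (\<lambda>k. - \<tau> k / s) x) \<partial>Q n) \<partial>gauss I)
    \<longlonglongrightarrow> (\<integral>\<tau>. iexp (ip I \<tau> (\<lambda>k. y k / s)) * (\<integral>x. iexp (ip I (\<lambda>k. - \<tau> k / s) x) \<partial>P) \<partial>gauss I)"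
  proof (rule integral_dominated_convergence[where w="\<lambda>_. 1"])
    have [measurable]: "(\<lambda>\<tau>. iexp (ip I \<tau> (\<lambda>k. y k / s))) \<in> borel_measurable (gauss I)"
      unfolding ip_def by measurable
    note [measurable] = meas[OF P] meas[OF Q]
    show "(\<lambda>\<tau>. iexp (ip I \<tau> (\<lambda>k. y k / s)) * (\<integral>x. iexp (ip I (\<lambda>k. - \<tau> k / s) x) \<partial>P)) \<in> borel_measurable (gauss I)"
      by measurable
    show "(\<lambda>\<tau>. iexp (ip I \<tau> (\<lambda>k. y k / s)) * (\<integral>x. iexp (ip I (\<lambda>k. - \<tau> k / s) x) \<partial>Q n)) \<in> borel_measurable (gauss I)" for n
      by measurable
    show "AE \<tau> in gauss I. (\<lambda>n. iexp (ip I \<tau> (\<lambda>k. y k / s)) * (\<integral>x. iexp (ip I (\<lambda>k. - \<tau> k / s) x) \<partial>Q n))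
        \<longlonglongrightarrow> iexp (ip I \<tau> (\<lambda>k. y k / s)) * (\<integral>x. iexp (ip I (\<lambda>k. - \<tau> k / s) x) \<partial>P)"
      by (intro AE_I2 tendsto_mult conv tendsto_const)
    show "AE \<tau> in gauss I. norm (iexp (ip I \<tau> (\<lambda>k. y k / s)) * (\<integral>x. iexp (ip I (\<lambda>k. - \<tau> k / s) x) \<partial>Q n)) \<le> 1" for n
      using bound[OF Q] by (intro AE_I2) (simp add: norm_mult)
  qed simp
  then have "(\<lambda>n. complex_of_real (\<integral>x. mollifier I s (\<lambda>k. y k - x k) \<partial>Q n))
      \<longlonglongrightarrow> complex_of_real (\<integral>x. mollifier I s (\<lambda>k. y k - x k) \<partial>P)"
    unfolding mollified_fourier[OF fin s Q] mollified_fourier[OF fin s P] by (intro tendsto_mult tendsto_const)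
  then show ?thesis by (simp only: tendsto_of_real_iff)
qed

lemma mollifier_restrict: "mollifier I s (restrict z I) = mollifier I s z"
  unfolding mollifier_def by (auto intro: prod.cong)

lemma mollifier_shift:
  assumes fin: "finite I" and s: "s > 0"
  shows "integrable (leb I) (\<lambda>y. mollifier I s (\<lambda>k. y k - x k))"
    "(\<integral>y. mollifier I s (\<lambda>k. y k - x k) \<partial>leb I) = 1"
    "integrable (leb I) (\<lambda>y. L2_set (\<lambda>k. y k - x k) I * mollifier I s (\<lambda>k. y k - x k))"
    "(\<integral>y. L2_set (\<lambda>k. y k - x k) I * mollifier I s (\<lambda>k. y k - x k) \<partial>leb I) \<le> s * (card I + 1)"
proof -
  have m: "mollifier I s \<in> borel_measurable (leb I)" by (simp add: measurable_leb)
  note * = integral_leb_translate[OF fin m mollifier_restrict]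
  show "integrable (leb I) (\<lambda>y. mollifier I s (\<lambda>k. y k - x k))"
    "(\<integral>y. mollifier I s (\<lambda>k. y k - x k) \<partial>leb I) = 1"
    using * mollifier_integral[OF fin s] by auto
  have m2: "(\<lambda>y. L2_set y I * mollifier I s y) \<in> borel_measurable (leb I)"
    unfolding measurable_leb by measurable
  have r2: "L2_set (restrict y I) I * mollifier I s (restrict y I) = L2_set y I * mollifier I s y" for y
    by (simp add: mollifier_restrict L2_set_def)
  note ** = integral_leb_translate[OF fin m2 r2]
  \<comment> \<open>From 2 s |y| \<le> |y|^2 + s^2 follows |y| \<le> |y|^2 / s + s. This needs only
    second moments, and the mean of the right-hand side is s * (card I + 1).\<close>
  define w where "w = (\<lambda>y. (\<Sum>k\<in>I. (y k)\<^sup>2 * mollifier I s y) / s + s * mollifier I s y)"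
  have w: "integrable (leb I) w" unfolding w_def
    using mollifier_integral[OF fin s] by (intro Bochner_Integration.integrable_add integrable_divide_zero
      Bochner_Integration.integrable_sum integrable_mult_right) auto
  have le: "L2_set y I * mollifier I s y \<le> w y" for y
  proof -
    have "0 \<le> (L2_set y I - s)\<^sup>2" by simp
    then have "2 * (L2_set y I * s) \<le> (L2_set y I)\<^sup>2 + s * s"
      by (simp add: power2_diff power2_eq_square algebra_simps)
    moreover have "0 \<le> L2_set y I * s" using s by (simp add: L2_set_nonneg)
    ultimately have "L2_set y I * s \<le> (L2_set y I)\<^sup>2 + s * s" by linarith
    then have "L2_set y I \<le> (L2_set y I)\<^sup>2 / s + s" using s by (simp add: field_simps)
    also have "(L2_set y I)\<^sup>2 = (\<Sum>k\<in>I. (y k)\<^sup>2)" by (simp add: L2_set_def sum_nonneg)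
    finally have "L2_set y I * mollifier I s y \<le> ((\<Sum>k\<in>I. (y k)\<^sup>2) / s + s) * mollifier I s y"
      by (intro mult_right_mono mollifier_nonneg)
    then show ?thesis by (simp add: w_def sum_distrib_right distrib_right)
  qed
  have int: "integrable (leb I) (\<lambda>y. L2_set y I * mollifier I s y)"
    using le by (intro Bochner_Integration.integrable_bound[OF w m2] AE_I2)
      (simp add: abs_mult L2_set_nonneg mollifier_nonneg order_trans[OF le abs_ge_self])
  show "integrable (leb I) (\<lambda>y. L2_set (\<lambda>k. y k - x k) I * mollifier I s (\<lambda>k. y k - x k))"
    using **(2)[OF int] .
  have "(\<integral>y. L2_set y I * mollifier I s y \<partial>leb I) \<le> (\<integral>y. w y \<partial>leb I)"
    by (intro integral_mono int w le)
  also have "\<dots> = (\<Sum>k\<in>I. s\<^sup>2) / s + s * 1"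
    unfolding w_def using mollifier_integral[OF fin s]
    by (subst Bochner_Integration.integral_add)
      (auto intro!: integrable_divide_zero Bochner_Integration.integrable_sum simp: Bochner_Integration.integral_sum)
  also have "\<dots> = s * (card I + 1)" using s by (simp add: power2_eq_square algebra_simps)
  finally show "(\<integral>y. L2_set (\<lambda>k. y k - x k) I * mollifier I s (\<lambda>k. y k - x k) \<partial>leb I) \<le> s * (card I + 1)"
    unfolding **(1) .
qed

section \<open>Laws with Gaussian noise added\<close>

definition smoothed :: "'i set \<Rightarrow> real \<Rightarrow> ('i \<Rightarrow> real) measure \<Rightarrow> ('i \<Rightarrow> real) \<Rightarrow> real"
  where "smoothed I s Q y = (\<integral>x. mollifier I s (\<lambda>k. y k - x k) \<partial>Q)"

text \<open>\<open>smoothed I s Q\<close> is the density of Q with independent noise of mean size at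
  most s * (card I + 1); the noise moves the mean of F by at most L times this size, whatever Q
  is.\<close>

lemma smoothed_props:
  assumes fin: "finite I" and s: "s > 0" and Q: "prob_space Q" "sets Q = sets (euclid I)"
    and F: "lip I L F" and B: "\<And>x. \<bar>F x\<bar> \<le> B" and L: "L \<ge> 0"
  shows "integrable (leb I) (smoothed I s Q)" "(\<integral>y. smoothed I s Q y \<partial>leb I) = 1"
    "\<bar>(\<integral>y. F y * smoothed I s Q y \<partial>leb I) - (\<integral>x. F x \<partial>Q)\<bar> \<le> L * s * (card I + 1)"
proof -
  interpret Q: prob_space Q by fact
  interpret leb: sigma_finite_measure "leb I" by (rule lborel_prod.sigma_finite[OF fin])
  interpret QL: pair_sigma_finite Q "leb I" by unfold_locales
  note [measurable_cong] = Q(2) sets_leb[of I]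
  note ms = mollifier_shift[OF fin s]
  have [measurable]: "F \<in> borel_measurable (euclid I)" by (rule lip_measurable[OF fin F])
  have [measurable]: "(\<lambda>(x, y). mollifier I s (\<lambda>k. y k - x k)) \<in> borel_measurable (Q \<Otimes>\<^sub>M leb I)"
    unfolding mollifier_def by measurable
  have m: "integrable (Q \<Otimes>\<^sub>M leb I) (\<lambda>(x, y). mollifier I s (\<lambda>k. y k - x k))"
    by (rule QL.Fubini_integrable) (auto simp: ms mollifier_nonneg)
  have Fm: "integrable (Q \<Otimes>\<^sub>M leb I) (\<lambda>(x, y). F y * mollifier I s (\<lambda>k. y k - x k))"
  proof (rule Bochner_Integration.integrable_bound[OF integrable_mult_right[OF m, of B]])
    have "B \<ge> 0" using B[of undefined] by linarith
    then show "AE z in Q \<Otimes>\<^sub>M leb I. norm (case z of (x, y) \<Rightarrow> F y * mollifier I s (\<lambda>k. y k - x k))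
        \<le> norm (B * (case z of (x, y) \<Rightarrow> mollifier I s (\<lambda>k. y k - x k)))"
      using B by (intro AE_I2) (auto simp: abs_mult intro!: mult_right_mono split: prod.splits)
  qed measurable
  show "integrable (leb I) (smoothed I s Q)"
    using QL.integrable_snd[OF m] by (simp add: smoothed_def[abs_def])
  have "(\<integral>y. smoothed I s Q y \<partial>leb I) = (\<integral>x. (\<integral>y. mollifier I s (\<lambda>k. y k - x k) \<partial>leb I) \<partial>Q)"
    unfolding smoothed_def using QL.Fubini_integral[OF m] by simp
  then show "(\<integral>y. smoothed I s Q y \<partial>leb I) = 1" by (simp add: ms Q.prob_space)
  have Q_F: "integrable Q F" using B by (intro Q.integrable_const_bound[where B=B]) auto
  have iF: "integrable (leb I) (\<lambda>y. F y * mollifier I s (\<lambda>k. y k - x k))" for x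
    using B by (intro Bochner_Integration.integrable_bound[OF integrable_mult_right[OF ms(1)[of x], of B]])
      (auto simp: abs_mult measurable_leb mollifier_def intro!: mult_mono order_trans[OF B abs_ge_self])
  have "(\<integral>y. F y * smoothed I s Q y \<partial>leb I) = (\<integral>y. (\<integral>x. F y * mollifier I s (\<lambda>k. y k - x k) \<partial>Q) \<partial>leb I)"
    unfolding smoothed_def by simp
  also have "\<dots> = (\<integral>x. (\<integral>y. F y * mollifier I s (\<lambda>k. y k - x k) \<partial>leb I) \<partial>Q)"
    using QL.Fubini_integral[OF Fm] by simp
  finally have eq: "(\<integral>y. F y * smoothed I s Q y \<partial>leb I) - (\<integral>x. F x \<partial>Q) =
      (\<integral>x. (\<integral>y. F y * mollifier I s (\<lambda>k. y k - x k) \<partial>leb I) - F x \<partial>Q)"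
    using QL.integrable_fst[OF Fm] Q_F by simp
  have "\<bar>(\<integral>y. F y * smoothed I s Q y \<partial>leb I) - (\<integral>x. F x \<partial>Q)\<bar> \<le>
      (\<integral>x. \<bar>(\<integral>y. F y * mollifier I s (\<lambda>k. y k - x k) \<partial>leb I) - F x\<bar> \<partial>Q)"
    unfolding eq by (rule integral_abs_bound)
  also have "\<dots> \<le> (\<integral>x. L * s * (card I + 1) \<partial>Q)"
  proof (rule integral_mono)
    show "integrable Q (\<lambda>x. \<bar>(\<integral>y. F y * mollifier I s (\<lambda>k. y k - x k) \<partial>leb I) - F x\<bar>)"
      using QL.integrable_fst[OF Fm] Q_F by (intro integrable_abs Bochner_Integration.integrable_diff) auto
    fix x
    have eq: "(\<integral>y. F y * mollifier I s (\<lambda>k. y k - x k) \<partial>leb I) - F x =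
        (\<integral>y. F y * mollifier I s (\<lambda>k. y k - x k) - F x * mollifier I s (\<lambda>k. y k - x k) \<partial>leb I)"
      using iF ms by (subst Bochner_Integration.integral_diff) auto
    have "\<bar>(\<integral>y. F y * mollifier I s (\<lambda>k. y k - x k) \<partial>leb I) - F x\<bar> \<le>
        (\<integral>y. \<bar>F y * mollifier I s (\<lambda>k. y k - x k) - F x * mollifier I s (\<lambda>k. y k - x k)\<bar> \<partial>leb I)"
      unfolding eq by (rule integral_abs_bound)
    also have "\<dots> \<le> (\<integral>y. L * (L2_set (\<lambda>k. y k - x k) I * mollifier I s (\<lambda>k. y k - x k)) \<partial>leb I)"
    proof (rule integral_mono)
      show "integrable (leb I) (\<lambda>y. \<bar>F y * mollifier I s (\<lambda>k. y k - x k) - F x * mollifier I s (\<lambda>k. y k - x k)\<bar>)"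
        using iF ms by (intro integrable_abs Bochner_Integration.integrable_diff integrable_mult_right) auto
      show "integrable (leb I) (\<lambda>y. L * (L2_set (\<lambda>k. y k - x k) I * mollifier I s (\<lambda>k. y k - x k)))"
        using ms by (intro integrable_mult_right) auto
      fix y
      have "\<bar>F y * mollifier I s (\<lambda>k. y k - x k) - F x * mollifier I s (\<lambda>k. y k - x k)\<bar> =
          \<bar>F y - F x\<bar> * mollifier I s (\<lambda>k. y k - x k)"
        by (simp add: left_diff_distrib[symmetric] abs_mult mollifier_nonneg)
      also have "\<dots> \<le> L * L2_set (\<lambda>k. y k - x k) I * mollifier I s (\<lambda>k. y k - x k)"
        by (intro mult_right_mono lipD[OF F] mollifier_nonneg)
      finally show "\<bar>F y * mollifier I s (\<lambda>k. y k - x k) - F x * mollifier I s (\<lambda>k. y k - x k)\<bar> \<le>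
          L * (L2_set (\<lambda>k. y k - x k) I * mollifier I s (\<lambda>k. y k - x k))" by (simp add: mult.assoc)
    qed
    also have "\<dots> \<le> L * (s * (card I + 1))"
      using mult_left_mono[OF ms(4)[of x] L] by simp
    finally show "\<bar>(\<integral>y. F y * mollifier I s (\<lambda>k. y k - x k) \<partial>leb I) - F x\<bar> \<le> L * s * (card I + 1)"
      by (simp add: mult.assoc)
  qed simp
  finally show "\<bar>(\<integral>y. F y * smoothed I s Q y \<partial>leb I) - (\<integral>x. F x \<partial>Q)\<bar> \<le> L * s * (card I + 1)"
    by (simp add: Q.prob_space)
qed

lemma smoothed_nonneg: "smoothed I s Q y \<ge> 0"
  unfolding smoothed_def by (intro integral_nonneg_AE AE_I2 mollifier_nonneg)

text \<open>The smoothed densities converge pointwise and all have mass 1, so by Scheffe they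
  converge in L1, which is enough for every bounded F. Removing the smoothing costs the same for all
  n because F is Lipschitz.\<close>

theorem levy_continuity_lip:
  assumes fin: "finite I"
    and Q: "\<And>n. prob_space (Q n)" "\<And>n. sets (Q n) = sets (euclid I)"
    and P: "prob_space P" "sets P = sets (euclid I)"
    and conv: "\<And>t. (\<lambda>n. \<integral>x. iexp (ip I t x) \<partial>Q n) \<longlonglongrightarrow> (\<integral>x. iexp (ip I t x) \<partial>P)"
    and F: "lip I L F" and B: "\<And>x. \<bar>F x\<bar> \<le> B" and L: "L \<ge> 0"
  shows "(\<lambda>n. \<integral>x. F x \<partial>Q n) \<longlonglongrightarrow> (\<integral>x. F x \<partial>P)"
proof (rule LIMSEQ_I)
  fix r :: real assume r: "r > 0"
  \<comment> \<open>Chosen such that smoothing costs at most r/4 for \<open>Q n\<close> and for P;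
    the L1 distance of the densities contributes the third quarter.\<close>
  define s where "s = r / (4 * (L + 1) * (card I + 1))"
  have s: "s > 0" using r L by (auto simp: s_def)
  have B0: "B \<ge> 0" using B[of undefined] by linarith
  have Ls: "L * s * (card I + 1) \<le> r / 4"
  proof -
    have "L * s * (card I + 1) = r / 4 * (L / (L + 1))" using L by (simp add: s_def divide_simps)
    also have "\<dots> \<le> r / 4 * 1" using L r by (intro mult_left_mono) auto
    finally show ?thesis by simp
  qed
  note sQ = smoothed_props[OF fin s Q F B L] and sP = smoothed_props[OF fin s P F B L]
  have mF: "F \<in> borel_measurable (leb I)" using lip_measurable[OF fin F] by (simp add: measurable_leb)
  have "(\<lambda>n. \<integral>\<^sup>+ y. norm (smoothed I s (Q n) y - smoothed I s P y) \<partial>leb I) \<longlonglongrightarrow> 0"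
  proof (rule Scheffe_lemma2)
    show "AE y in leb I. (\<lambda>n. smoothed I s (Q n) y) \<longlonglongrightarrow> smoothed I s P y"
      unfolding smoothed_def by (intro AE_I2 mollified_tendsto fin s Q P conv)
    show "(\<integral>\<^sup>+ y. norm (smoothed I s (Q n) y) \<partial>leb I) \<le> (\<integral>\<^sup>+ y. norm (smoothed I s P y) \<partial>leb I)" for n
      using sQ(1,2)[of n] sP(1,2) by (simp add: smoothed_nonneg nn_integral_eq_integral)
  qed (use sQ(1) sP(1) in auto)
  then have "(\<lambda>n. B * (\<integral>y. \<bar>smoothed I s (Q n) y - smoothed I s P y\<bar> \<partial>leb I)) \<longlonglongrightarrow> B * 0"
  proof (intro tendsto_mult tendsto_const)
    have "(\<integral>\<^sup>+ y. norm (smoothed I s (Q n) y - smoothed I s P y) \<partial>leb I) =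
        ennreal (\<integral>y. \<bar>smoothed I s (Q n) y - smoothed I s P y\<bar> \<partial>leb I)" for n
      using sQ(1)[of n] sP(1) by (subst nn_integral_eq_integral) auto
    moreover assume "(\<lambda>n. \<integral>\<^sup>+ y. norm (smoothed I s (Q n) y - smoothed I s P y) \<partial>leb I) \<longlonglongrightarrow> 0"
    ultimately have "(\<lambda>n. ennreal (\<integral>y. \<bar>smoothed I s (Q n) y - smoothed I s P y\<bar> \<partial>leb I)) \<longlonglongrightarrow> ennreal 0"
      by simp
    then show "(\<lambda>n. \<integral>y. \<bar>smoothed I s (Q n) y - smoothed I s P y\<bar> \<partial>leb I) \<longlonglongrightarrow> 0"
      by (subst (asm) tendsto_ennreal_iff) (auto intro: integral_nonneg_AE)
  qed
  then have "\<forall>\<^sub>F n in sequentially. B * (\<integral>y. \<bar>smoothed I s (Q n) y - smoothed I s P y\<bar> \<partial>leb I) < r / 4"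
    using r by (intro order_tendstoD(2)) auto
  then obtain n0 where n0: "\<And>n. n \<ge> n0 \<Longrightarrow>
      B * (\<integral>y. \<bar>smoothed I s (Q n) y - smoothed I s P y\<bar> \<partial>leb I) < r / 4"
    by (auto simp: eventually_sequentially)
  have "norm ((\<integral>x. F x \<partial>Q n) - (\<integral>x. F x \<partial>P)) < r" if "n \<ge> n0" for n
  proof -
    have iF: "integrable (leb I) (\<lambda>y. F y * smoothed I s R y)" if "integrable (leb I) (smoothed I s R)" for R
      using B mF that by (intro Bochner_Integration.integrable_bound[OF integrable_mult_right[OF that, of B]])
        (auto simp: abs_mult intro!: mult_right_mono order_trans[OF B abs_ge_self])
    have "\<bar>(\<integral>y. F y * smoothed I s (Q n) y \<partial>leb I) - (\<integral>y. F y * smoothed I s P y \<partial>leb I)\<bar> =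
        \<bar>\<integral>y. F y * smoothed I s (Q n) y - F y * smoothed I s P y \<partial>leb I\<bar>"
      using iF sQ(1) sP(1) by (subst Bochner_Integration.integral_diff) auto
    also have "\<dots> \<le> (\<integral>y. \<bar>F y * smoothed I s (Q n) y - F y * smoothed I s P y\<bar> \<partial>leb I)"
      by (rule integral_abs_bound)
    also have "\<dots> \<le> (\<integral>y. B * \<bar>smoothed I s (Q n) y - smoothed I s P y\<bar> \<partial>leb I)"
    proof (rule integral_mono)
      show "integrable (leb I) (\<lambda>y. \<bar>F y * smoothed I s (Q n) y - F y * smoothed I s P y\<bar>)"
        by (intro integrable_abs Bochner_Integration.integrable_diff iF sQ(1) sP(1))
      show "integrable (leb I) (\<lambda>y. B * \<bar>smoothed I s (Q n) y - smoothed I s P y\<bar>)"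
        by (intro integrable_mult_right integrable_abs Bochner_Integration.integrable_diff sQ(1) sP(1))
      show "\<bar>F y * smoothed I s (Q n) y - F y * smoothed I s P y\<bar> \<le> B * \<bar>smoothed I s (Q n) y - smoothed I s P y\<bar>" for y
        unfolding right_diff_distrib[symmetric] abs_mult by (intro mult_right_mono B) auto
    qed
    also have "\<dots> < r / 4" using n0[OF that] by simp
    finally show ?thesis using sQ(3)[of n] sP(3) Ls r unfolding real_norm_def by linarith
  qed
  then show "\<exists>n0. \<forall>n\<ge>n0. norm ((\<integral>x. F x \<partial>Q n) - (\<integral>x. F x \<partial>P)) < r" by blast
qed

section \<open>Random walks with rare jumps\<close>

text \<open>The logarithm of the Laplace transform of a centred Poisson variable with intensity
  1.\<close>

definition phi2 :: "real \<Rightarrow> real"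
  where "phi2 x = exp x - 1 - x"

lemma phi2_nonneg: "phi2 x \<ge> 0"
  unfolding phi2_def using exp_ge_add_one_self[of x] by linarith

text \<open>For z \<ge> 0 the difference of \<open>phi2 z\<close> and \<open>phi2 (- z)\<close>
  vanishes at 0 and has the derivative exp z + exp (- z) - 2, which is a square.\<close>

lemma phi2_abs: "phi2 x \<le> phi2 \<bar>x\<bar>"
proof (cases "x \<ge> 0")
  case False
  define z where "z = - x"
  have z: "z \<ge> 0" using False by (simp add: z_def)
  have "(\<lambda>z. exp z - exp (- z) - 2 * z) 0 \<le> (\<lambda>z. exp z - exp (- z) - 2 * z) z"
  proof (rule DERIV_nonneg_imp_nondecreasing[OF z])
    fix y :: real assume "0 \<le> y" "y \<le> z"
    have "0 \<le> (exp (y / 2) - exp (- y / 2))\<^sup>2" by simp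
    also have "\<dots> = (exp (y / 2))\<^sup>2 + (exp (- y / 2))\<^sup>2 - 2 * exp (y / 2) * exp (- y / 2)"
      by (rule power2_diff)
    also have "\<dots> = exp y + exp (- y) - 2"
    proof -
      have "exp (y / 2) * exp (- y / 2) = 1" by (simp add: exp_add[symmetric])
      moreover have "(exp (y / 2))\<^sup>2 = exp y" "(exp (- y / 2))\<^sup>2 = exp (- y)"
        using exp_double[of "y / 2"] exp_double[of "- y / 2"] by simp_all
      ultimately show ?thesis by (simp only: mult.assoc)
    qed
    finally show "\<exists>d. ((\<lambda>z. exp z - exp (- z) - 2 * z) has_real_derivative d) (at y) \<and> 0 \<le> d"
      by (intro exI[of _ "exp y + exp (- y) - 2"]) (auto intro!: derivative_eq_intros)
  qed
  then show ?thesis using False by (simp add: phi2_def z_def)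
qed simp

text \<open>The power series of \<open>phi2\<close> starts at exponent 2, so each term gains at
  least the factor s^2. With s = |u| / R this is where the ratio V / R^2 comes from.\<close>

lemma phi2_scale:
  assumes "0 \<le> s" "s \<le> 1" "0 \<le> z"
  shows "phi2 (s * z) \<le> s\<^sup>2 * phi2 z"
proof -
  have eq: "phi2 x = (\<Sum>n. inverse (fact (n + 2)) *\<^sub>R (x ^ (n + 2)))" for x
    unfolding phi2_def using exp_first_two_terms[of x] by simp
  have sm: "summable (\<lambda>n. inverse (fact (n + 2)) *\<^sub>R (x ^ (n + 2)))" for x :: real
    using summable_ignore_initial_segment[OF summable_exp_generic[of x], of 2]
    by (simp add: divide_inverse mult.commute)
  have "phi2 (s * z) \<le> (\<Sum>n. s\<^sup>2 * (inverse (fact (n + 2)) *\<^sub>R (z ^ (n + 2))))"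
    unfolding eq
  proof (rule suminf_le)
    fix n
    have "(s * z) ^ (n + 2) = s ^ n * (s\<^sup>2 * z ^ (n + 2))"
      by (simp add: power_mult_distrib power_add power2_eq_square)
    also have "\<dots> \<le> 1 * (s\<^sup>2 * z ^ (n + 2))"
      using assms by (intro mult_right_mono power_le_one) auto
    finally have "inverse (fact (n + 2)) * (s * z) ^ (n + 2) \<le>
        inverse (fact (n + 2)) * (1 * (s\<^sup>2 * z ^ (n + 2)))"
      by (rule mult_left_mono) simp
    then show "inverse (fact (n + 2)) *\<^sub>R (s * z) ^ (n + 2) \<le> s\<^sup>2 * (inverse (fact (n + 2)) *\<^sub>R z ^ (n + 2))"
      by (simp add: mult.left_commute)
  qed (intro summable_mult sm)+
  also have "\<dots> = s\<^sup>2 * phi2 z" unfolding eq by (rule suminf_mult[OF sm])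
  finally show ?thesis .
qed

text \<open>The case distinction is there because the zero measure cannot be normalised.\<close>

definition jump_law :: "'i set \<Rightarrow> ('i \<Rightarrow> real) measure \<Rightarrow> real \<Rightarrow> ('i \<Rightarrow> real) measure"
  where "jump_law I \<kappa> n =
    (if measure \<kappa> (space \<kappa>) = 0 then return (euclid I) (\<lambda>k\<in>I. 0)
     else distr (measure_pmf (bernoulli_pmf (measure \<kappa> (space \<kappa>) / n)) \<Otimes>\<^sub>M
         density \<kappa> (\<lambda>_. ennreal (1 / measure \<kappa> (space \<kappa>)))) (euclid I)
       (\<lambda>(b, u). if b then u else (\<lambda>k\<in>I. 0)))"

text \<open>The step is zero except with probability
  \<open>measure \<kappa> (space \<kappa>) / n\<close>, when it follows the normalised \<kappa>. The
  mass cancels in the mean, which gives one formula for all \<kappa>, including those of mass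
  zero.\<close>

lemma jump_law:
  fixes g :: "('i \<Rightarrow> real) \<Rightarrow> 'b::{banach, second_countable_topology}"
  assumes \<kappa>: "finite_measure \<kappa>" "sets \<kappa> = sets (euclid I)"
    and n: "n > 0" "measure \<kappa> (space \<kappa>) \<le> n"
  shows "prob_space (jump_law I \<kappa> n)" "sets (jump_law I \<kappa> n) = sets (euclid I)"
    and "g \<in> borel_measurable (euclid I) \<Longrightarrow> integrable \<kappa> g \<Longrightarrow> integrable (jump_law I \<kappa> n) g"
    and "g \<in> borel_measurable (euclid I) \<Longrightarrow> integrable \<kappa> g \<Longrightarrow>
      (\<integral>u. g u \<partial>jump_law I \<kappa> n) = g (\<lambda>k\<in>I. 0) + (1 / n) *\<^sub>R (\<integral>u. g u - g (\<lambda>k\<in>I. 0) \<partial>\<kappa>)"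
proof -
  interpret \<kappa>: finite_measure \<kappa> by fact
  define l where "l = measure \<kappa> (space \<kappa>)"
  let ?z = "\<lambda>k\<in>I. 0::real"
  have z: "?z \<in> space (euclid I)" by (simp add: space_PiM)
  have "prob_space (jump_law I \<kappa> n) \<and> sets (jump_law I \<kappa> n) = sets (euclid I) \<and>
    (g \<in> borel_measurable (euclid I) \<longrightarrow> integrable \<kappa> g \<longrightarrow> integrable (jump_law I \<kappa> n) g \<and>
      (\<integral>u. g u \<partial>jump_law I \<kappa> n) = g ?z + (1 / n) *\<^sub>R (\<integral>u. g u - g ?z \<partial>\<kappa>))"
  proof (cases "l = 0")
    case True
    then have jl: "jump_law I \<kappa> n = return (euclid I) ?z" by (simp add: jump_law_def l_def)
    have "space \<kappa> \<in> null_sets \<kappa>"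
      using True by (intro null_setsI) (simp_all add: l_def \<kappa>.emeasure_eq_measure)
    then have "AE u in \<kappa>. g u - g ?z = 0" by (rule AE_I') auto
    then have 0: "(\<integral>u. g u - g ?z \<partial>\<kappa>) = 0" by (rule integral_eq_zero_AE)
    have "integrable (return (euclid I) ?z) g" if "g \<in> borel_measurable (euclid I)"
      using that z by (intro integrableI_bounded) (auto simp: nn_integral_return)
    moreover have "(\<integral>u. g u \<partial>return (euclid I) ?z) = g ?z" if "g \<in> borel_measurable (euclid I)"
      using z that by (rule integral_return)
    moreover have "prob_space (return (euclid I) ?z)" by (rule prob_space_return[OF z])
    ultimately show ?thesis unfolding jl 0 scaleR_zero_right add_0_right sets_return by blast
  next
    case False
    then have l: "l > 0" by (simp add: l_def less_le)
    define B where "B = measure_pmf (bernoulli_pmf (l / n))"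
    define N where "N = density \<kappa> (\<lambda>_. ennreal (1 / l))"
    let ?h = "\<lambda>(b, u). if b then u else ?z"
    have jl: "jump_law I \<kappa> n = distr (B \<Otimes>\<^sub>M N) (euclid I) ?h"
      using False by (simp add: jump_law_def l_def B_def N_def)
    have [measurable_cong]: "sets N = sets (euclid I)" by (simp add: N_def \<kappa>)
    have [measurable_cong]: "sets B = sets (count_space UNIV)" by (simp add: B_def)
    interpret B: prob_space B unfolding B_def by (rule measure_pmf.prob_space_axioms)
    interpret N: prob_space N
    proof
      have "emeasure N (space N) = ennreal (1 / l) * emeasure \<kappa> (space \<kappa>)"
        unfolding N_def by (simp add: emeasure_density_const)
      also have "\<dots> = ennreal (1 / l * l)" using l
        by (subst ennreal_mult) (auto simp: \<kappa>.emeasure_eq_measure l_def)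
      finally show "emeasure N (space N) = 1" using l by simp
    qed
    interpret BN: pair_prob_space B N by unfold_locales
    have h [measurable]: "?h \<in> measurable (B \<Otimes>\<^sub>M N) (euclid I)"
      by measurable
    have "integrable (jump_law I \<kappa> n) g \<and>
      (\<integral>u. g u \<partial>jump_law I \<kappa> n) = g ?z + (1 / n) *\<^sub>R (\<integral>u. g u - g ?z \<partial>\<kappa>)"
      if g [measurable]: "g \<in> borel_measurable (euclid I)" and gi: "integrable \<kappa> g"
    proof
      have alg: "(1 / n) *\<^sub>R (D + l *\<^sub>R c) + (1 - l / n) *\<^sub>R c = c + (1 / n) *\<^sub>R D" for c D :: 'b
        by (simp add: algebra_simps)
      have gk: "g \<in> borel_measurable \<kappa>" using gi by (rule borel_measurable_integrable)
      have gN: "integrable N g" unfolding N_def using gi gk l by (subst integrable_density) auto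
      have intN: "integrable N (\<lambda>u. g (if b then u else ?z))" for b
        using gN by (cases b) auto
      have int: "integrable (B \<Otimes>\<^sub>M N) (\<lambda>(b, u). g (if b then u else ?z))"
      proof (rule BN.Fubini_integrable)
        show "integrable B (\<lambda>b. \<integral>u. norm (case (b, u) of (b, u) \<Rightarrow> g (if b then u else ?z)) \<partial>N)"
          unfolding B_def by (intro integrable_measure_pmf_finite) simp
      qed (use intN in auto)
      then have int': "integrable (B \<Otimes>\<^sub>M N) (\<lambda>p. g (?h p))" by (simp add: case_prod_unfold)
      then show "integrable (jump_law I \<kappa> n) g" unfolding jl by (simp add: integrable_distr_eq)
      have "(\<integral>u. g u \<partial>jump_law I \<kappa> n) = (\<integral>p. g (?h p) \<partial>(B \<Otimes>\<^sub>M N))"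
        unfolding jl by (rule integral_distr) measurable
      also have "\<dots> = (\<integral>b. (\<integral>u. g (if b then u else ?z) \<partial>N) \<partial>B)"
        using BN.integral_fst'[OF int'] by simp
      also have "\<dots> = (l / n) *\<^sub>R (\<integral>u. g u \<partial>N) + (1 - l / n) *\<^sub>R g ?z"
      proof -
        have "l / n \<le> 1" "l / n \<ge> 0" using n l by (auto simp: l_def)
        then show ?thesis unfolding B_def
          by (subst integral_measure_pmf[of UNIV]) (auto simp: UNIV_bool N.prob_space)
      qed
      also have "(\<integral>u. g u \<partial>N) = (1 / l) *\<^sub>R (\<integral>u. g u \<partial>\<kappa>)"
        unfolding N_def using l gk by (subst integral_density) auto
      also have "(l / n) *\<^sub>R (1 / l) *\<^sub>R (\<integral>u. g u \<partial>\<kappa>) = (1 / n) *\<^sub>R (\<integral>u. g u \<partial>\<kappa>)"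
        using l by simp
      also have "(\<integral>u. g u \<partial>\<kappa>) = (\<integral>u. g u - g ?z \<partial>\<kappa>) + l *\<^sub>R g ?z"
        using gi by (subst Bochner_Integration.integral_diff) (auto simp: l_def)
      finally show "(\<integral>u. g u \<partial>jump_law I \<kappa> n) = g ?z + (1 / n) *\<^sub>R (\<integral>u. g u - g ?z \<partial>\<kappa>)"
        by (simp only: alg)
    qed
    moreover have "prob_space (jump_law I \<kappa> n)" unfolding jl by (rule BN.prob_space_distr[OF h])
    moreover have "sets (jump_law I \<kappa> n) = sets (euclid I)" unfolding jl by simp
    ultimately show ?thesis by blast
  qed
  then show "prob_space (jump_law I \<kappa> n)" "sets (jump_law I \<kappa> n) = sets (euclid I)"
    and "g \<in> borel_measurable (euclid I) \<Longrightarrow> integrable \<kappa> g \<Longrightarrow> integrable (jump_law I \<kappa> n) g"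
    and "g \<in> borel_measurable (euclid I) \<Longrightarrow> integrable \<kappa> g \<Longrightarrow>
      (\<integral>u. g u \<partial>jump_law I \<kappa> n) = g (\<lambda>k\<in>I. 0) + (1 / n) *\<^sub>R (\<integral>u. g u - g (\<lambda>k\<in>I. 0) \<partial>\<kappa>)"
    by auto
qed

section \<open>Random walks with independent steps\<close>

primrec walk :: "'i set \<Rightarrow> ('i \<Rightarrow> real) measure \<Rightarrow> ('i \<Rightarrow> real) \<Rightarrow> nat \<Rightarrow> ('i \<Rightarrow> real) measure"
  where
    "walk I m x 0 = return (euclid I) (restrict x I)"
  | "walk I m x (Suc k) = distr (walk I m x k \<Otimes>\<^sub>M m) (euclid I) (\<lambda>(y, u). \<lambda>j\<in>I. y j + u j)"

lemma sets_walk [simp]: "sets (walk I m x k) = sets (euclid I)"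
  by (cases k) auto

context
  fixes I :: "'i set" and m :: "('i \<Rightarrow> real) measure"
  assumes m: "prob_space m" "sets m = sets (euclid I)"
begin

lemma step_measurable:
  "(\<lambda>(y, u). \<lambda>j\<in>I. y j + u j) \<in> measurable (walk I m x k \<Otimes>\<^sub>M m) (euclid I)"
proof -
  note [measurable_cong] = m(2) sets_walk[of I m x k]
  show ?thesis by measurable
qed

lemma prob_space_walk: "prob_space (walk I m x k)"
proof (induction k)
  case 0
  show ?case by (auto intro!: prob_space_return simp: space_PiM)
next
  case (Suc k)
  interpret pair_prob_space "walk I m x k" m
    using Suc m(1) by (simp add: pair_prob_space_def pair_sigma_finite_def prob_space_imp_sigma_finite)
  show ?case using prob_space_distr[OF step_measurable] by simp
qed

text \<open>Integrability is assumed in iterated form because the lemma is also applied to the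
  unbounded function \<open>sqdist\<close>.\<close>

lemma walk_Suc:
  fixes g :: "('i \<Rightarrow> real) \<Rightarrow> 'b::{banach, second_countable_topology}"
  assumes g: "g \<in> borel_measurable (euclid I)"
    and int: "\<And>y. y \<in> space (euclid I) \<Longrightarrow> integrable m (\<lambda>u. g (\<lambda>j\<in>I. y j + u j))"
      "integrable (walk I m x k) (\<lambda>y. \<integral>u. norm (g (\<lambda>j\<in>I. y j + u j)) \<partial>m)"
  shows "integrable (walk I m x (Suc k)) g"
    "(\<integral>y. g y \<partial>walk I m x (Suc k)) = (\<integral>y. (\<integral>u. g (\<lambda>j\<in>I. y j + u j) \<partial>m) \<partial>walk I m x k)"
proof -
  interpret W: prob_space "walk I m x k" by (rule prob_space_walk)
  interpret m: prob_space m by (rule m)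
  interpret Wm: pair_prob_space "walk I m x k" m by unfold_locales
  note [measurable_cong] = m(2) sets_walk[of I m x k]
  note [measurable] = g
  have sp: "space (walk I m x k) = space (euclid I)" by (rule sets_eq_imp_space_eq) simp
  have int': "integrable (walk I m x k \<Otimes>\<^sub>M m) (\<lambda>(y, u). g (\<lambda>j\<in>I. y j + u j))"
    using int by (intro Wm.Fubini_integrable) (auto simp: sp)
  then have int'': "integrable (walk I m x k \<Otimes>\<^sub>M m) (\<lambda>p. g ((\<lambda>(y, u). \<lambda>j\<in>I. y j + u j) p))"
    by (simp add: case_prod_unfold)
  show "integrable (walk I m x (Suc k)) g"
    using integrable_distr_eq[OF step_measurable[of x k] g] int'' by simp
  have "(\<integral>y. g y \<partial>walk I m x (Suc k)) = (\<integral>p. g ((\<lambda>(y, u). \<lambda>j\<in>I. y j + u j) p) \<partial>(walk I m x k \<Otimes>\<^sub>M m))"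
    using integral_distr[OF step_measurable[of x k] g] by simp
  also have "\<dots> = (\<integral>y. (\<integral>u. g (\<lambda>j\<in>I. y j + u j) \<partial>m) \<partial>walk I m x k)"
    using Wm.integral_fst'[OF int''] by simp
  finally show "(\<integral>y. g y \<partial>walk I m x (Suc k)) = (\<integral>y. (\<integral>u. g (\<lambda>j\<in>I. y j + u j) \<partial>m) \<partial>walk I m x k)" .
qed

lemma integrable_bounded:
  fixes g :: "('i \<Rightarrow> real) \<Rightarrow> 'b::{banach, second_countable_topology}"
  assumes "prob_space Q" "sets Q = sets (euclid I)" "g \<in> borel_measurable (euclid I)" "\<And>y. norm (g y) \<le> B"
  shows "integrable Q g"
proof -
  interpret prob_space Q by fact
  have "g \<in> borel_measurable Q" using assms(2,3) by (simp cong: measurable_cong_sets)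
  then show ?thesis using assms(4) by (intro integrable_const_bound[where B=B]) auto
qed

lemma walk_Suc_bounded:
  fixes g :: "('i \<Rightarrow> real) \<Rightarrow> 'b::{banach, second_countable_topology}"
  assumes g: "g \<in> borel_measurable (euclid I)" and B: "\<And>y. norm (g y) \<le> B"
  shows "(\<integral>y. g y \<partial>walk I m x (Suc k)) = (\<integral>y. (\<integral>u. g (\<lambda>j\<in>I. y j + u j) \<partial>m) \<partial>walk I m x k)"
proof (rule walk_Suc[OF g])
  interpret m: prob_space m by (rule m)
  note [measurable_cong] = m(2)
  note [measurable] = g
  show "integrable m (\<lambda>u. g (\<lambda>j\<in>I. y j + u j))" for y
    using B by (intro m.integrable_const_bound[where B=B]) auto
  have B0: "0 \<le> B" using order_trans[OF norm_ge_zero B] .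
  have "(\<integral>u. norm (g (\<lambda>j\<in>I. y j + u j)) \<partial>m) \<le> B" for y
  proof -
    have "(\<integral>u. norm (g (\<lambda>j\<in>I. y j + u j)) \<partial>m) \<le> (\<integral>u. B \<partial>m)"
      using B B0 by (intro integral_mono m.integrable_const_bound[where B=B]) auto
    then show ?thesis by (simp add: m.prob_space)
  qed
  then show "integrable (walk I m x k) (\<lambda>y. \<integral>u. norm (g (\<lambda>j\<in>I. y j + u j)) \<partial>m)"
    by (intro integrable_bounded[where B=B] prob_space_walk) (auto simp: integral_nonneg_AE)
qed

lemma walk_char:
  "(\<integral>y. iexp (ip I t y) \<partial>walk I m x k) = iexp (ip I t x) * (\<integral>u. iexp (ip I t u) \<partial>m) ^ k"
proof (induction k)
  case 0
  have "(\<integral>y. iexp (ip I t y) \<partial>walk I m x 0) = iexp (ip I t (restrict x I))"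
    by (simp add: integral_return space_PiM)
  also have "ip I t (restrict x I) = ip I t x" by (simp add: ip_def)
  finally show ?case by simp
next
  case (Suc k)
  have add: "iexp (ip I t (\<lambda>j\<in>I. y j + u j)) = iexp (ip I t y) * iexp (ip I t u)" for y u
  proof -
    have "ip I t (\<lambda>j\<in>I. y j + u j) = ip I t y + ip I t u"
      by (simp add: ip_def distrib_left sum.distrib)
    then show ?thesis by (simp only: of_real_add distrib_left exp_add)
  qed
  have "(\<integral>y. iexp (ip I t y) \<partial>walk I m x (Suc k)) =
      (\<integral>y. (\<integral>u. iexp (ip I t (\<lambda>j\<in>I. y j + u j)) \<partial>m) \<partial>walk I m x k)"
    by (rule walk_Suc_bounded[where B=1]) auto
  also have "\<dots> = (\<integral>y. iexp (ip I t y) \<partial>walk I m x k) * (\<integral>u. iexp (ip I t u) \<partial>m)"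
    by (simp only: add integral_mult_right_zero integral_mult_left_zero)
  also have "\<dots> = iexp (ip I t x) * (\<integral>u. iexp (ip I t u) \<partial>m) ^ Suc k"
    unfolding Suc by simp
  finally show ?case .
qed

text \<open>Translations are isometries, and averaging preserves both the Lipschitz constant and the
  bound. The conditional mean can therefore take the place of F in an induction over the
  steps.\<close>

lemma lip_step:
  assumes fin: "finite I" and F: "lip I L F" and B: "\<And>y. \<bar>F y\<bar> \<le> B"
  shows "lip I L (\<lambda>y. \<integral>u. F (\<lambda>j\<in>I. y j + u j) \<partial>m)" "\<bar>\<integral>u. F (\<lambda>j\<in>I. y j + u j) \<partial>m\<bar> \<le> B"
    "integrable m (\<lambda>u. F (\<lambda>j\<in>I. y j + u j))"
proof -
  interpret m: prob_space m by (rule m)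
  note [measurable_cong] = m(2)
  note [measurable] = lip_measurable[OF fin F]
  have i: "integrable m (\<lambda>u. F (\<lambda>j\<in>I. y j + u j))" for y
    using B by (intro m.integrable_const_bound[where B=B]) auto
  then show "integrable m (\<lambda>u. F (\<lambda>j\<in>I. y j + u j))" .
  have b: "\<bar>\<integral>u. f u \<partial>m\<bar> \<le> b" if "integrable m f" "\<And>u. \<bar>f u\<bar> \<le> b" for f and b :: real
  proof -
    have "\<bar>\<integral>u. f u \<partial>m\<bar> \<le> (\<integral>u. \<bar>f u\<bar> \<partial>m)" by (rule integral_abs_bound)
    also have "\<dots> \<le> (\<integral>u. b \<partial>m)" using that by (intro integral_mono) auto
    finally show ?thesis by (simp add: m.prob_space)
  qed
  show "\<bar>\<integral>u. F (\<lambda>j\<in>I. y j + u j) \<partial>m\<bar> \<le> B" using i B by (rule b)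
  show "lip I L (\<lambda>y. \<integral>u. F (\<lambda>j\<in>I. y j + u j) \<partial>m)"
    unfolding lip_def
  proof (intro allI)
    fix y z
    have eq: "(\<integral>u. F (\<lambda>j\<in>I. y j + u j) \<partial>m) - (\<integral>u. F (\<lambda>j\<in>I. z j + u j) \<partial>m) =
        (\<integral>u. F (\<lambda>j\<in>I. y j + u j) - F (\<lambda>j\<in>I. z j + u j) \<partial>m)"
      using i by simp
    have "\<bar>F (\<lambda>j\<in>I. y j + u j) - F (\<lambda>j\<in>I. z j + u j)\<bar> \<le> L * L2_set (\<lambda>k. y k - z k) I" for u
      using lipD[OF F, of "\<lambda>j\<in>I. y j + u j" "\<lambda>j\<in>I. z j + u j"] by (simp add: L2_set_def)
    then show "\<bar>(\<integral>u. F (\<lambda>j\<in>I. y j + u j) \<partial>m) - (\<integral>u. F (\<lambda>j\<in>I. z j + u j) \<partial>m)\<bar>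
        \<le> L * L2_set (\<lambda>k. y k - z k) I"
      unfolding eq by (intro b Bochner_Integration.integrable_diff i)
  qed
qed

text \<open>The last step is peeled off and F is replaced by its conditional mean G, hence the
  induction with F arbitrary. The number c is the cost of one step; for steps that jump with
  probability of order 1/k these costs add up to an integral with respect to the jump
  measure.\<close>

lemma walk_laplace:
  assumes fin: "finite I" and t: "t \<ge> 0"
    and phi: "integrable m (\<lambda>u. phi2 (t * L2_set u I))" "(\<integral>u. phi2 (t * L2_set u I) \<partial>m) \<le> c"
    and F: "lip I 1 F" and B: "\<And>y. \<bar>F y\<bar> \<le> B"
  shows "(\<integral>y. exp (t * F y) \<partial>walk I m x k) \<le> exp (t * (\<integral>y. F y \<partial>walk I m x k) + k * c)"
  using F B
proof (induction k arbitrary: F)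
  case 0
  then show ?case using lip_measurable[OF fin 0(1)] by (simp add: integral_return space_PiM)
next
  case (Suc k)
  interpret m: prob_space m by (rule m)
  note [measurable_cong] = m(2)
  note F = Suc.prems(1) and B = Suc.prems(2)
  note [measurable] = lip_measurable[OF fin F]
  define G where "G = (\<lambda>y. \<integral>u. F (\<lambda>j\<in>I. y j + u j) \<partial>m)"
  note G = lip_step[OF fin F B, folded G_def]
  have Gb: "\<bar>G y\<bar> \<le> B" for y unfolding G_def by (rule lip_step[OF fin F B])
  have eB: "norm (exp (t * F y)) \<le> exp (t * B)" for y
    using B[of y] t by (auto intro!: mult_left_mono)
  have step: "(\<integral>u. exp (t * F (\<lambda>j\<in>I. y j + u j)) \<partial>m) \<le> exp c * exp (t * G y)" for y
  proof -
    define Y where "Y = (\<lambda>u. F (\<lambda>j\<in>I. y j + u j) - F y)"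
    have Yi: "integrable m Y" unfolding Y_def by (intro Bochner_Integration.integrable_diff G(3)) simp
    have Yb: "\<bar>Y u\<bar> \<le> L2_set u I" for u
    proof -
      have "L2_set (\<lambda>k. (\<lambda>j\<in>I. y j + u j) k - y k) I = L2_set u I"
        by (intro L2_set_cong) auto
      then show ?thesis unfolding Y_def
        using lipD[OF F, of "\<lambda>j\<in>I. y j + u j" y] by (simp only: mult_1)
    qed
    have A: "(\<integral>u. exp (t * F (\<lambda>j\<in>I. y j + u j)) \<partial>m) = exp (t * F y) * (\<integral>u. exp (t * Y u) \<partial>m)"
    proof -
      have "exp (t * F (\<lambda>j\<in>I. y j + u j)) = exp (t * F y) * exp (t * Y u)" for u
        by (simp add: Y_def exp_add[symmetric] right_diff_distrib)
      then show ?thesis by simp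
    qed
    \<comment> \<open>Only the part of order two and higher is estimated through |Y u| \<le> |u|.
      The linear term is kept exactly, since its mean is what turns F into G.\<close>
    have "(\<integral>u. exp (t * Y u) \<partial>m) \<le> (\<integral>u. 1 + t * Y u + phi2 (t * L2_set u I) \<partial>m)"
    proof (rule integral_mono)
      have "exp (t * Y u) = exp (- (t * F y)) * exp (t * F (\<lambda>j\<in>I. y j + u j))" for u
        by (simp add: Y_def exp_add[symmetric] right_diff_distrib)
      moreover have "integrable m (\<lambda>u. exp (t * F (\<lambda>j\<in>I. y j + u j)))"
        using eB by (intro m.integrable_const_bound[where B="exp (t * B)"]) auto
      ultimately show "integrable m (\<lambda>u. exp (t * Y u))" by simp
      show "integrable m (\<lambda>u. 1 + t * Y u + phi2 (t * L2_set u I))" using Yi phi by simp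
      fix u
      have "phi2 (t * Y u) \<le> phi2 (t * \<bar>Y u\<bar>)" using phi2_abs[of "t * Y u"] t by (simp add: abs_mult)
      also have "\<dots> \<le> phi2 (t * L2_set u I)"
      proof (cases "L2_set u I = 0")
        case False
        then have pos: "L2_set u I > 0" using L2_set_nonneg[of u I] False by linarith
        \<comment> \<open>Monotonicity of \<open>phi2\<close> on the nonnegative half-line, obtained
          from \<open>phi2_scale\<close> with s^2 \<le> 1.\<close>
        define s where "s = \<bar>Y u\<bar> / L2_set u I"
        have s: "0 \<le> s" "s \<le> 1" using Yb[of u] pos by (auto simp: s_def)
        have "phi2 (s * (t * L2_set u I)) \<le> s\<^sup>2 * phi2 (t * L2_set u I)"
          using s t pos by (intro phi2_scale) auto
        also have "\<dots> \<le> 1 * phi2 (t * L2_set u I)"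
          using s by (intro mult_right_mono phi2_nonneg power_le_one)
        finally show ?thesis using pos by (simp add: s_def mult.commute)
      qed (use Yb[of u] in auto)
      finally show "exp (t * Y u) \<le> 1 + t * Y u + phi2 (t * L2_set u I)" by (simp add: phi2_def)
    qed
    also have "\<dots> = 1 + t * (\<integral>u. Y u \<partial>m) + (\<integral>u. phi2 (t * L2_set u I) \<partial>m)"
      using Yi phi by (simp add: m.prob_space)
    also have "\<dots> \<le> 1 + (t * (\<integral>u. Y u \<partial>m) + c)" using phi by simp
    also have "\<dots> \<le> exp (t * (\<integral>u. Y u \<partial>m) + c)" by (rule exp_ge_add_one_self)
    also have "(\<integral>u. Y u \<partial>m) = G y - F y" unfolding Y_def G_def
      by (subst Bochner_Integration.integral_diff[OF G(3)]) (simp_all add: m.prob_space)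
    finally have "(\<integral>u. exp (t * Y u) \<partial>m) \<le> exp (t * (G y - F y) + c)" .
    then have "(\<integral>u. exp (t * F (\<lambda>j\<in>I. y j + u j)) \<partial>m) \<le> exp (t * F y) * exp (t * (G y - F y) + c)"
      unfolding A by (rule mult_left_mono) simp
    also have "\<dots> = exp c * exp (t * G y)" by (simp add: exp_add[symmetric] right_diff_distrib)
    finally show ?thesis .
  qed
  have Gm [measurable]: "G \<in> borel_measurable (euclid I)" by (rule lip_measurable[OF fin G(1)])
  have "(\<integral>y. exp (t * F y) \<partial>walk I m x (Suc k)) =
      (\<integral>y. (\<integral>u. exp (t * F (\<lambda>j\<in>I. y j + u j)) \<partial>m) \<partial>walk I m x k)"
    using eB by (intro walk_Suc_bounded[where B="exp (t * B)"]) auto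
  also have "\<dots> \<le> (\<integral>y. exp c * exp (t * G y) \<partial>walk I m x k)"
  proof (rule integral_mono[OF _ _ step])
    have "0 \<le> (\<integral>u. exp (t * F (\<lambda>j\<in>I. y j + u j)) \<partial>m)" for y by (simp add: integral_nonneg_AE)
    moreover have "exp (t * G y) \<le> exp (t * B)" for y
      using Gb[of y] t by (auto intro!: mult_left_mono)
    ultimately have *: "norm (\<integral>u. exp (t * F (\<lambda>j\<in>I. y j + u j)) \<partial>m) \<le> exp c * exp (t * B)"
        "norm (exp c * exp (t * G y)) \<le> exp c * exp (t * B)" for y
      using order_trans[OF step[of y], of "exp c * exp (t * B)"] by auto
    show "integrable (walk I m x k) (\<lambda>y. \<integral>u. exp (t * F (\<lambda>j\<in>I. y j + u j)) \<partial>m)"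
      by (rule integrable_bounded[OF prob_space_walk sets_walk _ *(1)]) measurable
    show "integrable (walk I m x k) (\<lambda>y. exp c * exp (t * G y))"
      by (rule integrable_bounded[OF prob_space_walk sets_walk _ *(2)]) measurable
  qed
  also have "\<dots> \<le> exp c * exp (t * (\<integral>y. G y \<partial>walk I m x k) + k * c)"
    using Suc.IH[OF G(1) Gb] by simp
  also have "(\<integral>y. G y \<partial>walk I m x k) = (\<integral>y. F y \<partial>walk I m x (Suc k))"
    unfolding G_def using B by (intro walk_Suc_bounded[symmetric, where B=B]) auto
  also have "exp c * exp (t * (\<integral>y. F y \<partial>walk I m x (Suc k)) + k * c) =
      exp (t * (\<integral>y. F y \<partial>walk I m x (Suc k)) + Suc k * c)"
    by (simp only: exp_add[symmetric]) (simp add: algebra_simps)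
  finally show ?case .
qed

end

section \<open>Moments and concentration of random walks\<close>

definition sqdist :: "'i set \<Rightarrow> ('i \<Rightarrow> real) \<Rightarrow> ('i \<Rightarrow> real) \<Rightarrow> real"
  where "sqdist I c y = (\<Sum>j\<in>I. (y j - c j)\<^sup>2)"

lemma sqdist_measurable [measurable]: "sqdist I c \<in> borel_measurable (euclid I)"
  unfolding sqdist_def by measurable

lemma sqdist_nonneg: "sqdist I c y \<ge> 0"
  by (simp add: sqdist_def sum_nonneg)

text \<open>One step turns the second moment about c into the one about c - \<mu> plus the variance
  of the step, so the induction moves the centre. The final bound drops the squared means, because
  the raw second moments are what an integral over the jump measure gives.\<close>

lemma walk_second_moment:
  assumes m: "prob_space m" "sets m = sets (euclid I)"
    and i1: "\<And>j. j \<in> I \<Longrightarrow> integrable m (\<lambda>u. u j)"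
    and i2: "\<And>j. j \<in> I \<Longrightarrow> integrable m (\<lambda>u. (u j)\<^sup>2)"
  defines "\<mu> \<equiv> \<lambda>j. \<integral>u. u j \<partial>m"
  shows "integrable (walk I m x k) (sqdist I c)"
    "(\<integral>y. sqdist I c y \<partial>walk I m x k) \<le> sqdist I c (\<lambda>j. x j + k * \<mu> j) + k * (\<Sum>j\<in>I. \<integral>u. (u j)\<^sup>2 \<partial>m)"
proof -
  interpret m: prob_space m by (rule m)
  note [measurable_cong] = m(2)
  define V where "V = (\<Sum>j\<in>I. (\<integral>u. (u j)\<^sup>2 \<partial>m) - (\<mu> j)\<^sup>2)"
  have exp_sq: "sqdist I c (\<lambda>j\<in>I. y j + u j) = (\<Sum>j\<in>I. (y j - c j)\<^sup>2 + 2 * (y j - c j) * u j + (u j)\<^sup>2)" for y u c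
    unfolding sqdist_def by (intro sum.cong refl) (simp add: power2_eq_square algebra_simps)
  have int: "integrable m (\<lambda>u. sqdist I d (\<lambda>j\<in>I. y j + u j))" for y d
    unfolding exp_sq using i1 i2
    by (intro Bochner_Integration.integrable_sum Bochner_Integration.integrable_add integrable_mult_right) auto
  have step: "(\<integral>u. sqdist I c (\<lambda>j\<in>I. y j + u j) \<partial>m) = sqdist I (\<lambda>j. c j - \<mu> j) y + V" for y c
  proof -
    have "(\<integral>u. sqdist I c (\<lambda>j\<in>I. y j + u j) \<partial>m) =
        (\<Sum>j\<in>I. (\<integral>u. (y j - c j)\<^sup>2 + 2 * (y j - c j) * u j + (u j)\<^sup>2 \<partial>m))"
      unfolding exp_sq using i1 i2
      by (intro Bochner_Integration.integral_sum Bochner_Integration.integrable_add integrable_mult_right) auto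
    also have "\<dots> = (\<Sum>j\<in>I. (y j - c j)\<^sup>2 + 2 * (y j - c j) * \<mu> j + (\<integral>u. (u j)\<^sup>2 \<partial>m))"
      using i1 i2 by (intro sum.cong refl) (simp add: \<mu>_def m.prob_space)
    also have "\<dots> = sqdist I (\<lambda>j. c j - \<mu> j) y + V"
      unfolding sqdist_def V_def sum.distrib[symmetric]
      by (intro sum.cong refl) (simp add: power2_eq_square algebra_simps)
    finally show ?thesis .
  qed
  have "integrable (walk I m x k) (sqdist I c) \<and>
      (\<integral>y. sqdist I c y \<partial>walk I m x k) = sqdist I c (\<lambda>j. x j + k * \<mu> j) + k * V" for c
  proof (induction k arbitrary: c)
    case 0
    have "sqdist I c (restrict x I) = sqdist I c x" unfolding sqdist_def by (intro sum.cong) auto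
    moreover have "integrable (return (euclid I) (restrict x I)) (sqdist I c)"
      by (intro integrableI_bounded) (auto simp: nn_integral_return space_PiM)
    ultimately show ?case by (simp add: integral_return space_PiM)
  next
    case (Suc k)
    interpret W: prob_space "walk I m x k" by (rule prob_space_walk[OF m])
    have n: "norm (sqdist I c (\<lambda>j\<in>I. y j + u j)) = sqdist I c (\<lambda>j\<in>I. y j + u j)" for y u
      by (simp add: sqdist_nonneg)
    have i: "integrable (walk I m x k) (\<lambda>y. sqdist I (\<lambda>j. c j - \<mu> j) y + V)" using Suc.IH by simp
    have a1: "integrable m (\<lambda>u. sqdist I c (\<lambda>j\<in>I. y j + u j))" for y by (rule int)
    have a2: "integrable (walk I m x k) (\<lambda>y. \<integral>u. norm (sqdist I c (\<lambda>j\<in>I. y j + u j)) \<partial>m)"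
      unfolding n step by (rule i)
    note ws = walk_Suc[OF m sqdist_measurable a1 a2, unfolded step]
    have "(\<integral>y. sqdist I c y \<partial>walk I m x (Suc k)) = sqdist I (\<lambda>j. c j - \<mu> j) (\<lambda>j. x j + k * \<mu> j) + k * V + V"
      unfolding ws(2) using Suc.IH[of "\<lambda>j. c j - \<mu> j"] by (simp add: W.prob_space)
    also have "sqdist I (\<lambda>j. c j - \<mu> j) (\<lambda>j. x j + k * \<mu> j) = sqdist I c (\<lambda>j. x j + Suc k * \<mu> j)"
      unfolding sqdist_def by (simp add: algebra_simps)
    finally show ?case using ws(1) by (simp add: algebra_simps)
  qed
  then have *: "integrable (walk I m x k) (sqdist I c)"
    "(\<integral>y. sqdist I c y \<partial>walk I m x k) = sqdist I c (\<lambda>j. x j + k * \<mu> j) + k * V" by auto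
  show "integrable (walk I m x k) (sqdist I c)" by fact
  have "V \<le> (\<Sum>j\<in>I. \<integral>u. (u j)\<^sup>2 \<partial>m)" unfolding V_def by (intro sum_mono) auto
  then show "(\<integral>y. sqdist I c y \<partial>walk I m x k) \<le> sqdist I c (\<lambda>j. x j + k * \<mu> j) + k * (\<Sum>j\<in>I. \<integral>u. (u j)\<^sup>2 \<partial>m)"
    unfolding * by (intro add_left_mono mult_left_mono) auto
qed

text \<open>The steps are exchanged one at a time, each at the cost \<theta>. Functions with values
  in [0, 1] form the right class, since the mean of such a function over a further step is again
  one.\<close>

lemma walk_compare:
  assumes m: "prob_space m" "sets m = sets (euclid I)"
    and m': "prob_space m'" "sets m' = sets (euclid I)"
    and le: "\<And>g :: ('i \<Rightarrow> real) \<Rightarrow> real. g \<in> borel_measurable (euclid I) \<Longrightarrow> (\<And>y. 0 \<le> g y) \<Longrightarrow> (\<And>y. g y \<le> 1) \<Longrightarrow>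
      (\<integral>u. g u \<partial>m) \<le> (\<integral>u. g u \<partial>m') + \<theta>"
    and g: "g \<in> borel_measurable (euclid I)" "\<And>y. 0 \<le> g y" "\<And>y. g y \<le> 1"
  shows "(\<integral>y. g y \<partial>walk I m x k) \<le> (\<integral>y. g y \<partial>walk I m' x k) + k * \<theta>"
  using g
proof (induction k arbitrary: g)
  case (Suc k)
  interpret m': prob_space m' by (rule m')
  interpret W: prob_space "walk I m x k" by (rule prob_space_walk[OF m])
  note [measurable_cong] = m(2) m'(2) sets_walk[of I m x k]
  note [measurable] = Suc.prems(1)
  have n: "norm (g y) \<le> 1" for y using Suc.prems(2,3)[of y] by simp
  define h where "h = (\<lambda>y. \<integral>u. g (\<lambda>j\<in>I. y j + u j) \<partial>m')"
  have [measurable]: "h \<in> borel_measurable (euclid I)" unfolding h_def by measurable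
  have h: "0 \<le> h y" "h y \<le> 1" for y
  proof -
    show "0 \<le> h y" unfolding h_def using Suc.prems by (intro integral_nonneg_AE) auto
    have "h y \<le> (\<integral>u. 1 \<partial>m')" unfolding h_def using Suc.prems n
      by (intro integral_mono m'.integrable_const_bound[where B=1]) auto
    then show "h y \<le> 1" by (simp add: m'.prob_space)
  qed
  have ih: "integrable (walk I m x k) h"
    using h by (intro W.integrable_const_bound[where B=1]) auto
  have "(\<integral>y. g y \<partial>walk I m x (Suc k)) = (\<integral>y. (\<integral>u. g (\<lambda>j\<in>I. y j + u j) \<partial>m) \<partial>walk I m x k)"
    by (rule walk_Suc_bounded[OF m Suc.prems(1) n])
  also have "\<dots> \<le> (\<integral>y. h y + \<theta> \<partial>walk I m x k)"
  proof (rule integral_mono)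
    interpret m: prob_space m by (rule m)
    show "(\<integral>u. g (\<lambda>j\<in>I. y j + u j) \<partial>m) \<le> h y + \<theta>" for y
      unfolding h_def using Suc.prems by (intro le) auto
    have "norm (\<integral>u. g (\<lambda>j\<in>I. y j + u j) \<partial>m) \<le> 1" for y
    proof -
      have "norm (\<integral>u. g (\<lambda>j\<in>I. y j + u j) \<partial>m) \<le> (\<integral>u. norm (g (\<lambda>j\<in>I. y j + u j)) \<partial>m)"
        by (rule integral_norm_bound)
      also have "\<dots> \<le> (\<integral>u. 1 \<partial>m)"
        using n by (intro integral_mono m.integrable_const_bound[where B=1]) auto
      finally show ?thesis by (simp add: m.prob_space)
    qed
    then show "integrable (walk I m x k) (\<lambda>y. \<integral>u. g (\<lambda>j\<in>I. y j + u j) \<partial>m)"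
      by (intro W.integrable_const_bound[where B=1]) auto
    show "integrable (walk I m x k) (\<lambda>y. h y + \<theta>)"
      using ih by simp
  qed
  also have "\<dots> = (\<integral>y. h y \<partial>walk I m x k) + \<theta>"
    using ih by (simp add: W.prob_space)
  also have "\<dots> \<le> (\<integral>y. h y \<partial>walk I m' x k) + k * \<theta> + \<theta>"
    using Suc.IH[OF _ h] by simp
  also have "(\<integral>y. h y \<partial>walk I m' x k) = (\<integral>y. g y \<partial>walk I m' x (Suc k))"
    unfolding h_def by (rule walk_Suc_bounded[OF m' Suc.prems(1) n, symmetric])
  finally show ?case by (simp add: algebra_simps)
qed simp

text \<open>The bound is the Laplace transform of R times a centred Poisson variable of intensity V
  / R^2, the extremal case. Bounded F are the ones for which \<open>exp (t * F)\<close> passes to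
  weak limits; the bound on F does not enter the estimate.\<close>

definition laplace_bound :: "'i set \<Rightarrow> real \<Rightarrow> real \<Rightarrow> ('i \<Rightarrow> real) measure \<Rightarrow> bool"
  where "laplace_bound I V R Q \<longleftrightarrow> (\<forall>F B t. lip I 1 F \<longrightarrow> (\<forall>y. \<bar>F y\<bar> \<le> B) \<longrightarrow> t \<ge> 0 \<longrightarrow>
    (\<integral>y. exp (t * F y) \<partial>Q) \<le> exp (t * (\<integral>y. F y \<partial>Q) + V / R\<^sup>2 * phi2 (t * R)))"

lemma chernoff:
  assumes fin: "finite I" and Q: "prob_space Q" "sets Q = sets (euclid I)"
    and lb: "laplace_bound I V R Q" and V: "V > 0" and R: "R > 0"
    and F: "lip I 1 F" and B: "\<And>y. \<bar>F y\<bar> \<le> B" and x: "x \<ge> 0"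
  shows "measure Q {y\<in>space Q. F y - (\<integral>y. F y \<partial>Q) \<ge> x} \<le> exp (- (V / R\<^sup>2) * ell (R * x / V))"
proof -
  interpret Q: prob_space Q by fact
  note [measurable_cong] = Q(2)
  note [measurable] = lip_measurable[OF fin F]
  \<comment> \<open>The minimiser of V / R^2 * \<open>phi2 (t * R)\<close> - t * x: the derivative
    vanishes when exp (t R) = 1 + R x / V.\<close>
  define t where "t = ln (1 + R * x / V) / R"
  have pos: "1 + R * x / V \<ge> 1" using V R x by simp
  have t: "t \<ge> 0" unfolding t_def using pos R by simp
  define E where "E = (\<integral>y. F y \<partial>Q)"
  have eB: "norm (exp (t * F y)) \<le> exp (t * B)" for y
    using B[of y] t by (auto intro!: mult_left_mono)
  have int: "integrable Q (\<lambda>y. exp (t * F y))"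
    using eB by (intro Q.integrable_const_bound[where B="exp (t * B)"]) auto
  have "measure Q {y\<in>space Q. F y - E \<ge> x} \<le> measure Q {y\<in>space Q. exp (t * F y) \<ge> exp (t * (E + x))}"
  proof (rule Q.finite_measure_mono)
    show "{y\<in>space Q. F y - E \<ge> x} \<subseteq> {y\<in>space Q. exp (t * F y) \<ge> exp (t * (E + x))}"
      using t by (auto intro!: mult_left_mono)
  qed measurable
  also have "\<dots> \<le> (\<integral>y. exp (t * F y) \<partial>Q) / exp (t * (E + x))"
    using int by (intro integral_Markov_inequality_measure[where A="{}"]) auto
  also have "\<dots> \<le> exp (t * E + V / R\<^sup>2 * phi2 (t * R)) / exp (t * (E + x))"
    using lb F B t unfolding laplace_bound_def E_def by (intro divide_right_mono) auto
  also have "\<dots> = exp (V / R\<^sup>2 * phi2 (t * R) - t * x)"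
    by (simp add: exp_diff[symmetric] algebra_simps)
  also have "V / R\<^sup>2 * phi2 (t * R) - t * x = - (V / R\<^sup>2) * ell (R * x / V)"
  proof -
    have tR: "t * R = ln (1 + R * x / V)" using R by (simp add: t_def)
    define l where "l = ln (1 + R * x / V)"
    define r w where "r = R * x / V" and "w = V / R\<^sup>2"
    have "phi2 (t * R) = r - l" unfolding phi2_def tR using pos by (simp add: l_def r_def)
    moreover have "t * x = w * (r * l)" using R V
      by (simp add: t_def l_def[symmetric] r_def w_def power2_eq_square)
    moreover have "ell r = l + r * l - r"
      by (simp add: ell_def l_def r_def distrib_right)
    ultimately show ?thesis unfolding r_def[symmetric] w_def[symmetric] by (simp only:) (simp add: algebra_simps)
  qed
  finally show ?thesis by (simp add: E_def)
qed

lemma lip_uminus: "lip I L F \<Longrightarrow> lip I L (\<lambda>y. - F y)"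
  unfolding lip_def by (simp add: abs_minus_commute)

lemma lip_scale:
  assumes "lip I L F" "c \<ge> 0"
  shows "lip I (c * L) (\<lambda>y. c * F y)"
  unfolding lip_def
proof (intro allI)
  fix x y
  have "\<bar>c * F x - c * F y\<bar> = c * \<bar>F x - F y\<bar>"
    using assms(2) by (simp add: right_diff_distrib[symmetric] abs_mult)
  also have "\<dots> \<le> c * (L * L2_set (\<lambda>k. x k - y k) I)" by (intro mult_left_mono lipD assms)
  finally show "\<bar>c * F x - c * F y\<bar> \<le> c * L * L2_set (\<lambda>k. x k - y k) I" by (simp add: mult.assoc)
qed

lemma chernoff_lip:
  assumes fin: "finite I" and Q: "prob_space Q" "sets Q = sets (euclid I)"
    and lb: "laplace_bound I V R Q" and V: "V > 0" and R: "R > 0" and L: "L > 0"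
    and F: "lip I L F" and B: "\<And>y. \<bar>F y\<bar> \<le> B" and x: "x \<ge> 0"
  shows "measure Q {y\<in>space Q. F y - (\<integral>y. F y \<partial>Q) \<ge> x} \<le> exp (- (V / R\<^sup>2) * ell (R * x / (L * V)))"
proof -
  have 1: "lip I 1 (\<lambda>y. 1 / L * F y)" using lip_scale[OF F, of "1 / L"] L by simp
  have 2: "\<bar>1 / L * F y\<bar> \<le> 1 / L * B" for y
    using B[of y] L by (simp add: abs_mult divide_right_mono)
  have eq: "(1 / L * F y - (\<integral>y. 1 / L * F y \<partial>Q) \<ge> x / L) \<longleftrightarrow> (F y - (\<integral>y. F y \<partial>Q) \<ge> x)" for y
    using L by (simp add: field_simps)
  have "x / L \<ge> 0" using x L by simp
  from chernoff[OF fin Q lb V R 1 2 this] show ?thesis unfolding eq by (simp add: mult.commute)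
qed

lemma chernoff_lower:
  assumes fin: "finite I" and Q: "prob_space Q" "sets Q = sets (euclid I)"
    and lb: "laplace_bound I V R Q" and V: "V > 0" and R: "R > 0"
    and F: "lip I 1 F" and B: "\<And>y. \<bar>F y\<bar> \<le> B" and x: "x \<ge> 0"
  shows "measure Q {y\<in>space Q. F y - (\<integral>y. F y \<partial>Q) \<le> - x} \<le> exp (- (V / R\<^sup>2) * ell (R * x / V))"
proof -
  have "\<bar>- F y\<bar> \<le> B" for y using B[of y] by simp
  from chernoff[OF fin Q lb V R lip_uminus[OF F] this x]
  have "measure Q {y\<in>space Q. - F y - (\<integral>y. - F y \<partial>Q) \<ge> x} \<le> exp (- (V / R\<^sup>2) * ell (R * x / V))" .
  moreover have "(- F y - (\<integral>y. - F y \<partial>Q) \<ge> x) \<longleftrightarrow> (F y - (\<integral>y. F y \<partial>Q) \<le> - x)" for y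
    by auto
  ultimately show ?thesis by simp
qed

text \<open>The exponential is Lipschitz below the level t * B, by the tangent inequality exp (b -
  a) \<ge> 1 + b - a. This makes \<open>exp (t * F)\<close> admissible in
  \<open>levy_continuity_lip\<close>.\<close>

lemma lip_exp:
  assumes F: "lip I L F" and B: "\<And>y. \<bar>F y\<bar> \<le> B" and L: "L \<ge> 0" and t: "t \<ge> 0"
  shows "lip I (t * L * exp (t * B)) (\<lambda>y. exp (t * F y))"
  unfolding lip_def
proof (intro allI)
  fix x y
  have key: "exp a - exp b \<le> exp (t * B) * \<bar>a - b\<bar>" if "a \<le> t * B" for a b :: real
  proof -
    have "exp a * (1 + (b - a)) \<le> exp a * exp (b - a)"
      by (intro mult_left_mono exp_ge_add_one_self) simp
    then have "exp a - exp b \<le> exp a * (a - b)" by (simp add: exp_diff algebra_simps)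
    also have "\<dots> \<le> exp a * \<bar>a - b\<bar>" by (intro mult_left_mono) auto
    also have "\<dots> \<le> exp (t * B) * \<bar>a - b\<bar>" using that by (intro mult_right_mono) auto
    finally show ?thesis .
  qed
  have tB: "t * F z \<le> t * B" for z using B[of z] t by (intro mult_left_mono) auto
  have "\<bar>exp (t * F x) - exp (t * F y)\<bar> \<le> exp (t * B) * \<bar>t * F x - t * F y\<bar>"
    using key[OF tB, of x "t * F y"] key[OF tB, of y "t * F x"] by (simp add: abs_le_iff abs_minus_commute)
  also have "\<bar>t * F x - t * F y\<bar> \<le> t * L * L2_set (\<lambda>k. x k - y k) I"
    using lipD[OF lip_scale[OF F t]] .
  finally show "\<bar>exp (t * F x) - exp (t * F y)\<bar> \<le> t * L * exp (t * B) * L2_set (\<lambda>k. x k - y k) I"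
    by (simp add: algebra_simps)
qed

lemma laplace_bound_limit:
  assumes fin: "finite I"
    and Q: "\<And>n. prob_space (Q n)" "\<And>n. sets (Q n) = sets (euclid I)"
    and P: "prob_space P" "sets P = sets (euclid I)"
    and conv: "\<And>t. (\<lambda>n. \<integral>x. iexp (ip I t x) \<partial>Q n) \<longlonglongrightarrow> (\<integral>x. iexp (ip I t x) \<partial>P)"
    and lb: "\<And>n. laplace_bound I V R (Q n)"
  shows "laplace_bound I V R P"
  unfolding laplace_bound_def
proof (intro allI impI)
  fix F B t assume F: "lip I 1 F" and B: "\<forall>y. \<bar>F y\<bar> \<le> B" and t: "(t::real) \<ge> 0"
  have eB: "\<bar>exp (t * F y)\<bar> \<le> exp (t * B)" for y
    using B t by (auto intro!: mult_left_mono dest!: spec[of _ y])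
  have "(\<lambda>n. \<integral>y. exp (t * F y) \<partial>Q n) \<longlonglongrightarrow> (\<integral>y. exp (t * F y) \<partial>P)"
    using t B by (intro levy_continuity_lip[OF fin Q P conv lip_exp[OF F _ _ t] eB]) auto
  moreover have "(\<lambda>n. exp (t * (\<integral>y. F y \<partial>Q n) + V / R\<^sup>2 * phi2 (t * R))) \<longlonglongrightarrow>
      exp (t * (\<integral>y. F y \<partial>P) + V / R\<^sup>2 * phi2 (t * R))"
    using B by (intro tendsto_intros levy_continuity_lip[OF fin Q P conv F]) auto
  ultimately show "(\<integral>y. exp (t * F y) \<partial>P) \<le> exp (t * (\<integral>y. F y \<partial>P) + V / R\<^sup>2 * phi2 (t * R))"
    by (rule LIMSEQ_le) (use lb F B t in \<open>auto simp: laplace_bound_def\<close>)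
qed

section \<open>Infinitely divisible laws with bounded jumps\<close>

lemma ip_Cauchy_Schwarz: "\<bar>ip I t u\<bar> \<le> L2_set t I * L2_set u I"
proof -
  have "\<bar>ip I t u\<bar> \<le> (\<Sum>k\<in>I. \<bar>t k\<bar> * \<bar>u k\<bar>)"
    unfolding ip_def by (intro order_trans[OF sum_abs]) (simp add: abs_mult)
  also have "\<dots> \<le> L2_set t I * L2_set u I" by (rule L2_set_mult_ineq)
  finally show ?thesis .
qed

lemma component_le_L2_set: "finite I \<Longrightarrow> j \<in> I \<Longrightarrow> \<bar>u j\<bar> \<le> L2_set u I"
  using member_le_L2_set[of I j "\<lambda>k. \<bar>u k\<bar>"] by (simp add: L2_set_def)

locale bounded_id =
  fixes I :: "'i set" and \<beta> :: "'i \<Rightarrow> real" and \<nu> P :: "('i \<Rightarrow> real) measure"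
  assumes fin: "finite I" and id: "ID I \<beta> \<nu> P" and bs: "bounded_supp I \<nu>"
begin

abbreviation R where "R \<equiv> supp_radius I \<nu>"
abbreviation V where "V \<equiv> Vsq I \<nu> R"

lemma P: "prob_space P" "sets P = sets (euclid I)"
  and sets_\<nu>: "sets \<nu> = sets (euclid I)"
  and \<nu>_nonzero: "emeasure \<nu> (space \<nu>) \<noteq> 0"
  and \<nu>_origin: "emeasure \<nu> {\<lambda>k\<in>I. 0} = 0"
  and \<nu>_finite: "(\<integral>\<^sup>+u. ennreal (min 1 ((L2_set u I)\<^sup>2)) \<partial>\<nu>) < \<infinity>"
  using id by (auto simp: ID_def levy_measure_def)

lemma meas_\<nu>: "borel_measurable \<nu> = borel_measurable (euclid I)"
  by (intro measurable_cong_sets sets_\<nu> refl)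

lemma space_\<nu>: "space \<nu> = space (euclid I)"
  by (rule sets_eq_imp_space_eq[OF sets_\<nu>])

lemma norm_measurable [measurable]: "(\<lambda>u. L2_set u I) \<in> borel_measurable \<nu>"
  unfolding meas_\<nu> by measurable

lemma component_measurable: "j \<in> I \<Longrightarrow> (\<lambda>u. u j) \<in> borel_measurable \<nu>"
  unfolding meas_\<nu> by measurable

lemma ip_measurable_\<nu> [measurable]: "ip I t \<in> borel_measurable \<nu>"
  unfolding meas_\<nu> by measurable

lemma integrable_min: "integrable \<nu> (\<lambda>u. min 1 ((L2_set u I)\<^sup>2))"
  using \<nu>_finite by (intro integrableI_nonneg) (auto simp: meas_\<nu>)

lemma finite_tail:
  assumes "\<epsilon> > 0"
  shows "integrable \<nu> (indicator {u. \<epsilon> < L2_set u I} :: _ \<Rightarrow> real)"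
proof (rule Bochner_Integration.integrable_bound[OF integrable_mult_right[OF integrable_min, of "1 / min 1 (\<epsilon>\<^sup>2)"]])
  have "1 \<le> 1 / min 1 (\<epsilon>\<^sup>2) * min 1 ((L2_set u I)\<^sup>2)" if "\<epsilon> < L2_set u I" for u
  proof -
    have "\<epsilon>\<^sup>2 \<le> (L2_set u I)\<^sup>2" using that assms by (intro power_mono) auto
    then have "min 1 (\<epsilon>\<^sup>2) \<le> min 1 ((L2_set u I)\<^sup>2)" by (rule min.mono[OF order_refl])
    then show ?thesis using assms by (simp add: field_simps)
  qed
  then show "AE u in \<nu>. norm (indicator {u. \<epsilon> < L2_set u I} u :: real)
      \<le> norm (1 / min 1 (\<epsilon>\<^sup>2) * min 1 ((L2_set u I)\<^sup>2))"
    by (intro AE_I2) (auto simp: indicator_def intro: order_trans[OF _ abs_ge_self])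
qed measurable

text \<open>R is only an infimum of admissible radii, so it is approached through the countably many
  thresholds R + 1 / (n + 1).\<close>

lemma AE_norm_le_R: "AE u in \<nu>. L2_set u I \<le> R"
proof -
  define A where "A = {r. r > 0 \<and> emeasure \<nu> {u\<in>space \<nu>. L2_set u I > r} = 0}"
  have "A \<noteq> {}" using bs by (auto simp: A_def bounded_supp_def)
  have R: "R = Inf A" by (simp add: supp_radius_def A_def)
  have "AE u in \<nu>. L2_set u I \<le> R + 1 / Suc n" for n
  proof -
    have "Inf A < R + 1 / Suc n" by (simp add: R)
    then obtain r where r: "r \<in> A" "r < R + 1 / Suc n" using cInf_lessD[OF \<open>A \<noteq> {}\<close>] by blast
    have "AE u in \<nu>. \<not> r < L2_set u I"
      using r(1) by (intro AE_I[where N="{u\<in>space \<nu>. L2_set u I > r}"]) (auto simp: A_def)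
    then show ?thesis using r(2) by (auto elim!: eventually_mono)
  qed
  then have "AE u in \<nu>. \<forall>n. L2_set u I \<le> R + 1 / Suc n" by (simp add: AE_all_countable)
  then show ?thesis
  proof (rule eventually_mono)
    fix u assume u: "\<forall>n. L2_set u I \<le> R + 1 / Suc n"
    show "L2_set u I \<le> R"
    proof (rule field_le_epsilon)
      fix e :: real assume "e > 0"
      then obtain n where "1 / Suc n < e" using nat_approx_posE by blast
      then show "L2_set u I \<le> R + e" using spec[OF u, of n] by linarith
    qed
  qed
qed

text \<open>In the space of \<nu> the only point of norm 0 is the origin, which has no mass, while
  \<nu> itself is not zero. From this follow R > 0 and V > 0, which give the later quotients their
  meaning.\<close>

lemma not_AE_zero: "\<not> (AE u in \<nu>. L2_set u I = 0)"
proof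
  assume a: "AE u in \<nu>. L2_set u I = 0"
  have "AE u in \<nu>. u \<noteq> (\<lambda>k\<in>I. 0)"
  proof (rule AE_I[where N="{\<lambda>k\<in>I. 0}"])
    have "{\<lambda>k\<in>I. 0} = PiE I (\<lambda>_. {0::real})" by (auto simp: PiE_iff extensional_def fun_eq_iff)
    also have "\<dots> \<in> sets (euclid I)" by (intro sets_PiM_I_finite fin) auto
    finally show "{\<lambda>k\<in>I. 0} \<in> sets \<nu>" by (simp add: sets_\<nu>)
  qed (auto simp: \<nu>_origin)
  then have "AE u in \<nu>. False" using a AE_space
  proof eventually_elim
    case (elim u)
    then have "u = (\<lambda>k\<in>I. 0)"
      using fin by (auto simp: space_\<nu> space_PiM PiE_iff extensional_def L2_set_eq_0_iff)
    with elim show ?case by simp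
  qed
  then show False using \<nu>_nonzero AE_E2[where M=\<nu> and P="\<lambda>_. False"] by simp
qed

lemma R_pos: "R > 0"
proof -
  have "R \<ge> 0" unfolding supp_radius_def
    using bs by (intro cInf_greatest) (auto simp: bounded_supp_def)
  moreover have "R \<noteq> 0"
  proof
    assume "R = 0"
    then have "AE u in \<nu>. L2_set u I = 0"
      using AE_norm_le_R by (auto elim!: eventually_mono intro: antisym L2_set_nonneg)
    then show False using not_AE_zero by simp
  qed
  ultimately show ?thesis by simp
qed

lemma integrable_sq: "integrable \<nu> (\<lambda>u. (L2_set u I)\<^sup>2)"
proof (rule Bochner_Integration.integrable_bound[OF integrable_mult_right[OF integrable_min, of "max 1 (R\<^sup>2)"]])
  show "AE u in \<nu>. norm ((L2_set u I)\<^sup>2) \<le> norm (max 1 (R\<^sup>2) * min 1 ((L2_set u I)\<^sup>2))"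
    using AE_norm_le_R
  proof eventually_elim
    case (elim u)
    have "(L2_set u I)\<^sup>2 \<le> max 1 (R\<^sup>2) * min 1 ((L2_set u I)\<^sup>2)"
    proof (cases "(L2_set u I)\<^sup>2 \<le> 1")
      case True
      have "1 * (L2_set u I)\<^sup>2 \<le> max 1 (R\<^sup>2) * (L2_set u I)\<^sup>2" by (intro mult_right_mono) auto
      then show ?thesis using True by simp
    next
      case False
      have "(L2_set u I)\<^sup>2 \<le> R\<^sup>2" using elim by (intro power_mono L2_set_nonneg)
      then show ?thesis using False by simp
    qed
    then show ?case by (simp add: order_trans[OF _ abs_ge_self])
  qed
qed measurable

lemma V_eq: "V = (\<integral>u. (L2_set u I)\<^sup>2 \<partial>\<nu>)"
  unfolding Vsq_def set_lebesgue_integral_def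
proof (rule integral_cong_AE)
  show "AE u in \<nu>. indicat_real {u \<in> space \<nu>. L2_set u I \<le> R} u *\<^sub>R (L2_set u I)\<^sup>2 = (L2_set u I)\<^sup>2"
    using AE_norm_le_R AE_space by eventually_elim simp
qed measurable

lemma V_pos: "V > 0"
proof -
  have "V \<ge> 0" unfolding V_eq by (intro integral_nonneg_AE) auto
  moreover have "V \<noteq> 0"
  proof
    assume "V = 0"
    then have "AE u in \<nu>. (L2_set u I)\<^sup>2 = 0"
      unfolding V_eq using integrable_sq by (subst (asm) integral_nonneg_eq_0_iff_AE) auto
    then show False using not_AE_zero by simp
  qed
  ultimately show ?thesis by simp
qed

text \<open>The integrand of the Levy-Khintchine formula.\<close>

definition lk :: "('i \<Rightarrow> real) \<Rightarrow> ('i \<Rightarrow> real) \<Rightarrow> complex"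
  where "lk t u = iexp (ip I t u) - 1 - \<i> * complex_of_real (ip I t u * indicator {u. L2_set u I \<le> 1} u)"

lemma lk_measurable [measurable]: "lk t \<in> borel_measurable \<nu>"
  unfolding lk_def[abs_def] by measurable

text \<open>Taylor expansion to second order for |u| \<le> 1, where the compensator is the linear
  term, and the trivial bound 2 beyond. The result is dominated by the function whose integrability
  defines a Levy measure.\<close>

lemma lk_bound: "norm (lk t u) \<le> (2 + (L2_set t I)\<^sup>2) * min 1 ((L2_set u I)\<^sup>2)"
proof (cases "L2_set u I \<le> 1")
  case True
  have "norm (iexp (ip I t u) - (\<Sum>k\<le>1. (\<i> * ip I t u) ^ k / fact k)) \<le> \<bar>ip I t u\<bar> ^ Suc 1 / fact (Suc 1)"
    by (rule iexp_approx1)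
  then have "norm (lk t u) \<le> \<bar>ip I t u\<bar>\<^sup>2 / 2"
    using True by (simp add: lk_def numeral_2_eq_2 diff_diff_eq)
  also have "\<dots> \<le> \<bar>ip I t u\<bar>\<^sup>2" by simp
  also have "\<dots> \<le> (L2_set t I * L2_set u I)\<^sup>2" by (intro power_mono ip_Cauchy_Schwarz) auto
  also have "\<dots> \<le> (2 + (L2_set t I)\<^sup>2) * (L2_set u I)\<^sup>2" by (simp add: power_mult_distrib mult_right_mono)
  also have "(L2_set u I)\<^sup>2 = min 1 ((L2_set u I)\<^sup>2)"
    using True power_le_one[of "L2_set u I" 2] by simp
  finally show ?thesis .
next
  case False
  have "norm (lk t u) \<le> 2"
    using False norm_triangle_ineq4[of "iexp (ip I t u)" 1] by (simp add: lk_def)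
  moreover have "min 1 ((L2_set u I)\<^sup>2) = 1"
    using False one_le_power[of "L2_set u I" 2] by simp
  ultimately show ?thesis by (simp add: add_increasing2)
qed

lemma integrable_lk: "integrable \<nu> (lk t)"
  using lk_bound[of t] by (intro Bochner_Integration.integrable_bound[OF integrable_mult_right[OF integrable_min,
    of "2 + (L2_set t I)\<^sup>2"]] AE_I2 order_trans[OF lk_bound abs_ge_self]) auto

lemma char_P: "(\<integral>x. iexp (ip I t x) \<partial>P) = exp (\<i> * complex_of_real (ip I t \<beta>) + (\<integral>u. lk t u \<partial>\<nu>))"
  using id by (simp add: ID_def lk_def)

text \<open>The restriction of \<nu> to S, written as a density: the sets S used below also contain
  functions that are not extensional outside I, so it is their indicators that are measurable, not
  they themselves members of \<open>sets \<nu>\<close>.\<close>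

definition cut :: "('i \<Rightarrow> real) set \<Rightarrow> ('i \<Rightarrow> real) measure"
  where "cut S = density \<nu> (\<lambda>u. ennreal (indicator S u))"

lemma sets_cut [simp]: "sets (cut S) = sets (euclid I)" "space (cut S) = space \<nu>"
  by (simp_all add: cut_def sets_\<nu>)

context
  fixes S :: "('i \<Rightarrow> real) set" and \<epsilon> :: real
  assumes S [measurable]: "(indicator S :: _ \<Rightarrow> real) \<in> borel_measurable \<nu>"
    and \<epsilon>: "\<epsilon> > 0" "S \<subseteq> {u. \<epsilon> < L2_set u I}"
begin

lemma cut_integrable_indicator: "integrable \<nu> (indicator S :: _ \<Rightarrow> real)"
  using \<epsilon>(2) by (intro Bochner_Integration.integrable_bound[OF finite_tail[OF \<epsilon>(1)]])
    (auto simp: indicator_def intro!: AE_I2)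

lemma cut_integral:
  fixes f :: "_ \<Rightarrow> 'b::{banach, second_countable_topology}"
  assumes "f \<in> borel_measurable (euclid I)"
  shows "(\<integral>u. f u \<partial>cut S) = (\<integral>u. indicator S u *\<^sub>R f u \<partial>\<nu>)"
    "integrable (cut S) f \<longleftrightarrow> integrable \<nu> (\<lambda>u. indicator S u *\<^sub>R f u)"
  unfolding cut_def using assms S by (auto simp: meas_\<nu> integral_density integrable_density)

lemma finite_cut: "finite_measure (cut S)"
  "measure (cut S) (space (cut S)) = (\<integral>u. indicator S u \<partial>\<nu>)"
proof -
  have i: "integrable (cut S) (\<lambda>_. 1::real)"
    using cut_integrable_indicator by (subst cut_integral(2)) auto
  then show f: "finite_measure (cut S)" by (auto intro!: finite_measureI simp: integrable_iff_bounded)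
  interpret finite_measure "cut S" by fact
  have "measure (cut S) (space (cut S)) = (\<integral>u. 1 \<partial>cut S)" by simp
  then show "measure (cut S) (space (cut S)) = (\<integral>u. indicator S u \<partial>\<nu>)"
    by (subst (asm) cut_integral(1)) auto
qed

lemma cut_integrable_bounded:
  fixes f :: "_ \<Rightarrow> 'b::{banach, second_countable_topology}"
  assumes f: "f \<in> borel_measurable (euclid I)" and B: "AE u in \<nu>. u \<in> S \<longrightarrow> norm (f u) \<le> B"
  shows "integrable \<nu> (\<lambda>u. indicator S u *\<^sub>R f u)" "integrable (cut S) f"
proof -
  have [measurable]: "f \<in> borel_measurable \<nu>" using f by (simp add: meas_\<nu>)
  show "integrable \<nu> (\<lambda>u. indicator S u *\<^sub>R f u)"
  proof (rule Bochner_Integration.integrable_bound[OF integrable_mult_right[OF cut_integrable_indicator, of B]])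
    show "AE u in \<nu>. norm (indicator S u *\<^sub>R f u) \<le> norm (B * indicator S u)"
      using B by eventually_elim (auto simp: indicator_def intro: order_trans[OF _ abs_ge_self])
  qed measurable
  then show "integrable (cut S) f" by (simp add: cut_integral(2)[OF f])
qed

end

end

section \<open>Approximation by random walks\<close>

context bounded_id
begin

definition eps :: "nat \<Rightarrow> real"
  where "eps m = 1 / Suc m"

definition big :: "nat \<Rightarrow> ('i \<Rightarrow> real) set"
  where "big m = {u. eps m < L2_set u I}"

text \<open>Finite for each m, but unbounded in m when \<nu> has infinite mass near the
  origin.\<close>

definition lam :: "nat \<Rightarrow> real"
  where "lam m = (\<integral>u. indicator (big m) u \<partial>\<nu>)"

text \<open>The number of steps must dominate \<open>(lam m)\<^sup>2\<close> for the Poisson approximation error to vanish.\<close>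

definition num :: "nat \<Rightarrow> nat"
  where "num m = nat \<lceil>Suc m * (lam m)\<^sup>2 + 2 * lam m\<rceil> + 1"

text \<open>The steps of the walk are not centred; the compensator of the jumps of size at most 1 is
  put into the starting point as a whole.\<close>

definition start :: "nat \<Rightarrow> 'i \<Rightarrow> real"
  where "start m j = \<beta> j - (\<integral>u. indicator {u. eps m < L2_set u I \<and> L2_set u I \<le> 1} u * u j \<partial>\<nu>)"

definition approx :: "nat \<Rightarrow> ('i \<Rightarrow> real) measure"
  where "approx m = walk I (jump_law I (cut (big m)) (num m)) (start m) (num m)"

lemma eps_pos: "eps m > 0" by (simp add: eps_def)

lemma big: "(indicator (big m) :: _ \<Rightarrow> real) \<in> borel_measurable \<nu>" "big m \<subseteq> {u. eps m < L2_set u I}"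
  unfolding big_def by measurable

lemma indicator_big_tendsto:
  fixes c :: "'b::real_normed_vector"
  assumes "L2_set u I = 0 \<Longrightarrow> c = 0"
  shows "(\<lambda>m. indicator (big m) u *\<^sub>R c) \<longlonglongrightarrow> c"
proof (cases "L2_set u I = 0")
  case True
  then show ?thesis using assms by simp
next
  case False
  then have "L2_set u I > 0" using L2_set_nonneg[of u I] by linarith
  then obtain n where n: "1 / Suc n < L2_set u I" using nat_approx_posE by blast
  have "indicator (big m) u *\<^sub>R c = c" if "m \<ge> n" for m
  proof -
    have "1 / real (Suc m) \<le> 1 / real (Suc n)" using that by (intro divide_left_mono) auto
    then show ?thesis using n by (simp add: big_def eps_def)
  qed
  then show ?thesis by (intro tendsto_eventually) (auto simp: eventually_sequentially)
qed

lemma lam_nonneg: "lam m \<ge> 0" unfolding lam_def by (intro integral_nonneg_AE) auto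

lemma num: "num m > 0" "lam m \<le> num m" "2 * lam m \<le> num m" "(lam m)\<^sup>2 / num m \<le> 1 / Suc m"
proof -
  show p: "num m > 0" by (simp add: num_def)
  have n: "Suc m * (lam m)\<^sup>2 + 2 * lam m \<le> num m"
    unfolding num_def by linarith
  show 2: "2 * lam m \<le> num m" using n by (rule order_trans[rotated]) simp
  then show "lam m \<le> num m" using lam_nonneg[of m] by linarith
  have "Suc m * (lam m)\<^sup>2 \<le> num m" using n lam_nonneg[of m] by linarith
  then show "(lam m)\<^sup>2 / num m \<le> 1 / Suc m" using p by (simp add: field_simps)
qed

text \<open>A bound on f is required on S and almost everywhere only, because the jumps are bounded
  by R merely almost everywhere.\<close>

lemma jump:
  assumes S: "(indicator S :: _ \<Rightarrow> real) \<in> borel_measurable \<nu>" "S \<subseteq> big m"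
  shows "prob_space (jump_law I (cut S) (num m))" "sets (jump_law I (cut S) (num m)) = sets (euclid I)"
    and "\<And>f B. f \<in> borel_measurable (euclid I) \<Longrightarrow> (AE u in \<nu>. u \<in> S \<longrightarrow> norm (f u) \<le> B) \<Longrightarrow>
      integrable (jump_law I (cut S) (num m)) (f :: _ \<Rightarrow> 'b::{banach, second_countable_topology})"
    and "\<And>f B. f \<in> borel_measurable (euclid I) \<Longrightarrow> (AE u in \<nu>. u \<in> S \<longrightarrow> norm (f u) \<le> B) \<Longrightarrow>
      (\<integral>u. f u \<partial>jump_law I (cut S) (num m)) = (f (\<lambda>k\<in>I. 0) :: 'b) +
      (1 / num m) *\<^sub>R (\<integral>u. indicator S u *\<^sub>R (f u - f (\<lambda>k\<in>I. 0)) \<partial>\<nu>)"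
proof -
  have S': "S \<subseteq> {u. eps m < L2_set u I}" using S(2) by (simp add: big_def)
  note c = S(1) eps_pos S'
  have "(\<integral>u. indicator S u \<partial>\<nu>) \<le> lam m"
    unfolding lam_def using S(2) big
    by (intro integral_mono cut_integrable_indicator[OF c] cut_integrable_indicator[OF big(1) eps_pos big(2)])
      (auto simp: indicator_def)
  then have l: "measure (cut S) (space (cut S)) \<le> num m"
    using num(2)[of m] by (simp only: finite_cut[OF c])
  have n: "real (num m) > 0" using num(1) by simp
  note jl = jump_law[OF finite_cut(1)[OF c] sets_cut(1) n l]
  show "prob_space (jump_law I (cut S) (num m))" "sets (jump_law I (cut S) (num m)) = sets (euclid I)"
    using jl(1,2) by auto
  fix f :: "_ \<Rightarrow> 'b::{banach, second_countable_topology}" and B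
  assume f: "f \<in> borel_measurable (euclid I)" and B: "AE u in \<nu>. u \<in> S \<longrightarrow> norm (f u) \<le> B"
  have fi: "integrable (cut S) f" by (rule cut_integrable_bounded[OF c f B])
  show "integrable (jump_law I (cut S) (num m)) f" by (rule jl(3)[OF f fi])
  show "(\<integral>u. f u \<partial>jump_law I (cut S) (num m)) = f (\<lambda>k\<in>I. 0) +
      (1 / num m) *\<^sub>R (\<integral>u. indicator S u *\<^sub>R (f u - f (\<lambda>k\<in>I. 0)) \<partial>\<nu>)"
    unfolding jl(4)[OF f fi] using f by (subst cut_integral(1)[OF c]) auto
qed

lemma approx: "prob_space (approx m)" "sets (approx m) = sets (euclid I)"
  unfolding approx_def by (rule prob_space_walk[OF jump(1,2)[OF big(1) order_refl]], rule sets_walk)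

lemma phi2_measurable [measurable]: "phi2 \<in> borel_measurable borel"
  unfolding phi2_def[abs_def] by measurable

lemma norm_zero_fun: "L2_set (\<lambda>k\<in>I. 0::real) I = 0"
  by (simp add: L2_set_def)

text \<open>The \<open>num m\<close> steps cost together the integral of
  \<open>phi2 (t * |u|)\<close> over \<open>big m\<close>, and \<open>phi2_scale\<close> with s =
  |u| / R bounds it by V / R^2 * \<open>phi2 (t * R)\<close>. The estimate is uniform in m, as the
  passage to the limit requires.\<close>

lemma laplace_bound_approx: "laplace_bound I V R (approx m)"
  unfolding laplace_bound_def
proof (intro allI impI)
  fix F B t assume F: "lip I 1 F" and B: "\<forall>y. \<bar>F y\<bar> \<le> B" and t: "(t::real) \<ge> 0"
  let ?J = "jump_law I (cut (big m)) (num m)"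
  define f where "f = (\<lambda>u. phi2 (t * L2_set u I))"
  have f [measurable]: "f \<in> borel_measurable (euclid I)" unfolding f_def by measurable
  have f\<nu>: "f \<in> borel_measurable \<nu>" by (simp add: meas_\<nu>)
  have le: "AE u in \<nu>. f u \<le> (L2_set u I)\<^sup>2 * (phi2 (t * R) / R\<^sup>2)"
    using AE_norm_le_R
  proof eventually_elim
    case (elim u)
    have "phi2 (L2_set u I / R * (t * R)) \<le> (L2_set u I / R)\<^sup>2 * phi2 (t * R)"
      using elim R_pos t by (intro phi2_scale) auto
    then show ?case using R_pos by (simp add: f_def power_divide mult.commute)
  qed
  have bd: "AE u in \<nu>. u \<in> big m \<longrightarrow> norm (f u) \<le> phi2 (t * R)"
    using AE_norm_le_R le
  proof eventually_elim
    case (elim u)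
    have "(L2_set u I)\<^sup>2 * (phi2 (t * R) / R\<^sup>2) \<le> R\<^sup>2 * (phi2 (t * R) / R\<^sup>2)"
      using elim(1) by (intro mult_right_mono power_mono divide_nonneg_nonneg phi2_nonneg) auto
    also have "\<dots> = phi2 (t * R)" using R_pos by simp
    finally have "f u \<le> phi2 (t * R)" using elim(2) by linarith
    then show ?case by (simp add: f_def phi2_nonneg)
  qed
  note j = jump[OF big(1)[of m] order_refl]
  have z: "f (\<lambda>k\<in>I. 0) = 0" by (simp add: f_def norm_zero_fun phi2_def)
  have fb: "f \<in> borel_measurable (euclid I)" by (rule f)
  have "(\<integral>u. indicator (big m) u *\<^sub>R f u \<partial>\<nu>) \<le> (\<integral>u. (L2_set u I)\<^sup>2 * (phi2 (t * R) / R\<^sup>2) \<partial>\<nu>)"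
  proof (rule integral_mono_AE)
    show "integrable \<nu> (\<lambda>u. indicator (big m) u *\<^sub>R f u)"
      by (rule cut_integrable_bounded[OF big(1) eps_pos big(2) fb bd])
    show "AE u in \<nu>. indicator (big m) u *\<^sub>R f u \<le> (L2_set u I)\<^sup>2 * (phi2 (t * R) / R\<^sup>2)"
      using le by eventually_elim (auto simp: indicator_def phi2_nonneg)
  qed (use integrable_sq in auto)
  also have "\<dots> = V / R\<^sup>2 * phi2 (t * R)" by (simp add: V_eq)
  finally have le2: "(\<integral>u. indicator (big m) u *\<^sub>R f u \<partial>\<nu>) \<le> V / R\<^sup>2 * phi2 (t * R)" .
  have eq: "(\<integral>u. f u \<partial>?J) = (1 / num m) * (\<integral>u. indicator (big m) u *\<^sub>R f u \<partial>\<nu>)"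
    using j(4)[OF fb bd] by (simp add: z)
  have "(\<integral>y. exp (t * F y) \<partial>approx m) \<le> exp (t * (\<integral>y. F y \<partial>approx m) + num m * (\<integral>u. f u \<partial>?J))"
    unfolding approx_def f_def
    by (rule walk_laplace[OF j(1,2) fin t j(3)[OF fb bd, unfolded f_def] order_refl F]) (use B in blast)
  also have "num m * (\<integral>u. f u \<partial>?J) = (\<integral>u. indicator (big m) u *\<^sub>R f u \<partial>\<nu>)"
    unfolding eq using num(1)[of m] by simp
  also have "exp (t * (\<integral>y. F y \<partial>approx m) + \<dots>) \<le> exp (t * (\<integral>y. F y \<partial>approx m) + V / R\<^sup>2 * phi2 (t * R))"
    using le2 by simp
  finally show "(\<integral>y. exp (t * F y) \<partial>approx m) \<le> exp (t * (\<integral>y. F y \<partial>approx m) + V / R\<^sup>2 * phi2 (t * R))" .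
qed

text \<open>Both 1 + w and exp w have modulus at most 1, so their n-th powers differ by at most n
  times their difference, which is quadratic in w. The factor 3 bounds exp 1.\<close>

lemma one_plus_div_power_exp:
  fixes \<psi> :: complex
  assumes n: "n > 0" and c: "norm \<psi> \<le> real n" "norm (1 + \<psi> / n) \<le> 1" "Re \<psi> \<le> 0"
  shows "norm ((1 + \<psi> / n) ^ n - exp \<psi>) \<le> 3 * (norm \<psi>)\<^sup>2 / n"
proof -
  define w where "w = \<psi> / n"
  have w: "norm w \<le> 1" using n c by (simp add: w_def norm_divide)
  have "Re w \<le> 0" using n c(3) by (simp add: w_def divide_nonpos_nonneg)
  then have "norm (exp w) \<le> 1" by simp
  then have "norm ((1 + w) ^ n - exp w ^ n) \<le> n * norm ((1 + w) - exp w)"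
    using c(2) by (intro norm_power_diff) (auto simp: w_def)
  also have "norm ((1 + w) - exp w) \<le> exp \<bar>Re w\<bar> * (norm w)\<^sup>2"
    using Taylor_exp[of w 1] by (simp add: norm_minus_commute numeral_2_eq_2 diff_diff_eq)
  also have "\<dots> \<le> 3 * (norm w)\<^sup>2"
  proof (rule mult_right_mono)
    have "exp \<bar>Re w\<bar> \<le> exp 1" using w abs_Re_le_cmod[of w] by simp
    then show "exp \<bar>Re w\<bar> \<le> 3" using exp_le by linarith
  qed simp
  also have "n * (3 * (norm w)\<^sup>2) = 3 * (norm \<psi>)\<^sup>2 / n"
    using n by (simp add: w_def norm_divide power_divide power2_eq_square)
  also have "exp w ^ n = exp \<psi>" using n by (simp add: w_def exp_of_nat_mult[symmetric])
  finally show ?thesis using n by (simp add: w_def mult_left_mono)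
qed

text \<open>\<open>T m\<close> is the characteristic function of a shifted compound Poisson law with
  jumps in \<open>big m\<close>. The walk is close to it by the choice of \<open>num m\<close>, and
  it tends to the characteristic function of P by dominated convergence in the Levy-Khintchine
  integral.\<close>

lemma approx_char: "(\<lambda>m. \<integral>x. iexp (ip I t x) \<partial>approx m) \<longlonglongrightarrow> (\<integral>x. iexp (ip I t x) \<partial>P)"
proof -
  define e where "e = (\<lambda>u. iexp (ip I t u))"
  have e [measurable]: "e \<in> borel_measurable (euclid I)" unfolding e_def by measurable
  have ez: "e (\<lambda>k\<in>I. 0) = 1" by (simp add: e_def ip_def)
  have eb: "AE u in \<nu>. u \<in> big m \<longrightarrow> norm (e u) \<le> 1" for m by (simp add: e_def)
  define \<psi> where "\<psi> = (\<lambda>m. \<integral>u. indicator (big m) u *\<^sub>R (e u - 1) \<partial>\<nu>)"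
  define T where "T = (\<lambda>m. exp (\<i> * ip I t (start m) + \<psi> m))"
  have c: "(\<integral>x. e x \<partial>approx m) = iexp (ip I t (start m)) * (1 + \<psi> m / num m) ^ num m" for m
  proof -
    note j = jump[OF big(1)[of m] order_refl]
    have "(\<integral>u. e u \<partial>jump_law I (cut (big m)) (num m)) = 1 + (1 / num m) *\<^sub>R \<psi> m"
      unfolding j(4)[OF e eb] ez \<psi>_def ..
    also have "(1 / num m) *\<^sub>R \<psi> m = \<psi> m / num m" by (simp add: scaleR_conv_of_real)
    finally show ?thesis
      unfolding approx_def e_def walk_char[OF j(1,2)] by simp
  qed
  have i\<psi>: "integrable \<nu> (\<lambda>u. indicator (big m) u *\<^sub>R (e u - 1))" for m
  proof (rule cut_integrable_bounded[OF big(1) eps_pos big(2)])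
    show "AE u in \<nu>. u \<in> big m \<longrightarrow> norm (e u - 1) \<le> 2"
      using norm_triangle_ineq4[of "e _" 1] by (auto simp: e_def intro!: AE_I2 order_trans[OF norm_triangle_ineq4])
  qed measurable
  have n\<psi>: "norm (\<psi> m) \<le> 2 * lam m" for m
  proof -
    have "norm (\<psi> m) \<le> (\<integral>u. norm (indicator (big m) u *\<^sub>R (e u - 1)) \<partial>\<nu>)"
      unfolding \<psi>_def by (rule integral_norm_bound)
    also have "\<dots> \<le> (\<integral>u. 2 * indicator (big m) u \<partial>\<nu>)"
    proof (rule integral_mono)
      show "integrable \<nu> (\<lambda>u. norm (indicator (big m) u *\<^sub>R (e u - 1)))" by (rule integrable_norm[OF i\<psi>])
      show "integrable \<nu> (\<lambda>u. 2 * indicator (big m) u :: real)"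
        by (intro integrable_mult_right cut_integrable_indicator[OF big(1) eps_pos big(2)])
      show "norm (indicator (big m) u *\<^sub>R (e u - 1)) \<le> 2 * indicator (big m) u" for u
        by (auto simp: indicator_def e_def intro!: order_trans[OF norm_triangle_ineq4])
    qed
    also have "\<dots> = 2 * lam m" by (simp add: lam_def)
    finally show ?thesis .
  qed
  have Re\<psi>: "Re (\<psi> m) \<le> 0" for m
  proof -
    have "Re (\<psi> m) = (\<integral>u. Re (indicator (big m) u *\<^sub>R (e u - 1)) \<partial>\<nu>)"
      unfolding \<psi>_def using i\<psi>[of m] by (rule integral_Re[symmetric])
    also have "\<dots> \<le> (\<integral>u. 0 \<partial>\<nu>)"
      using i\<psi>[of m] by (intro integral_mono integrable_Re) (auto simp: indicator_def e_def Re_exp)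
    finally show ?thesis by simp
  qed
  \<comment> \<open>The constant is 3 from the exponential approximation times the square of the 2
    in the bound for \<psi>.\<close>
  have err: "norm ((\<integral>x. e x \<partial>approx m) - T m) \<le> 12 * (1 / Suc m)" for m
  proof -
    note j = jump[OF big(1)[of m] order_refl]
    \<comment> \<open>The quantity is the characteristic function of a single step.\<close>
    have n1: "norm (1 + \<psi> m / num m) \<le> 1"
    proof -
      interpret J: prob_space "jump_law I (cut (big m)) (num m)" by (rule j)
      have "norm (\<integral>u. e u \<partial>jump_law I (cut (big m)) (num m)) \<le> (\<integral>u. norm (e u) \<partial>jump_law I (cut (big m)) (num m))"
        by (rule integral_norm_bound)
      also have "\<dots> = 1" by (simp add: e_def J.prob_space)
      also have "(\<integral>u. e u \<partial>jump_law I (cut (big m)) (num m)) = 1 + (1 / num m) *\<^sub>R \<psi> m"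
        unfolding j(4)[OF e eb] ez \<psi>_def ..
      also have "(1 / num m) *\<^sub>R \<psi> m = \<psi> m / num m" by (simp add: scaleR_conv_of_real)
      finally show ?thesis .
    qed
    have "(\<integral>x. e x \<partial>approx m) - T m = iexp (ip I t (start m)) * ((1 + \<psi> m / num m) ^ num m - exp (\<psi> m))"
      by (simp add: c T_def exp_add right_diff_distrib)
    then have "norm ((\<integral>x. e x \<partial>approx m) - T m) = norm ((1 + \<psi> m / num m) ^ num m - exp (\<psi> m))"
      by (simp add: norm_mult)
    also have "\<dots> \<le> 3 * (norm (\<psi> m))\<^sup>2 / num m"
      using n\<psi>[of m] num[of m] n1 Re\<psi>[of m] by (intro one_plus_div_power_exp) auto
    also have "\<dots> \<le> 3 * (2 * lam m)\<^sup>2 / num m"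
      using n\<psi>[of m] by (intro divide_right_mono mult_left_mono power_mono) auto
    also have "\<dots> = 12 * ((lam m)\<^sup>2 / num m)" by (simp add: power_mult_distrib)
    also have "\<dots> \<le> 12 * (1 / Suc m)" using num(4)[of m] by (intro mult_left_mono) auto
    finally show ?thesis .
  qed
  \<comment> \<open>The compensator hidden in \<open>start m\<close> joins \<psi> to form the
    Levy-Khintchine integrand, whose integral converges, whereas the two pieces may diverge
    separately.\<close>
  have T: "T m = exp (\<i> * ip I t \<beta> + (\<integral>u. indicator (big m) u *\<^sub>R lk t u \<partial>\<nu>))" for m
  proof -
    let ?S = "{u. eps m < L2_set u I \<and> L2_set u I \<le> 1}"
    have S: "(indicator ?S :: _ \<Rightarrow> real) \<in> borel_measurable \<nu>" "?S \<subseteq> {u. eps m < L2_set u I}"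
      by (measurable, auto)
    have iu: "integrable \<nu> (\<lambda>u. indicator ?S u *\<^sub>R u j)" if "j \<in> I" for j
      using that component_le_L2_set[OF fin that]
      by (intro cut_integrable_bounded[OF S(1) eps_pos S(2), where B=1] AE_I2)
        (auto intro: order_trans)
    have "ip I t (start m) = ip I t \<beta> - (\<Sum>j\<in>I. t j * (\<integral>u. indicator ?S u * u j \<partial>\<nu>))"
      by (simp add: ip_def start_def right_diff_distrib sum_subtractf)
    also have "(\<Sum>j\<in>I. t j * (\<integral>u. indicator ?S u * u j \<partial>\<nu>)) = (\<Sum>j\<in>I. (\<integral>u. t j * (indicator ?S u * u j) \<partial>\<nu>))"
      by simp
    also have "\<dots> = (\<integral>u. (\<Sum>j\<in>I. t j * (indicator ?S u * u j)) \<partial>\<nu>)"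
      using iu by (intro Bochner_Integration.integral_sum[symmetric] integrable_mult_right) auto
    also have "\<dots> = (\<integral>u. indicator ?S u * ip I t u \<partial>\<nu>)"
      by (simp add: ip_def sum_distrib_left mult.left_commute)
    finally have st: "ip I t (start m) = ip I t \<beta> - (\<integral>u. indicator ?S u * ip I t u \<partial>\<nu>)" .
    have ii: "integrable \<nu> (\<lambda>u. indicator ?S u * ip I t u)"
    proof -
      have "integrable \<nu> (\<lambda>u. \<Sum>j\<in>I. t j * (indicator ?S u *\<^sub>R u j))"
        using iu by (intro Bochner_Integration.integrable_sum integrable_mult_right) auto
      then show ?thesis by (simp add: ip_def sum_distrib_left mult.left_commute)
    qed
    have "(\<integral>u. indicator (big m) u *\<^sub>R lk t u \<partial>\<nu>) =
        (\<integral>u. indicator (big m) u *\<^sub>R (e u - 1) - \<i> * complex_of_real (indicator ?S u * ip I t u) \<partial>\<nu>)"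
      by (intro Bochner_Integration.integral_cong refl)
        (auto simp: lk_def e_def big_def indicator_def)
    also have "\<dots> = \<psi> m - \<i> * complex_of_real (\<integral>u. indicator ?S u * ip I t u \<partial>\<nu>)"
      unfolding \<psi>_def
      by (subst Bochner_Integration.integral_diff[OF i\<psi>])
        (simp_all only: integral_mult_right_zero integral_complex_of_real integrable_mult_right integrable_of_real[OF ii])
    finally have lk: "(\<integral>u. indicator (big m) u *\<^sub>R lk t u \<partial>\<nu>) =
        \<psi> m - \<i> * complex_of_real (\<integral>u. indicator ?S u * ip I t u \<partial>\<nu>)" .
    show ?thesis unfolding T_def st lk of_real_diff right_diff_distrib by (simp only: diff_add_eq add_diff_eq)
  qed
  have "(\<lambda>m. \<integral>u. indicator (big m) u *\<^sub>R lk t u \<partial>\<nu>) \<longlonglongrightarrow> (\<integral>u. lk t u \<partial>\<nu>)"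
  proof (rule integral_dominated_convergence[where w="\<lambda>u. norm (lk t u)"])
    note [measurable] = big(1)
    show "(\<lambda>u. indicator (big m) u *\<^sub>R lk t u) \<in> borel_measurable \<nu>" for m by measurable
    show "AE u in \<nu>. (\<lambda>m. indicator (big m) u *\<^sub>R lk t u) \<longlonglongrightarrow> lk t u"
    proof (intro AE_I2 indicator_big_tendsto)
      fix u assume "L2_set u I = 0"
      then show "lk t u = 0" using ip_Cauchy_Schwarz[of I t u] by (simp add: lk_def)
    qed
  qed (use integrable_lk in \<open>auto simp: indicator_def\<close>)
  then have "T \<longlonglongrightarrow> (\<integral>x. iexp (ip I t x) \<partial>P)"
    unfolding T[abs_def] char_P by (intro tendsto_intros)
  moreover have "(\<lambda>m. (\<integral>x. e x \<partial>approx m) - T m) \<longlonglongrightarrow> 0"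
  proof (rule Lim_null_comparison[OF always_eventually])
    show "\<forall>m. norm ((\<integral>x. e x \<partial>approx m) - T m) \<le> 12 * (1 / Suc m)" using err by blast
    show "(\<lambda>m. 12 * (1 / Suc m)) \<longlonglongrightarrow> (0::real)"
      using tendsto_mult[OF tendsto_const LIMSEQ_Suc[OF lim_1_over_n], of "12::real"] by simp
  qed
  ultimately have "(\<lambda>m. ((\<integral>x. e x \<partial>approx m) - T m) + T m) \<longlonglongrightarrow> 0 + (\<integral>x. iexp (ip I t x) \<partial>P)"
    by (intro tendsto_add)
  then show ?thesis by (simp add: e_def)
qed

theorem laplace_bound_P: "laplace_bound I V R P"
  by (rule laplace_bound_limit[OF fin approx P approx_char laplace_bound_approx])

lemma approx_tendsto:
  assumes "lip I 1 F" "\<And>y. \<bar>F y\<bar> \<le> B"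
  shows "(\<lambda>m. \<integral>x. F x \<partial>approx m) \<longlonglongrightarrow> (\<integral>x. F x \<partial>P)"
  using assms by (intro levy_continuity_lip[OF fin approx P approx_char]) auto

end

section \<open>The typical size of the norm\<close>

text \<open>
  This lower bound makes \<open>p (sqrt \<gamma> + k_gamma \<gamma> (1/4))\<close> at least two standard deviations of the part of \<open>X\<close> with
  jumps of size at most \<open>p\<close>, so that Chebyshev's inequality is enough to bound its tail by \<open>1/4\<close>.
\<close>
lemma k_gamma_quarter:
  assumes \<gamma>: "\<gamma> > 0"
  shows "k_gamma \<gamma> (1/4) \<ge> sqrt \<gamma>"
proof -
  define h where "h = (\<lambda>y. (y + \<gamma>) * ln (1 + y / \<gamma>) - y)"
  have deriv: "(h has_real_derivative ln (1 + y / \<gamma>)) (at y)" if "y \<ge> 0" for y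
  proof -
    have pos: "1 + y / \<gamma> > 0" using that \<gamma> by (simp add: add_pos_nonneg)
    have "(y + \<gamma>) * (1 / \<gamma> / (1 + y / \<gamma>)) = 1" using \<gamma> that by (simp add: field_simps)
    then show ?thesis unfolding h_def using pos
      by (auto intro!: derivative_eq_intros) (use \<gamma> that in \<open>simp add: field_simps\<close>)
  qed
  have mono: "h y < h z" if yz: "0 \<le> y" "y < z" for y z
  proof -
    obtain c where c: "y < c" "c < z" "h z - h y = (z - y) * ln (1 + c / \<gamma>)"
      using MVT2[OF yz(2), of h "\<lambda>y. ln (1 + y / \<gamma>)"] deriv yz by auto
    have "ln (1 + c / \<gamma>) > 0" using c(1) that \<gamma> by (intro ln_gt_zero) auto
    then have "(z - y) * ln (1 + c / \<gamma>) > 0" using that by simp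
    then show ?thesis using c by linarith
  qed
  \<comment> \<open>An explicit upper end for the intermediate value theorem: substituting 1 + y /
    \<gamma> = exp s makes h computable, and h \<ge> \<gamma> (s - 1) = ln 4.\<close>
  define s where "s = 1 + ln 4 / \<gamma>"
  have s: "s \<ge> 1" using \<gamma> by (simp add: s_def)
  define y1 where "y1 = \<gamma> * (exp s - 1)"
  have y1: "y1 \<ge> 0" using \<gamma> s by (simp add: y1_def)
  have "h y1 = \<gamma> * (exp s * (s - 1) + 1)"
  proof -
    have "1 + y1 / \<gamma> = exp s" using \<gamma> by (simp add: y1_def)
    then show ?thesis by (simp add: h_def y1_def algebra_simps)
  qed
  also have "\<dots> \<ge> \<gamma> * (s - 1)"
  proof (rule mult_left_mono)
    have "1 * (s - 1) \<le> exp s * (s - 1)" using s by (intro mult_right_mono) auto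
    then show "s - 1 \<le> exp s * (s - 1) + 1" by simp
  qed (use \<gamma> in simp)
  also have "\<gamma> * (s - 1) = ln 4" using \<gamma> by (simp add: s_def)
  finally have "ln 4 \<le> h y1" .
  moreover have "h 0 = 0" by (simp add: h_def)
  moreover have "isCont h y" if "0 \<le> y" for y using deriv[OF that] by (rule DERIV_isCont)
  ultimately obtain k where k: "0 \<le> k" "h k = ln 4"
    using IVT[of h 0 "ln 4" y1] y1 by auto
  have ln4: "ln (1/4::real) = - ln 4" by (simp add: ln_div)
  have "k_gamma \<gamma> (1/4) = k" unfolding k_gamma_def
  proof (rule the_equality)
    show "k \<ge> 0 \<and> k - (k + \<gamma>) * ln (1 + k / \<gamma>) = ln (1/4)" using k by (simp add: ln4 h_def)
    fix y assume y: "y \<ge> 0 \<and> y - (y + \<gamma>) * ln (1 + y / \<gamma>) = ln (1/4)"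
    then have "h y = h k" using k by (simp add: ln4 h_def)
    then show "y = k" using mono[of y k] mono[of k y] y k by (cases y k rule: linorder_cases) auto
  qed
  moreover have "k \<ge> sqrt \<gamma>"
  proof (rule ccontr)
    assume "\<not> k \<ge> sqrt \<gamma>"
    then have "k\<^sup>2 < (sqrt \<gamma>)\<^sup>2" using k by (intro power_strict_mono) auto
    then have "k\<^sup>2 < \<gamma>" using \<gamma> by simp
    \<comment> \<open>For k < sqrt \<gamma> this gives h k \<le> k^2 / \<gamma> < 1, which
      contradicts h k = ln 4 since exp 1 \<le> 3 < 4.\<close>
    have "ln (1 + k / \<gamma>) \<le> k / \<gamma>" using k \<gamma> by (intro ln_add_one_self_le_self) auto
    then have "h k \<le> (k + \<gamma>) * (k / \<gamma>) - k" unfolding h_def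
      using k \<gamma> by (intro diff_right_mono mult_left_mono) auto
    also have "\<dots> = k\<^sup>2 / \<gamma>" using \<gamma> by (simp add: field_simps power2_eq_square)
    also have "\<dots> < 1" using \<open>k\<^sup>2 < \<gamma>\<close> \<gamma> by simp
    finally have "ln 4 < (1::real)" using k by simp
    then have "(4::real) < exp 1" by (metis exp_less_mono exp_ln zero_less_numeral)
    then show False using exp_le by linarith
  qed
  ultimately show ?thesis by simp
qed

context bounded_id
begin

lemma Vsq_eq: "Vsq I \<nu> x = (\<integral>u. indicator {u. L2_set u I \<le> x} u * (L2_set u I)\<^sup>2 \<partial>\<nu>)"
  unfolding Vsq_def set_lebesgue_integral_def
  by (intro Bochner_Integration.integral_cong refl) (auto simp: indicator_def)

lemma integrable_cut_sq:
  assumes [measurable]: "(indicator S :: _ \<Rightarrow> real) \<in> borel_measurable \<nu>"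
  shows "integrable \<nu> (\<lambda>u. indicator S u * (L2_set u I)\<^sup>2)"
proof (rule Bochner_Integration.integrable_bound[OF integrable_sq])
  show "(\<lambda>u. indicator S u * (L2_set u I)\<^sup>2) \<in> borel_measurable \<nu>" by measurable
qed (auto simp: indicator_def)

lemma Vsq_mono: "x \<le> y \<Longrightarrow> Vsq I \<nu> x \<le> Vsq I \<nu> y"
  unfolding Vsq_eq
  by (intro integral_mono integrable_cut_sq) (measurable, auto simp: indicator_def)

text \<open>The infimum need not be attained, so the inequality is carried over from members of the
  set slightly above p, using that \<open>Vsq\<close> is monotone. The value p = 0 can occur, for a
  finite \<nu> that charges every neighbourhood of the origin.\<close>

lemma p_gamma:
  assumes \<gamma>: "\<gamma> > 0"
  shows "p_gamma I \<nu> \<gamma> \<ge> 0" "Vsq I \<nu> (p_gamma I \<nu> \<gamma>) \<le> \<gamma> * (p_gamma I \<nu> \<gamma>)\<^sup>2"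
proof -
  define A where "A = {x. x > 0 \<and> 0 < Vsq I \<nu> x / x\<^sup>2 \<and> Vsq I \<nu> x / x\<^sup>2 \<le> \<gamma>}"
  define p where "p = p_gamma I \<nu> \<gamma>"
  have p: "p = Inf A" by (simp add: p_def p_gamma_def A_def)
  \<comment> \<open>A member of the set: from R on, \<open>Vsq\<close> equals V, and the root makes
    V \<le> \<gamma> x^2.\<close>
  define x where "x = R + sqrt (V / \<gamma>)"
  have sq: "sqrt (V / \<gamma>) \<ge> 0" using V_pos \<gamma> by simp
  have x: "x > 0" "x \<ge> R" using sq R_pos unfolding x_def by linarith+
  have "Vsq I \<nu> x \<le> (\<integral>u. (L2_set u I)\<^sup>2 \<partial>\<nu>)" unfolding Vsq_eq
    by (intro integral_mono integrable_cut_sq integrable_sq) (measurable, auto simp: indicator_def)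
  then have Vx: "Vsq I \<nu> x = V" using Vsq_mono[OF x(2)] V_eq by linarith
  have "V / \<gamma> = (sqrt (V / \<gamma>))\<^sup>2" using V_pos \<gamma> by simp
  also have "\<dots> \<le> x\<^sup>2" using sq R_pos by (intro power_mono) (auto simp: x_def)
  finally have "V \<le> \<gamma> * x\<^sup>2" using \<gamma> by (simp add: field_simps)
  then have "x \<in> A" using x V_pos by (simp add: A_def Vx divide_le_eq)
  then have ne: "A \<noteq> {}" by auto
  have bdd: "bdd_below A" by (intro bdd_belowI[of _ 0]) (auto simp: A_def)
  show "p_gamma I \<nu> \<gamma> \<ge> 0" unfolding p_def[symmetric] p using ne by (intro cInf_greatest) (auto simp: A_def)
  have "Vsq I \<nu> p \<le> \<gamma> * (p + 1 / Suc n)\<^sup>2" for n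
  proof -
    have "Inf A < p + 1 / Suc n" by (simp add: p)
    then obtain x where x: "x \<in> A" "x < p + 1 / Suc n" using cInf_lessD[OF ne] by blast
    have "p \<le> x" unfolding p using x bdd by (intro cInf_lower)
    then have "Vsq I \<nu> p \<le> Vsq I \<nu> x" by (rule Vsq_mono)
    also have "\<dots> \<le> \<gamma> * x\<^sup>2" using x by (auto simp: A_def divide_le_eq)
    also have "\<dots> \<le> \<gamma> * (p + 1 / Suc n)\<^sup>2"
      using x \<gamma> by (intro mult_left_mono power_mono) (auto simp: A_def)
    finally show ?thesis .
  qed
  moreover have "(\<lambda>n. \<gamma> * (p + 1 / Suc n)\<^sup>2) \<longlonglongrightarrow> \<gamma> * (p + 0)\<^sup>2"
    by (intro tendsto_intros LIMSEQ_Suc[OF lim_1_over_n])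
  ultimately show "Vsq I \<nu> (p_gamma I \<nu> \<gamma>) \<le> \<gamma> * (p_gamma I \<nu> \<gamma>)\<^sup>2"
    unfolding p_def[symmetric] by (intro LIMSEQ_le_const[of _ "\<gamma> * p\<^sup>2"]) auto
qed

section \<open>The part with jumps of size at most p, and a median of the norm\<close>

context
  fixes \<gamma> :: real
  assumes \<gamma>: "\<gamma> > 0" and tail: "\<nu>bar I \<nu> (p_gamma I \<nu> \<gamma>) \<le> 1/4"
begin

definition p where "p = p_gamma I \<nu> \<gamma>"

definition small :: "nat \<Rightarrow> ('i \<Rightarrow> real) set"
  where "small m = {u. eps m < L2_set u I \<and> L2_set u I \<le> p}"

text \<open>Start and number of steps are those of \<open>approx m\<close>, so that the two walks
  can be compared step by step.\<close>

definition approx' :: "nat \<Rightarrow> ('i \<Rightarrow> real) measure"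
  where "approx' m = walk I (jump_law I (cut (small m)) (num m)) (start m) (num m)"

text \<open>The mean of \<open>approx' m\<close>.\<close>

definition center :: "nat \<Rightarrow> 'i \<Rightarrow> real"
  where "center m j = start m j + (\<integral>u. indicator (small m) u * u j \<partial>\<nu>)"

text \<open>The mean of the infinitely divisible law that keeps only the jumps of size at most
  p.\<close>

definition drift :: "'i \<Rightarrow> real"
  where "drift k = \<beta> k
      - (LINT y:{y\<in>space \<nu>. p < L2_set y I \<and> L2_set y I \<le> 1}|\<nu>. y k)
      + (LINT y:{y\<in>space \<nu>. 1 < L2_set y I \<and> L2_set y I \<le> p}|\<nu>. y k)"

lemma E_gamma_drift: "E_gamma I \<beta> \<nu> \<gamma> = L2_set drift I"
  by (simp add: E_gamma_def Let_def drift_def[abs_def] p_def L2_set_def)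

lemma small: "(indicator (small m) :: _ \<Rightarrow> real) \<in> borel_measurable \<nu>" "small m \<subseteq> big m"
    "small m \<subseteq> {u. eps m < L2_set u I}"
  unfolding small_def big_def by (measurable, auto)

lemma p_tail: "integrable \<nu> (indicator {u. p < L2_set u I} :: _ \<Rightarrow> real)"
  "(\<integral>u. indicator {u. p < L2_set u I} u \<partial>\<nu>) \<le> (1/4 :: real)"
proof -
  let ?S = "{u\<in>space \<nu>. p < L2_set u I}"
  have le: "emeasure \<nu> ?S \<le> ennreal (1/4)"
    using tail unfolding \<nu>bar_def p_def[symmetric]
    by (metis divide_ennreal_def ennreal_1 ennreal_divide_numeral ennreal_numeral numeral_One zero_le_one)
  have fin: "emeasure \<nu> ?S < \<infinity>" using le by (rule order_le_less_trans) simp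
  have c: "indicator {u. p < L2_set u I} u = (indicator ?S u :: real)" if "u \<in> space \<nu>" for u
    using that by (simp add: indicator_def)
  have "integrable \<nu> (indicator ?S :: _ \<Rightarrow> real)" using fin by (intro integrable_real_indicator) auto
  then show "integrable \<nu> (indicator {u. p < L2_set u I} :: _ \<Rightarrow> real)"
    by (subst Bochner_Integration.integrable_cong[where g="indicator ?S" and N=\<nu>]) (use c in auto)
  have "(\<integral>u. indicator {u. p < L2_set u I} u \<partial>\<nu>) = (\<integral>u. indicator ?S u \<partial>\<nu> :: real)"
    by (intro Bochner_Integration.integral_cong refl c)
  also have "\<dots> = measure \<nu> ?S" by simp
  also have "\<dots> \<le> 1/4" unfolding measure_def using le by (intro enn2real_leI) auto
  finally show "(\<integral>u. indicator {u. p < L2_set u I} u \<partial>\<nu>) \<le> (1/4 :: real)" .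
qed

text \<open>A step of one walk differs from that of the other only by jumps larger than p, which
  have probability at most 1 / (4 * \<open>num m\<close>); \<open>num m\<close> steps add up to 1/4.
  This is what the assumption on \<nu>bar is for.\<close>

lemma approx_compare:
  fixes g :: "('i \<Rightarrow> real) \<Rightarrow> real"
  assumes g: "g \<in> borel_measurable (euclid I)" "\<And>y. 0 \<le> g y" "\<And>y. g y \<le> 1"
  shows "(\<integral>y. g y \<partial>approx m) \<le> (\<integral>y. g y \<partial>approx' m) + 1/4"
proof -
  note j = jump[OF big(1)[of m] order_refl] and j' = jump[OF small(1,2)[of m]]
  have "(\<integral>y. g y \<partial>approx m) \<le> (\<integral>y. g y \<partial>approx' m) + num m * (1 / (4 * num m))"
    unfolding approx_def approx'_def
  proof (rule walk_compare[OF j(1,2) j'(1,2) _ g])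
    fix g :: "('i \<Rightarrow> real) \<Rightarrow> real"
    assume g: "g \<in> borel_measurable (euclid I)" and g01: "\<And>y. 0 \<le> g y" "\<And>y. g y \<le> 1"
    let ?z = "\<lambda>k\<in>I. 0"
    have gm [measurable]: "g \<in> borel_measurable \<nu>" using g by (simp add: meas_\<nu>)
    have b: "AE u in \<nu>. u \<in> S \<longrightarrow> norm (g u) \<le> 1" for S using g01 by (intro AE_I2) simp
    have b2: "AE u in \<nu>. u \<in> S \<longrightarrow> norm (g u - g ?z) \<le> 1" for S
    proof (intro AE_I2 impI)
      fix u show "norm (g u - g ?z) \<le> 1"
        using g01(1)[of u] g01(2)[of u] g01(1)[of ?z] g01(2)[of ?z] unfolding real_norm_def by linarith
    qed
    have g2: "(\<lambda>u. g u - g ?z) \<in> borel_measurable (euclid I)" using g by measurable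
    note i = cut_integrable_bounded(1)[OF big(1)[of m] eps_pos big(2) g2 b2]
    note i' = cut_integrable_bounded(1)[OF small(1)[of m] eps_pos small(3) g2 b2]
    have "(\<integral>u. indicator (big m) u *\<^sub>R (g u - g ?z) \<partial>\<nu>) - (\<integral>u. indicator (small m) u *\<^sub>R (g u - g ?z) \<partial>\<nu>) =
        (\<integral>u. indicator (big m) u *\<^sub>R (g u - g ?z) - indicator (small m) u *\<^sub>R (g u - g ?z) \<partial>\<nu>)"
      using i i' by simp
    also have "\<dots> \<le> (\<integral>u. indicator {u. p < L2_set u I} u \<partial>\<nu>)"
    proof (rule integral_mono[OF Bochner_Integration.integrable_diff[OF i i'] p_tail(1)])
      have "g u - g ?z \<le> 1" for u using g01(1)[of ?z] g01(2)[of u] by linarith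
      then show "indicator (big m) u *\<^sub>R (g u - g ?z) - indicator (small m) u *\<^sub>R (g u - g ?z) \<le>
          indicator {u. p < L2_set u I} u" for u
        by (auto simp: indicator_def big_def small_def)
    qed
    also have "\<dots> \<le> 1/4" by (rule p_tail)
    finally have d: "(\<integral>u. indicator (big m) u *\<^sub>R (g u - g ?z) \<partial>\<nu>) -
      (\<integral>u. indicator (small m) u *\<^sub>R (g u - g ?z) \<partial>\<nu>) \<le> 1/4" .
    have "1 / num m * ((\<integral>u. indicator (big m) u *\<^sub>R (g u - g ?z) \<partial>\<nu>) -
      (\<integral>u. indicator (small m) u *\<^sub>R (g u - g ?z) \<partial>\<nu>)) \<le> 1 / num m * (1/4)"
      using d by (intro mult_left_mono) auto
    then show "(\<integral>u. g u \<partial>jump_law I (cut (big m)) (num m)) \<le>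
        (\<integral>u. g u \<partial>jump_law I (cut (small m)) (num m)) + 1 / (4 * num m)"
      unfolding j(4)[OF g b] j'(4)[OF g b] by (simp add: right_diff_distrib)
  qed
  then show ?thesis using num(1)[of m] by simp
qed

text \<open>The variances of the steps add up to at most the second moment of \<nu> on |u| \<le> p,
  and the definition of p bounds this by \<gamma> p^2.\<close>

lemma approx'_moment:
  "integrable (approx' m) (sqdist I (center m))"
  "(\<integral>y. sqdist I (center m) y \<partial>approx' m) \<le> \<gamma> * p\<^sup>2"
proof -
  let ?J = "jump_law I (cut (small m)) (num m)"
  note j = jump[OF small(1,2)[of m]]
  have b1: "AE u in \<nu>. u \<in> small m \<longrightarrow> norm (u k) \<le> p" if "k \<in> I" for k
    by (intro AE_I2) (auto simp: small_def intro!: order_trans[OF component_le_L2_set[OF fin that]])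
  have b2: "AE u in \<nu>. u \<in> small m \<longrightarrow> norm ((u k)\<^sup>2) \<le> p\<^sup>2" if "k \<in> I" for k
    using b1[OF that] by eventually_elim (auto simp: abs_le_square_iff[symmetric])
  have m1: "(\<lambda>u. u k) \<in> borel_measurable (euclid I)" if "k \<in> I" for k using that by measurable
  have m2: "(\<lambda>u. (u k)\<^sup>2) \<in> borel_measurable (euclid I)" if "k \<in> I" for k using that by measurable
  have i1: "integrable ?J (\<lambda>u. u k)" if "k \<in> I" for k by (rule j(3)[OF m1[OF that] b1[OF that]])
  have i2: "integrable ?J (\<lambda>u. (u k)\<^sup>2)" if "k \<in> I" for k by (rule j(3)[OF m2[OF that] b2[OF that]])
  note w = walk_second_moment[OF j(1,2) i1 i2, where k="num m" and x="start m" and c="center m", folded approx'_def]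
  show "integrable (approx' m) (sqdist I (center m))" by (rule w)
  have "(\<Sum>k\<in>I. \<integral>u. (u k)\<^sup>2 \<partial>?J) = (\<Sum>k\<in>I. 1 / num m * (\<integral>u. indicator (small m) u *\<^sub>R (u k)\<^sup>2 \<partial>\<nu>))"
    by (intro sum.cong refl) (simp add: j(4)[OF m2 b2])
  also have "\<dots> = 1 / num m * (\<Sum>k\<in>I. \<integral>u. indicator (small m) u *\<^sub>R (u k)\<^sup>2 \<partial>\<nu>)"
    by (rule sum_distrib_left[symmetric])
  also have "(\<Sum>k\<in>I. \<integral>u. indicator (small m) u *\<^sub>R (u k)\<^sup>2 \<partial>\<nu>) =
      (\<integral>u. (\<Sum>k\<in>I. indicator (small m) u *\<^sub>R (u k)\<^sup>2) \<partial>\<nu>)"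
    by (intro Bochner_Integration.integral_sum[symmetric]
        cut_integrable_bounded(1)[OF small(1) eps_pos small(3) m2 b2])
  also have "\<dots> = (\<integral>u. indicator (small m) u * (L2_set u I)\<^sup>2 \<partial>\<nu>)"
    by (simp add: sum_distrib_left[symmetric] L2_set_def sum_nonneg)
  also have "1 / num m * \<dots> \<le> 1 / num m * Vsq I \<nu> p"
    unfolding Vsq_eq using small(1)
    by (intro mult_left_mono integral_mono integrable_cut_sq) (measurable, auto simp: indicator_def small_def)
  also have "\<dots> \<le> 1 / num m * (\<gamma> * p\<^sup>2)"
    using p_gamma[OF \<gamma>] by (intro mult_left_mono) (auto simp: p_def)
  finally have V: "num m * (\<Sum>k\<in>I. \<integral>u. (u k)\<^sup>2 \<partial>?J) \<le> \<gamma> * p\<^sup>2"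
    using num(1)[of m] by (simp add: field_simps)
  have "sqdist I (center m) (\<lambda>k. start m k + num m * (\<integral>u. u k \<partial>?J)) = 0"
    unfolding sqdist_def
  proof (intro sum.neutral ballI)
    fix k assume "k \<in> I"
    then have "(\<integral>u. u k \<partial>?J) = 1 / num m * (\<integral>u. indicator (small m) u * u k \<partial>\<nu>)"
      using j(4)[OF m1 b1] by simp
    then show "(start m k + num m * (\<integral>u. u k \<partial>?J) - center m k)\<^sup>2 = 0"
      using num(1)[of m] by (simp add: center_def)
  qed
  then show "(\<integral>y. sqdist I (center m) y \<partial>approx' m) \<le> \<gamma> * p\<^sup>2"
    using w(2) V by simp
qed

text \<open>First moments of \<nu> near the origin may diverge, so the two integrals in
  \<open>center m\<close> are combined first: they cancel for |u| \<le> min p 1, and what remains is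
  integrable.\<close>

lemma center_tendsto: "j \<in> I \<Longrightarrow> (\<lambda>m. center m j) \<longlonglongrightarrow> drift j"
proof -
  assume j: "j \<in> I"
  note [measurable] = component_measurable[OF j]
  have p0: "p \<ge> 0" using p_gamma(1)[OF \<gamma>] by (simp add: p_def)
  let ?A = "{u. p < L2_set u I \<and> L2_set u I \<le> 1}" and ?B = "{u. 1 < L2_set u I \<and> L2_set u I \<le> p}"
  let ?S = "\<lambda>m. {u. eps m < L2_set u I \<and> L2_set u I \<le> 1}"
  have cb: "\<bar>u j\<bar> \<le> b" if "L2_set u I \<le> b" for u b
    using order_trans[OF component_le_L2_set[OF fin j] that] .
  have iA: "integrable \<nu> (\<lambda>u. indicator ?A u * u j)"
    by (intro Bochner_Integration.integrable_bound[OF p_tail(1)])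
      (auto simp: indicator_def intro!: AE_I2 cb)
  have iB: "integrable \<nu> (\<lambda>u. indicator ?B u * u j)"
    using p0
    by (intro Bochner_Integration.integrable_bound[OF integrable_mult_right[OF finite_tail[of 1], of p]])
      (auto simp: indicator_def intro!: AE_I2 cb)
  have S1: "(indicator (?S m) :: _ \<Rightarrow> real) \<in> borel_measurable \<nu>" "?S m \<subseteq> {u. eps m < L2_set u I}" for m
    by (measurable, auto)
  have mj: "(\<lambda>u. u j) \<in> borel_measurable (euclid I)" using j by measurable
  have i1: "integrable \<nu> (\<lambda>u. indicator (?S m) u *\<^sub>R u j)" for m
    by (rule cut_integrable_bounded(1)[OF S1(1) eps_pos S1(2) mj, where B=1]) (auto intro!: AE_I2 cb)
  have i2: "integrable \<nu> (\<lambda>u. indicator (small m) u *\<^sub>R u j)" for m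
    by (rule cut_integrable_bounded(1)[OF small(1) eps_pos small(3) mj, where B=p])
      (auto simp: small_def intro!: AE_I2 cb)
  have c: "center m j = \<beta> j + (\<integral>u. indicator (big m) u * (indicator ?B u * u j - indicator ?A u * u j) \<partial>\<nu>)" for m
  proof -
    have "center m j = \<beta> j + (\<integral>u. indicator (small m) u *\<^sub>R u j - indicator (?S m) u *\<^sub>R u j \<partial>\<nu>)"
      using i1[of m] i2[of m] by (simp add: center_def start_def)
    also have "(\<integral>u. indicator (small m) u *\<^sub>R u j - indicator (?S m) u *\<^sub>R u j \<partial>\<nu>) =
        (\<integral>u. indicator (big m) u * (indicator ?B u * u j - indicator ?A u * u j) \<partial>\<nu>)"
      by (intro Bochner_Integration.integral_cong refl) (auto simp: indicator_def small_def big_def)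
    finally show ?thesis .
  qed
  have d: "drift j = \<beta> j + (\<integral>u. indicator ?B u * u j - indicator ?A u * u j \<partial>\<nu>)"
  proof -
    have "(LINT y:{y\<in>space \<nu>. p < L2_set y I \<and> L2_set y I \<le> 1}|\<nu>. y j) = (\<integral>u. indicator ?A u * u j \<partial>\<nu>)"
      "(LINT y:{y\<in>space \<nu>. 1 < L2_set y I \<and> L2_set y I \<le> p}|\<nu>. y j) = (\<integral>u. indicator ?B u * u j \<partial>\<nu>)"
      unfolding set_lebesgue_integral_def
      by (intro Bochner_Integration.integral_cong refl; simp add: indicator_def)+
    then show ?thesis using iA iB by (simp add: drift_def)
  qed
  have "(\<lambda>m. \<integral>u. indicator (big m) u * (indicator ?B u * u j - indicator ?A u * u j) \<partial>\<nu>)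
      \<longlonglongrightarrow> (\<integral>u. indicator ?B u * u j - indicator ?A u * u j \<partial>\<nu>)"
  proof (rule integral_dominated_convergence[where w="\<lambda>u. norm (indicator ?B u * u j - indicator ?A u * u j)"])
    note [measurable] = big(1)
    show "(\<lambda>u. indicator (big m) u * (indicator ?B u * u j - indicator ?A u * u j)) \<in> borel_measurable \<nu>" for m
      by measurable
    show "AE u in \<nu>. (\<lambda>m. indicator (big m) u * (indicator ?B u * u j - indicator ?A u * u j))
        \<longlonglongrightarrow> indicator ?B u * u j - indicator ?A u * u j"
    proof (intro AE_I2 indicator_big_tendsto[where 'b=real, unfolded real_scaleR_def])
      fix u assume "L2_set u I = 0"
      then have "u j = 0" using component_le_L2_set[OF fin j, of u] by simp
      then show "indicator ?B u * u j - indicator ?A u * u j = (0 :: real)" by simp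
    qed
  qed (use iA iB in \<open>auto simp: indicator_def\<close>)
  then show ?thesis unfolding c d by (intro tendsto_intros)
qed

text \<open>One quarter comes from Chebyshev's inequality for \<open>approx' m\<close>, the other
  from \<open>approx_compare\<close>.\<close>

lemma approx_median:
  assumes \<eta>: "\<eta> > 0"
  shows "\<forall>\<^sub>F m in sequentially.
    (\<integral>y. indicator {y. G2 I \<beta> \<nu> \<gamma> + \<eta> < L2_set y I} y \<partial>approx m) \<le> (1/2 :: real)"
proof -
  have p0: "p \<ge> 0" using p_gamma(1)[OF \<gamma>] by (simp add: p_def)
  \<comment> \<open>Half of \<eta> keeps r positive when p = 0; the other half absorbs the distance
    between the norms of \<open>center m\<close> and \<open>drift\<close>.\<close>
  define r where "r = p * (sqrt \<gamma> + k_gamma \<gamma> (1/4)) + \<eta> / 2"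
  have k: "2 * (p * sqrt \<gamma>) \<le> p * (sqrt \<gamma> + k_gamma \<gamma> (1/4))"
  proof -
    have "p * (2 * sqrt \<gamma>) \<le> p * (sqrt \<gamma> + k_gamma \<gamma> (1/4))"
      using k_gamma_quarter[OF \<gamma>] p0 by (intro mult_left_mono) auto
    then show ?thesis by simp
  qed
  have ps: "p * sqrt \<gamma> \<ge> 0" using p0 \<gamma> by simp
  have r: "r > 0" "2 * (p * sqrt \<gamma>) \<le> r" using k ps \<eta> by (auto simp: r_def)
  have "(2 * (p * sqrt \<gamma>))\<^sup>2 \<le> r\<^sup>2" using r(2) ps by (intro power_mono) auto
  then have r2: "\<gamma> * p\<^sup>2 / r\<^sup>2 \<le> 1/4" using \<gamma> r(1) by (simp add: power_mult_distrib field_simps)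
  have G2: "G2 I \<beta> \<nu> \<gamma> = (r - \<eta> / 2) + L2_set drift I"
    by (simp add: G2_def r_def E_gamma_drift p_def)
  have "(\<lambda>m. L2_set (center m) I) \<longlonglongrightarrow> L2_set drift I"
    unfolding L2_set_def by (intro tendsto_intros center_tendsto)
  then have "\<forall>\<^sub>F m in sequentially. L2_set (center m) I < L2_set drift I + \<eta> / 2"
    using \<eta> by (intro order_tendstoD(2)) auto
  then show ?thesis
  proof eventually_elim
    case (elim m)
    let ?g = "indicator {y. G2 I \<beta> \<nu> \<gamma> + \<eta> < L2_set y I} :: _ \<Rightarrow> real"
    have g [measurable]: "?g \<in> borel_measurable (euclid I)" by measurable
    have le: "?g y \<le> sqdist I (center m) y / r\<^sup>2" for y
    proof (cases "G2 I \<beta> \<nu> \<gamma> + \<eta> < L2_set y I")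
      case True
      have "L2_set y I \<le> L2_set (center m) I + L2_set (\<lambda>k. y k - center m k) I"
        using L2_set_triangle_ineq[of "center m" "\<lambda>k. y k - center m k" I] by simp
      then have "r \<le> L2_set (\<lambda>k. y k - center m k) I" using True elim by (simp add: G2)
      then have "r\<^sup>2 \<le> (L2_set (\<lambda>k. y k - center m k) I)\<^sup>2" using r by (intro power_mono) auto
      also have "\<dots> = sqdist I (center m) y" by (simp add: L2_set_def sqdist_def sum_nonneg)
      finally show ?thesis using r True by simp
    qed (simp add: sqdist_nonneg)
    have pr: "prob_space (approx' m)" "sets (approx' m) = sets (euclid I)"
      unfolding approx'_def by (rule prob_space_walk[OF jump(1,2)[OF small(1,2)]], rule sets_walk)
    have "(\<integral>y. ?g y \<partial>approx' m) \<le> (\<integral>y. sqdist I (center m) y / r\<^sup>2 \<partial>approx' m)"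
    proof (rule integral_mono[OF _ _ le])
      interpret prob_space "approx' m" by (rule pr)
      note [measurable_cong] = pr(2)
      show "integrable (approx' m) ?g" by (intro integrable_const_bound[where B=1]) auto
      show "integrable (approx' m) (\<lambda>y. sqdist I (center m) y / r\<^sup>2)" using approx'_moment(1) by simp
    qed
    also have "\<dots> \<le> \<gamma> * p\<^sup>2 / r\<^sup>2" using approx'_moment(2)[of m] by (simp add: divide_right_mono)
    also have "\<dots> \<le> 1/4" by (rule r2)
    finally show ?case using approx_compare[OF g, of m] by (auto simp: indicator_def)
  qed
qed

lemma G2_nonneg: "G2 I \<beta> \<nu> \<gamma> \<ge> 0"
proof -
  have "p \<ge> 0" using p_gamma(1)[OF \<gamma>] by (simp add: p_def)
  moreover have "k_gamma \<gamma> (1/4) \<ge> 0"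
    using k_gamma_quarter[OF \<gamma>] real_sqrt_ge_zero[of \<gamma>] \<gamma> by linarith
  ultimately show ?thesis using \<gamma> by (simp add: G2_def E_gamma_drift p_def[symmetric])
qed

lemma lip_min: "lip I 1 (\<lambda>y. min (L2_set y I) M)"
  unfolding lip_def
proof (intro allI)
  fix x y
  show "\<bar>min (L2_set x I) M - min (L2_set y I) M\<bar> \<le> 1 * L2_set (\<lambda>k. x k - y k) I"
    using lipD[OF lip_L2_set, of x I y] by linarith
qed

text \<open>If the mean exceeded a median by more than s, the norm would lie s below its mean with
  probability at least 1/2, against the lower Chernoff bound. The argument is run on the walks and
  only the mean is passed to the limit, since the indicator in \<open>approx_median\<close> is not
  Lipschitz.\<close>

lemma mean_truncated_norm:
  assumes s: "s \<ge> 0" "exp (- (V / R\<^sup>2) * ell (R * s / V)) < 1/2" and M: "M \<ge> 0"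
  shows "(\<integral>y. min (L2_set y I) M \<partial>P) \<le> G2 I \<beta> \<nu> \<gamma> + s"
proof (rule field_le_epsilon)
  fix \<eta> :: real assume \<eta>: "\<eta> > 0"
  let ?F = "\<lambda>y. min (L2_set y I) M"
  have B: "\<bar>?F y\<bar> \<le> M" for y using M by auto
  have "\<forall>\<^sub>F m in sequentially. (\<integral>y. ?F y \<partial>approx m) \<le> G2 I \<beta> \<nu> \<gamma> + s + \<eta>"
    using approx_median[OF \<eta>]
  proof eventually_elim
    case (elim m)
    interpret A: prob_space "approx m" by (rule approx)
    note [measurable_cong] = approx(2)[of m]
    define E where "E = (\<integral>y. ?F y \<partial>approx m)"
    show ?case
    proof (rule ccontr)
      assume "\<not> ?case"
      then have E: "E > G2 I \<beta> \<nu> \<gamma> + s + \<eta>" by (simp add: E_def)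
      let ?S = "{y\<in>space (approx m). ?F y - E \<le> - s}"
      let ?T = "{y\<in>space (approx m). G2 I \<beta> \<nu> \<gamma> + \<eta> < L2_set y I}"
      have "A.prob ?T = (\<integral>y. indicator ?T y \<partial>approx m)" by simp
      also have "\<dots> = (\<integral>y. indicator {y. G2 I \<beta> \<nu> \<gamma> + \<eta> < L2_set y I} y \<partial>approx m)"
        by (intro Bochner_Integration.integral_cong refl) (simp add: indicator_def)
      finally have T: "A.prob ?T \<le> 1/2" using elim by simp
      \<comment> \<open>Off \<open>?T\<close> the truncated norm is at most G2 + \<eta>, which is
        less than E - s.\<close>
      have "space (approx m) \<subseteq> ?S \<union> ?T" using E by auto
      then have "A.prob (space (approx m)) \<le> A.prob (?S \<union> ?T)" by (intro A.finite_measure_mono) auto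
      also have "\<dots> \<le> A.prob ?S + A.prob ?T" by (intro measure_Un_le) auto
      finally have "1 \<le> A.prob ?S + 1/2" using T by (simp add: A.prob_space)
      moreover have "A.prob ?S \<le> exp (- (V / R\<^sup>2) * ell (R * s / V))"
        unfolding E_def using s
        by (intro chernoff_lower[OF fin approx laplace_bound_approx V_pos R_pos lip_min B]) auto
      ultimately show False using s by linarith
    qed
  qed
  then have ev: "\<exists>N. \<forall>n\<ge>N. (\<integral>y. ?F y \<partial>approx n) \<le> G2 I \<beta> \<nu> \<gamma> + s + \<eta>"
    by (simp add: eventually_sequentially)
  show "(\<integral>y. ?F y \<partial>P) \<le> G2 I \<beta> \<nu> \<gamma> + s + \<eta>"
    by (rule LIMSEQ_le_const2[OF approx_tendsto[OF lip_min B] ev])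
qed

text \<open>The margin s is spent twice, from the median to the mean and from the mean to the tail.
  Truncating the norm at G2 + 2 s itself leaves the event unchanged.\<close>

theorem norm_tail:
  assumes s: "s \<ge> 0" "exp (- (V / R\<^sup>2) * ell (R * s / V)) < 1/2"
  shows "measure P {y\<in>space P. L2_set y I \<ge> G2 I \<beta> \<nu> \<gamma> + 2 * s} \<le> exp (- (V / R\<^sup>2) * ell (R * s / V))"
proof -
  define M where "M = G2 I \<beta> \<nu> \<gamma> + 2 * s"
  have M: "M \<ge> 0" using G2_nonneg s by (simp add: M_def)
  let ?F = "\<lambda>y. min (L2_set y I) M"
  have B: "\<bar>?F y\<bar> \<le> M" for y using M by auto
  interpret P: prob_space P by (rule P)
  note [measurable_cong] = P(2)
  have E: "(\<integral>y. ?F y \<partial>P) \<le> G2 I \<beta> \<nu> \<gamma> + s" by (rule mean_truncated_norm[OF s M])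
  have "measure P {y\<in>space P. L2_set y I \<ge> M} \<le> measure P {y\<in>space P. ?F y - (\<integral>y. ?F y \<partial>P) \<ge> s}"
    using E by (intro P.finite_measure_mono) (auto simp: M_def min_def)
  also have "\<dots> \<le> exp (- (V / R\<^sup>2) * ell (R * s / V))"
    using s by (intro chernoff[OF fin P laplace_bound_P V_pos R_pos lip_min B]) auto
  finally show ?thesis by (simp add: M_def)
qed

end

end

section \<open>The spectral theorem\<close>

lemma dim_mat_adjoint [simp]: "dim_row (mat_adjoint A) = dim_col A" "dim_col (mat_adjoint A) = dim_row A"
  by (simp_all add: mat_adjoint_def)

lemma mat_adjoint_carrier: "A \<in> carrier_mat n m \<Longrightarrow> mat_adjoint A \<in> carrier_mat m n"
  by (intro carrier_matI) auto

lemma mat_adjoint_index [simp]: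
  "i < dim_col A \<Longrightarrow> j < dim_row A \<Longrightarrow> mat_adjoint (A :: complex mat) $$ (i, j) = cnj (A $$ (j, i))"
  by (simp add: mat_adjoint_def mat_of_rows_index conjugate_complex_def)

lemma mat_mult_index:
  "A \<in> carrier_mat n m \<Longrightarrow> B \<in> carrier_mat m l \<Longrightarrow> i < n \<Longrightarrow> j < l \<Longrightarrow>
    (A * B) $$ (i, j) = (\<Sum>k<m. A $$ (i, k) * B $$ (k, j))"
  by (auto simp: scalar_prod_def atLeast0LessThan)

lemma mat_adjoint_adjoint: "mat_adjoint (mat_adjoint A) = (A :: complex mat)"
  by (rule eq_matI) auto

lemma mat_adjoint_mult:
  assumes "A \<in> carrier_mat n m" "B \<in> carrier_mat m l"
  shows "mat_adjoint (A * B) = mat_adjoint B * mat_adjoint (A :: complex mat)"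
proof (rule eq_matI)
  fix i j assume "i < dim_row (mat_adjoint B * mat_adjoint A)" "j < dim_col (mat_adjoint B * mat_adjoint A)"
  then have ij: "i < l" "j < n" using assms by auto
  have "mat_adjoint (A * B) $$ (i, j) = cnj ((A * B) $$ (j, i))" using ij assms by (intro mat_adjoint_index) auto
  also have "\<dots> = (\<Sum>k<m. cnj (A $$ (j, k)) * cnj (B $$ (k, i)))"
    unfolding mat_mult_index[OF assms ij(2,1)] by simp
  also have "\<dots> = (\<Sum>k<m. mat_adjoint B $$ (i, k) * mat_adjoint A $$ (k, j))"
    using ij assms by (intro sum.cong refl) (auto simp: mult.commute)
  also have "\<dots> = (mat_adjoint B * mat_adjoint A) $$ (i, j)"
    using ij by (intro mat_mult_index[symmetric, OF mat_adjoint_carrier[OF assms(2)] mat_adjoint_carrier[OF assms(1)]])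
  finally show "mat_adjoint (A * B) $$ (i, j) = (mat_adjoint B * mat_adjoint A) $$ (i, j)" .
qed (use assms in auto)

lemma unitaryD:
  assumes "unitary n U"
  shows "U \<in> carrier_mat n n" "mat_adjoint U \<in> carrier_mat n n"
    "U * mat_adjoint U = 1\<^sub>m n" "mat_adjoint U * U = 1\<^sub>m n"
proof -
  show U: "U \<in> carrier_mat n n" "U * mat_adjoint U = 1\<^sub>m n" using assms by (auto simp: unitary_def)
  then show U': "mat_adjoint U \<in> carrier_mat n n" by (intro mat_adjoint_carrier)
  show "mat_adjoint U * U = 1\<^sub>m n" by (rule mat_mult_left_right_inverse[OF U(1) U' U(2)])
qed

lemma unitaryI:
  assumes U: "U \<in> carrier_mat n n" and id: "mat_adjoint U * U = 1\<^sub>m n"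
  shows "unitary n U"
  unfolding unitary_def
  by (intro conjI U mat_mult_left_right_inverse[OF mat_adjoint_carrier[OF U] U id])

lemma unitary_adjoint: "unitary n U \<Longrightarrow> unitary n (mat_adjoint U)"
  by (intro unitaryI) (simp_all add: mat_adjoint_adjoint unitaryD)

lemma unitary_cancel:
  assumes "unitary n U" "X \<in> carrier_mat n n"
  shows "U * (mat_adjoint U * X) = X" "mat_adjoint U * (U * X) = X"
proof -
  note U = unitaryD[OF assms(1)]
  have "U * (mat_adjoint U * X) = U * mat_adjoint U * X"
    using U assms(2) by (intro assoc_mult_mat[symmetric, of _ n n _ n _ n]) auto
  then show "U * (mat_adjoint U * X) = X" using U assms(2) by simp
  have "mat_adjoint U * (U * X) = mat_adjoint U * U * X"
    using U assms(2) by (intro assoc_mult_mat[symmetric, of _ n n _ n _ n]) auto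
  then show "mat_adjoint U * (U * X) = X" using U assms(2) by simp
qed

lemma unitary_mult:
  assumes "unitary n U" "unitary n W"
  shows "unitary n (U * W)"
proof (rule unitaryI)
  note U = unitaryD[OF assms(1)] and W = unitaryD[OF assms(2)]
  show "U * W \<in> carrier_mat n n" using U W by auto
  have "mat_adjoint (U * W) * (U * W) = mat_adjoint W * (mat_adjoint U * (U * W))"
    unfolding mat_adjoint_mult[OF U(1) W(1)] using U W by (intro assoc_mult_mat[of _ n n _ n _ n]) auto
  also have "mat_adjoint U * (U * W) = mat_adjoint U * U * W"
    using U W by (intro assoc_mult_mat[symmetric, of _ n n _ n _ n]) auto
  also have "mat_adjoint W * \<dots> = 1\<^sub>m n" using U W by simp
  finally show "mat_adjoint (U * W) * (U * W) = 1\<^sub>m n" .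
qed

text \<open>Gram-Schmidt delivers orthogonal vectors that are not normalised, so the columns are
  divided by their norms. The factor c stays unspecified, because an eigenvector is needed only up
  to a scalar.\<close>

lemma unitary_completion:
  fixes v :: "complex vec"
  assumes v: "v \<in> carrier_vec n" "v \<noteq> 0\<^sub>v n"
  shows "\<exists>W c. unitary n W \<and> (\<forall>i<n. W $$ (i, 0) = c * v $ i)"
proof -
  interpret cof_vec_space n "TYPE(complex)" .
  define b where "b = basis_completion v"
  define ws where "ws = gram_schmidt n b"
  note bc = basis_completion[OF v, folded b_def]
  have n: "n > 0" using v by (cases n) auto
  have "b \<noteq> []" using bc(6) n by auto
  then obtain vs where bv: "b = v # vs" using bc(7) by (cases b) auto
  from gram_schmidt_result[OF bc(2,4,5) refl, folded ws_def]
  have ws: "set ws \<subseteq> carrier_vec n" "corthogonal ws" "length ws = n" using bc(6) by auto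
  have hd: "ws ! 0 = v" using gram_schmidt_hd[OF v(1), of vs, folded bv] ws(3) n
    unfolding ws_def by (metis hd_conv_nth length_greater_0_conv)
  define ns where "ns j = (\<Sum>k<n. (cmod (ws ! j $ k))\<^sup>2)" for j
  define W where "W = Matrix.mat n n (\<lambda>(i, j). ws ! j $ i / complex_of_real (sqrt (ns j)))"
  have W: "W \<in> carrier_mat n n" by (simp add: W_def)
  have ip: "ws ! j \<bullet>c ws ! i = (\<Sum>k<n. ws ! j $ k * cnj (ws ! i $ k))" if "i < n" "j < n" for i j
  proof -
    have "ws ! i \<in> carrier_vec n" "ws ! j \<in> carrier_vec n" using ws that by auto
    then show ?thesis by (auto simp: scalar_prod_def atLeast0LessThan conjugate_complex_def intro!: sum.cong)
  qed
  have ip_self: "(\<Sum>k<n. ws ! j $ k * cnj (ws ! j $ k)) = complex_of_real (ns j)" for j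
    unfolding ns_def of_real_sum by (intro sum.cong refl) (simp only: complex_norm_square)
  have ns: "ns j > 0" if "j < n" for j
  proof -
    have "ws ! j \<bullet>c ws ! j \<noteq> 0" using corthogonalD[OF ws(2), of j j] that ws(3) by simp
    then have "ns j \<noteq> 0" using ip[OF that that] ip_self[of j] by auto
    moreover have "ns j \<ge> 0" unfolding ns_def by (intro sum_nonneg) auto
    ultimately show ?thesis by simp
  qed
  have "mat_adjoint W * W = 1\<^sub>m n"
  proof (rule eq_matI)
    fix i j assume "i < dim_row (1\<^sub>m n)" "j < dim_col (1\<^sub>m n)"
    then have ij: "i < n" "j < n" by auto
    have "(mat_adjoint W * W) $$ (i, j) = (\<Sum>k<n. mat_adjoint W $$ (i, k) * W $$ (k, j))"
      by (rule mat_mult_index[OF mat_adjoint_carrier[OF W] W ij])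
    also have "\<dots> = (\<Sum>k<n. (ws ! j $ k * cnj (ws ! i $ k)) / complex_of_real (sqrt (ns i) * sqrt (ns j)))"
      using ij by (intro sum.cong refl) (auto simp: W_def mult.commute)
    also have "\<dots> = (ws ! j \<bullet>c ws ! i) / complex_of_real (sqrt (ns i) * sqrt (ns j))"
      unfolding ip[OF ij] by (rule sum_divide_distrib[symmetric])
    also have "\<dots> = (if i = j then 1 else 0)"
    proof (cases "i = j")
      case True
      have "sqrt (ns j) * sqrt (ns j) = ns j" using ns[OF ij(2)] by simp
      then show ?thesis using True ip[OF ij] ip_self[of j] ns[OF ij(2)] by simp
    next
      case False
      then show ?thesis using corthogonalD[OF ws(2), of j i] ij ws(3) by simp
    qed
    finally show "(mat_adjoint W * W) $$ (i, j) = 1\<^sub>m n $$ (i, j)" using ij by simp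
  qed (use W in auto)
  then have "unitary n W" by (rule unitaryI[OF W])
  moreover have "\<forall>i<n. W $$ (i, 0) = (1 / complex_of_real (sqrt (ns 0))) * v $ i"
    using n by (auto simp: W_def hd)
  ultimately show ?thesis by blast
qed

definition diagonalizes :: "nat \<Rightarrow> complex mat \<Rightarrow> complex mat \<Rightarrow> (nat \<Rightarrow> real) \<Rightarrow> bool"
  where "diagonalizes n M U l \<longleftrightarrow> unitary n U \<and>
    M = U * mat_diag n (\<lambda>i. complex_of_real (l i)) * mat_adjoint U"

lemma hermitian_conj:
  assumes M: "M \<in> carrier_mat n n" "hermitian M" and W: "W \<in> carrier_mat n n"
  shows "hermitian (mat_adjoint W * M * W)"
proof -
  note W' = mat_adjoint_carrier[OF W]
  have "mat_adjoint (mat_adjoint W * M * W) = mat_adjoint W * (mat_adjoint M * mat_adjoint (mat_adjoint W))"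
    using M W W' mat_adjoint_carrier[OF M(1)]
    by (simp add: mat_adjoint_mult[of _ n n _ n] mat_adjoint_adjoint assoc_mult_mat[of _ n n _ n _ n])
  also have "\<dots> = mat_adjoint W * M * W"
    using M W W' by (simp add: mat_adjoint_adjoint hermitian_def assoc_mult_mat[of _ n n _ n _ n])
  finally show ?thesis by (simp add: hermitian_def)
qed

text \<open>Deflation: conjugation with a unitary matrix whose first column is an eigenvector clears
  the rest of the first column, and Hermitian symmetry then clears the first row and makes the
  eigenvalue real. The induction hypothesis applies to the remaining block.\<close>

lemma spectral_theorem:
  assumes "M \<in> carrier_mat n n" "hermitian M"
  shows "\<exists>U l. diagonalizes n M U l"
  using assms
proof (induction n arbitrary: M)
  case 0
  have "unitary 0 (1\<^sub>m 0)" by (auto simp: unitary_def)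
  moreover have "M = 1\<^sub>m 0 * mat_diag 0 (\<lambda>i. complex_of_real 0) * mat_adjoint (1\<^sub>m 0)"
    using 0 by (intro eq_matI) auto
  ultimately show ?case unfolding diagonalizes_def by (intro exI[of _ "1\<^sub>m 0"] exI[of _ "\<lambda>_. 0"]) auto
next
  case (Suc n)
  let ?N = "Suc n"
  note M = Suc.prems
  have "degree (char_poly M) = ?N" using degree_monic_char_poly[OF M(1)] by simp
  then have "\<not> constant (poly (char_poly M))" by (simp add: constant_degree)
  then obtain e where "poly (char_poly M) e = 0" using fundamental_theorem_of_algebra by blast
  then have "eigenvalue M e" using eigenvalue_root_char_poly[OF M(1)] by simp
  then obtain v where v: "v \<in> carrier_vec ?N" "v \<noteq> 0\<^sub>v ?N" "M *\<^sub>v v = e \<cdot>\<^sub>v v"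
    using M(1) unfolding eigenvalue_def eigenvector_def by auto
  from unitary_completion[OF v(1,2)] obtain W c where
    W: "unitary ?N W" and Wv: "\<And>i. i < ?N \<Longrightarrow> W $$ (i, 0) = c * v $ i" by blast
  note uW = unitaryD[OF W]
  define B where "B = mat_adjoint W * M * W"
  have B: "B \<in> carrier_mat ?N ?N" using uW M by (auto simp: B_def)
  have hB: "mat_adjoint B = B" using hermitian_conj[OF M uW(1)] by (simp add: hermitian_def B_def)
  have B0: "B $$ (i, 0) = (if i = 0 then e else 0)" if i: "i < ?N" for i
  proof -
    have MW: "(M * W) $$ (k, 0) = e * W $$ (k, 0)" if k: "k < ?N" for k
    proof -
      have "(M * W) $$ (k, 0) = (\<Sum>j<?N. M $$ (k, j) * (c * v $ j))"
        using k by (subst mat_mult_index[OF M(1) uW(1)]) (auto simp: Wv)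
      also have "\<dots> = c * (\<Sum>j<?N. M $$ (k, j) * v $ j)"
        unfolding sum_distrib_left by (intro sum.cong refl) (simp only: mult.left_commute)
      also have "(\<Sum>j<?N. M $$ (k, j) * v $ j) = (M *\<^sub>v v) $ k"
        using k M(1) v(1) by (auto simp: scalar_prod_def atLeast0LessThan)
      also have "\<dots> = e * v $ k" using k v by simp
      finally show ?thesis using Wv[OF k] by simp
    qed
    have "B $$ (i, 0) = (mat_adjoint W * (M * W)) $$ (i, 0)"
      unfolding B_def using uW M by (simp add: assoc_mult_mat[of _ ?N ?N _ ?N _ ?N])
    also have "\<dots> = (\<Sum>k<?N. mat_adjoint W $$ (i, k) * (M * W) $$ (k, 0))"
      using i uW M by (intro mat_mult_index[of _ ?N ?N _ ?N]) auto
    also have "\<dots> = e * (\<Sum>k<?N. mat_adjoint W $$ (i, k) * W $$ (k, 0))"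
      unfolding sum_distrib_left by (intro sum.cong refl) (simp only: MW lessThan_iff mult.left_commute)
    also have "(\<Sum>k<?N. mat_adjoint W $$ (i, k) * W $$ (k, 0)) = (mat_adjoint W * W) $$ (i, 0)"
      using i uW by (intro mat_mult_index[symmetric, of _ ?N ?N _ ?N]) auto
    also have "e * \<dots> = (if i = 0 then e else 0)" using i uW(4) by simp
    finally show ?thesis .
  qed
  have hBi: "B $$ (i, j) = cnj (B $$ (j, i))" if "i < ?N" "j < ?N" for i j
    using mat_adjoint_index[of i B j] that B hB by auto
  have e_real: "e = complex_of_real (Re e)"
  proof -
    have "e = cnj e" using hBi[of 0 0] B0[of 0] by simp
    then show ?thesis by (metis Reals_cnj_iff of_real_Re)
  qed
  define B3 where "B3 = Matrix.mat n n (\<lambda>(i, j). B $$ (Suc i, Suc j))"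
  have B3: "B3 \<in> carrier_mat n n" by (simp add: B3_def)
  have "hermitian B3" unfolding hermitian_def
  proof (rule eq_matI)
    fix i j assume "i < dim_row B3" "j < dim_col B3"
    then have "i < n" "j < n" using B3 by auto
    then show "mat_adjoint B3 $$ (i, j) = B3 $$ (i, j)"
      using hBi[of "Suc i" "Suc j"] by (simp add: B3_def)
  qed (use B3 in auto)
  from Suc.IH[OF B3 this] obtain U3 l3 where
    U3: "unitary n U3" and B3_eq: "B3 = U3 * mat_diag n (\<lambda>i. complex_of_real (l3 i)) * mat_adjoint U3"
    by (auto simp: diagonalizes_def)
  note u3 = unitaryD[OF U3]
  define D3 where "D3 = mat_diag n (\<lambda>i. complex_of_real (l3 i))"
  have D3: "D3 \<in> carrier_mat n n" by (simp add: D3_def)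
  define U4 where "U4 = four_block_mat (1\<^sub>m 1) (0\<^sub>m 1 n) (0\<^sub>m n 1) U3"
  have U4: "U4 \<in> carrier_mat ?N ?N" using four_block_carrier_mat[of "1\<^sub>m 1" 1 1 U3 n n] u3 by (simp add: U4_def)
  have aU4: "mat_adjoint U4 = four_block_mat (1\<^sub>m 1) (0\<^sub>m 1 n) (0\<^sub>m n 1) (mat_adjoint U3)"
    using u3(1) by (intro eq_matI) (auto simp: U4_def)
  have "U4 * mat_adjoint U4 = four_block_mat (1\<^sub>m 1) (0\<^sub>m 1 n) (0\<^sub>m n 1) (1\<^sub>m n)"
    unfolding aU4 unfolding U4_def using u3
    by (subst mult_four_block_mat[of _ 1 1 _ n _ n _ _ 1 _ n]) auto
  also have "\<dots> = 1\<^sub>m ?N" by (intro eq_matI) auto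
  finally have uU4: "unitary ?N U4" using U4 by (simp add: unitary_def)
  define l where "l = (\<lambda>i. case i of 0 \<Rightarrow> Re e | Suc j \<Rightarrow> l3 j)"
  define D where "D = mat_diag ?N (\<lambda>i. complex_of_real (l i))"
  have D: "D \<in> carrier_mat ?N ?N" by (simp add: D_def)
  have D_eq: "D = four_block_mat (Matrix.mat 1 1 (\<lambda>_. e)) (0\<^sub>m 1 n) (0\<^sub>m n 1) D3"
    using e_real by (intro eq_matI) (auto simp: D_def D3_def mat_diag_def l_def split: nat.splits)
  have "U4 * D * mat_adjoint U4 = four_block_mat (Matrix.mat 1 1 (\<lambda>_. e)) (0\<^sub>m 1 n) (0\<^sub>m n 1) (U3 * D3 * mat_adjoint U3)"
  proof -
    have "U4 * D = four_block_mat (Matrix.mat 1 1 (\<lambda>_. e)) (0\<^sub>m 1 n) (0\<^sub>m n 1) (U3 * D3)"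
      unfolding D_eq U4_def using u3 D3
      by (subst mult_four_block_mat[of _ 1 1 _ n _ n _ _ 1 _ n]) auto
    then show ?thesis unfolding aU4 using u3 D3
      by (simp, subst mult_four_block_mat[of _ 1 1 _ n _ n _ _ 1 _ n]) auto
  qed
  also have "U3 * D3 * mat_adjoint U3 = B3" by (simp add: B3_eq D3_def)
  also have "four_block_mat (Matrix.mat 1 1 (\<lambda>_. e)) (0\<^sub>m 1 n) (0\<^sub>m n 1) B3 = B"
  proof (rule eq_matI)
    fix i j assume "i < dim_row B" "j < dim_col B"
    then have ij: "i < ?N" "j < ?N" using B by auto
    show "four_block_mat (Matrix.mat 1 1 (\<lambda>_. e)) (0\<^sub>m 1 n) (0\<^sub>m n 1) B3 $$ (i, j) = B $$ (i, j)"
      using ij B0[of i] B0[of j] hBi[of i j] by (cases i; cases j) (auto simp: B3_def)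
  qed (use B B3 in auto)
  finally have B_eq: "B = U4 * D * mat_adjoint U4" by simp
  define U where "U = W * U4"
  have U: "unitary ?N U" unfolding U_def by (rule unitary_mult[OF W uU4])
  have "M = W * B * mat_adjoint W"
    unfolding B_def using uW M unitary_cancel[OF W]
    by (simp add: assoc_mult_mat[of _ ?N ?N _ ?N _ ?N])
  then have "M = W * (U4 * D * mat_adjoint U4) * mat_adjoint W" by (simp add: B_eq)
  also have "\<dots> = U * D * mat_adjoint U"
    unfolding U_def mat_adjoint_mult[OF uW(1) U4] using uW U4 D mat_adjoint_carrier[OF U4]
    by (simp add: assoc_mult_mat[of _ ?N ?N _ ?N _ ?N])
  finally show ?case using U unfolding diagonalizes_def D_def by blast
qed

section \<open>Traces of functions of Hermitian matrices\<close>

text \<open>The squared Frobenius norm.\<close>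

definition frob2 :: "nat \<Rightarrow> complex mat \<Rightarrow> real"
  where "frob2 n M = (\<Sum>i<n. \<Sum>j<n. (cmod (M $$ (i, j)))\<^sup>2)"

lemma frob2_adjoint:
  assumes "M \<in> carrier_mat n n"
  shows "frob2 n (mat_adjoint M) = frob2 n M"
proof -
  have "frob2 n (mat_adjoint M) = (\<Sum>i<n. \<Sum>j<n. (cmod (M $$ (j, i)))\<^sup>2)"
    unfolding frob2_def using assms by (intro sum.cong refl) auto
  also have "\<dots> = frob2 n M" unfolding frob2_def by (rule sum.swap)
  finally show ?thesis .
qed

text \<open>In this form the invariance under multiplication by a unitary matrix from the left is
  immediate; the adjoint gives the one from the right.\<close>

lemma frob2_trace:
  assumes M: "M \<in> carrier_mat n n"
  shows "complex_of_real (frob2 n M) = (\<Sum>j<n. (mat_adjoint M * M) $$ (j, j))"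
proof -
  have "(\<Sum>j<n. (mat_adjoint M * M) $$ (j, j)) = (\<Sum>j<n. \<Sum>i<n. mat_adjoint M $$ (j, i) * M $$ (i, j))"
    using M by (intro sum.cong refl mat_mult_index[OF mat_adjoint_carrier[OF M] M]) auto
  also have "\<dots> = (\<Sum>j<n. \<Sum>i<n. complex_of_real ((cmod (M $$ (i, j)))\<^sup>2))"
  proof (intro sum.cong refl)
    fix j i assume "j \<in> {..<n}" "i \<in> {..<n}"
    then have "mat_adjoint M $$ (j, i) = cnj (M $$ (i, j))" using M by (intro mat_adjoint_index) auto
    then show "mat_adjoint M $$ (j, i) * M $$ (i, j) = complex_of_real ((cmod (M $$ (i, j)))\<^sup>2)"
      by (simp only: complex_norm_square mult.commute)
  qed
  also have "\<dots> = (\<Sum>i<n. \<Sum>j<n. complex_of_real ((cmod (M $$ (i, j)))\<^sup>2))" by (rule sum.swap)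
  finally show ?thesis by (simp only: frob2_def of_real_sum)
qed

lemma frob2_unitary_left:
  assumes U: "unitary n U" and M: "M \<in> carrier_mat n n"
  shows "frob2 n (U * M) = frob2 n M"
proof -
  note u = unitaryD[OF U]
  have "mat_adjoint (U * M) * (U * M) = mat_adjoint M * (mat_adjoint U * (U * M))"
    unfolding mat_adjoint_mult[OF u(1) M] using u(1,2) M mat_adjoint_carrier[OF M]
    by (intro assoc_mult_mat[of _ n n _ n _ n]) auto
  also have "\<dots> = mat_adjoint M * M" by (simp only: unitary_cancel[OF U M])
  finally have "complex_of_real (frob2 n (U * M)) = complex_of_real (frob2 n M)"
    by (simp only: frob2_trace[OF M] frob2_trace[OF mult_carrier_mat[OF u(1) M]])
  then show ?thesis by simp
qed

lemma frob2_unitary_right: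
  assumes U: "unitary n U" and M: "M \<in> carrier_mat n n"
  shows "frob2 n (M * U) = frob2 n M"
proof -
  note u = unitaryD[OF U]
  have "frob2 n (M * U) = frob2 n (mat_adjoint (M * U))"
    using u(1) M by (intro frob2_adjoint[symmetric]) auto
  also have "\<dots> = frob2 n (mat_adjoint M)"
    unfolding mat_adjoint_mult[OF M u(1)]
    by (intro frob2_unitary_left unitary_adjoint U mat_adjoint_carrier M)
  finally show ?thesis by (simp add: frob2_adjoint[OF M])
qed

lemma unitary_cancel_right:
  assumes "unitary n U" "X \<in> carrier_mat n n"
  shows "X * U * mat_adjoint U = X" "X * mat_adjoint U * U = X"
  using assoc_mult_mat[OF assms(2) unitaryD(1,2)[OF assms(1)]] assoc_mult_mat[OF assms(2) unitaryD(2,1)[OF assms(1)]]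
    right_mult_one_mat[OF assms(2)]
  by (simp_all only: unitaryD(3,4)[OF assms(1)])

abbreviation rdiag :: "nat \<Rightarrow> (nat \<Rightarrow> real) \<Rightarrow> complex mat"
  where "rdiag n l \<equiv> mat_diag n (\<lambda>i. complex_of_real (l i))"

lemma rdiag_carrier: "rdiag n l \<in> carrier_mat n n" by simp

lemma diagonalizesD:
  assumes "diagonalizes n M U l"
  shows "unitary n U" "M = U * rdiag n l * mat_adjoint U" "M \<in> carrier_mat n n"
proof -
  show U: "unitary n U" and M: "M = U * rdiag n l * mat_adjoint U"
    using assms by (auto simp only: diagonalizes_def)
  note u = unitaryD[OF U]
  show "M \<in> carrier_mat n n" unfolding M
    by (rule mult_carrier_mat[OF mult_carrier_mat[OF u(1) rdiag_carrier] u(2)])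
qed

text \<open>W holds the scalar products of the two eigenbases, and in them M - M' has the entries
  W_ij (l_j - l'_i). With M = M' this proves that \<open>mat_fun\<close> is well defined; in general
  it compares the two spectra.\<close>

lemma diagonalizes_intertwine:
  assumes M: "diagonalizes n M U l" and M': "diagonalizes n M' U' l'"
  defines "W \<equiv> mat_adjoint U' * U"
  shows "unitary n W" "mat_adjoint U' * (M - M') * U = W * rdiag n l - rdiag n l' * W"
proof -
  note U = diagonalizesD(1)[OF M] and U' = diagonalizesD(1)[OF M']
  note u = unitaryD[OF U] and u' = unitaryD[OF U']
  show W: "unitary n W" unfolding W_def by (intro unitary_mult unitary_adjoint U U')
  note Mc = diagonalizesD(3)[OF M] diagonalizesD(3)[OF M']
  have 1: "mat_adjoint U' * M * U = W * rdiag n l"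
  proof -
    note M_eq = diagonalizesD(2)[OF M]
    have UD: "U * rdiag n l \<in> carrier_mat n n" by (rule mult_carrier_mat[OF u(1) rdiag_carrier])
    have "mat_adjoint U' * M * U = mat_adjoint U' * (M * U)"
      by (rule assoc_mult_mat[OF u'(2) Mc(1) u(1)])
    also have "M * U = U * rdiag n l" unfolding M_eq by (rule unitary_cancel_right(2)[OF U UD])
    also have "mat_adjoint U' * (U * rdiag n l) = W * rdiag n l" unfolding W_def
      by (rule assoc_mult_mat[OF u'(2) u(1) rdiag_carrier, symmetric])
    finally show ?thesis .
  qed
  have 2: "mat_adjoint U' * M' * U = rdiag n l' * W"
  proof -
    note M_eq = diagonalizesD(2)[OF M']
    have DU: "rdiag n l' * mat_adjoint U' \<in> carrier_mat n n" by (rule mult_carrier_mat[OF rdiag_carrier u'(2)])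
    have "M' = U' * (rdiag n l' * mat_adjoint U')" unfolding M_eq
      by (rule assoc_mult_mat[OF u'(1) rdiag_carrier u'(2)])
    then have "mat_adjoint U' * M' = mat_adjoint U' * (U' * (rdiag n l' * mat_adjoint U'))" by (rule arg_cong)
    also have "\<dots> = rdiag n l' * mat_adjoint U'" by (rule unitary_cancel(2)[OF U' DU])
    finally have "mat_adjoint U' * M' * U = rdiag n l' * mat_adjoint U' * U" by (rule arg_cong)
    also have "\<dots> = rdiag n l' * W" unfolding W_def
      by (rule assoc_mult_mat[OF rdiag_carrier u'(2) u(1)])
    finally show ?thesis .
  qed
  have "mat_adjoint U' * (M - M') * U = mat_adjoint U' * M * U - mat_adjoint U' * M' * U"
    using u(1) u'(2) Mc by (simp add: mult_minus_distrib_mat[of _ n n _ n] minus_mult_distrib_mat[of _ n n _ _ n])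
  then show "mat_adjoint U' * (M - M') * U = W * rdiag n l - rdiag n l' * W" by (simp only: 1 2)
qed

lemma intertwine_index:
  assumes W: "W \<in> carrier_mat n n" and ij: "i < n" "j < n"
  shows "(W * rdiag n l - rdiag n l' * W) $$ (i, j) = W $$ (i, j) * complex_of_real (l j - l' i)"
  using ij W by (simp add: mat_diag_mult_right[OF W] mat_diag_mult_left[OF W] algebra_simps)

text \<open>The description needs uniqueness. For two diagonalizations of the same matrix every
  product W_ij (l_j - k_i) vanishes, so W_ij can be nonzero only where the eigenvalues agree; there
  their images under f agree too, and W intertwines the two diagonal matrices of images.\<close>

lemma mat_fun_eq:
  assumes M: "diagonalizes n M U l"
  shows "mat_fun f M = U * rdiag n (\<lambda>i. f (l i)) * mat_adjoint U"
proof -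
  note U = diagonalizesD(1)[OF M]
  note u = unitaryD[OF U]
  note Mc = diagonalizesD(3)[OF M]
  have n: "dim_row M = n" using Mc by (rule carrier_matD)
  note M_eq = diagonalizesD(2)[OF M]
  show ?thesis unfolding mat_fun_def n
  proof (rule the_equality)
    show "\<exists>V k. unitary n V \<and> M = V * rdiag n k * mat_adjoint V \<and>
        U * rdiag n (\<lambda>i. f (l i)) * mat_adjoint U = V * rdiag n (\<lambda>i. f (k i)) * mat_adjoint V"
      using M_eq U by blast
    fix B
    assume "\<exists>V k. unitary n V \<and> M = V * rdiag n k * mat_adjoint V \<and> B = V * rdiag n (\<lambda>i. f (k i)) * mat_adjoint V"
    then obtain V k where V: "diagonalizes n M V k" and B: "B = V * rdiag n (\<lambda>i. f (k i)) * mat_adjoint V"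
      unfolding diagonalizes_def by blast
    note uV = diagonalizesD(1)[OF V]
    note v = unitaryD[OF uV]
    define W where "W = mat_adjoint V * U"
    note iw = diagonalizes_intertwine[OF M V, folded W_def]
    have W: "W \<in> carrier_mat n n" using unitaryD(1)[OF iw(1)] .
    have "mat_adjoint V * (M - M) * U = 0\<^sub>m n n"
    proof -
      have "M - M = 0\<^sub>m n n" using Mc by (intro eq_matI) auto
      then show ?thesis
        by (simp only: right_mult_zero_mat[OF v(2)] left_mult_zero_mat[OF u(1)])
    qed
    then have z: "W $$ (i, j) * complex_of_real (l j - k i) = 0" if "i < n" "j < n" for i j
      using intertwine_index[OF W that, of l k] iw(2) that by simp
    have "W * rdiag n (\<lambda>i. f (l i)) = rdiag n (\<lambda>i. f (k i)) * W"
    proof (rule eq_matI)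
      fix i j assume "i < dim_row (rdiag n (\<lambda>i. f (k i)) * W)" "j < dim_col (rdiag n (\<lambda>i. f (k i)) * W)"
      then have ij: "i < n" "j < n" using W by (auto simp: mat_diag_def)
      have "W $$ (i, j) = 0 \<or> l j = k i" using z[OF ij] by auto
      then show "(W * rdiag n (\<lambda>i. f (l i))) $$ (i, j) = (rdiag n (\<lambda>i. f (k i)) * W) $$ (i, j)"
        using ij by (auto simp: mat_diag_mult_right[OF W] mat_diag_mult_left[OF W])
    qed (use W in \<open>auto simp: mat_diag_def\<close>)
    moreover have "W * rdiag n (\<lambda>i. f (l i)) = mat_adjoint V * (U * rdiag n (\<lambda>i. f (l i)))"
      unfolding W_def by (rule assoc_mult_mat[OF v(2) u(1) rdiag_carrier])
    moreover have "rdiag n (\<lambda>i. f (k i)) * W = rdiag n (\<lambda>i. f (k i)) * mat_adjoint V * U"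
      unfolding W_def by (rule assoc_mult_mat[OF rdiag_carrier v(2) u(1), symmetric])
    ultimately have "V * (mat_adjoint V * (U * rdiag n (\<lambda>i. f (l i)))) = V * (rdiag n (\<lambda>i. f (k i)) * mat_adjoint V * U)"
      by (simp only:)
    also have "V * (mat_adjoint V * (U * rdiag n (\<lambda>i. f (l i)))) = U * rdiag n (\<lambda>i. f (l i))"
      by (rule unitary_cancel(1)[OF uV mult_carrier_mat[OF u(1) rdiag_carrier]])
    also have "V * (rdiag n (\<lambda>i. f (k i)) * mat_adjoint V * U) = V * (rdiag n (\<lambda>i. f (k i)) * mat_adjoint V) * U"
      by (rule assoc_mult_mat[OF v(1) mult_carrier_mat[OF rdiag_carrier v(2)] u(1), symmetric])
    also have "V * (rdiag n (\<lambda>i. f (k i)) * mat_adjoint V) = B"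
      unfolding B by (rule assoc_mult_mat[OF v(1) rdiag_carrier v(2), symmetric])
    finally have "U * rdiag n (\<lambda>i. f (l i)) * mat_adjoint U = B * U * mat_adjoint U" by (rule arg_cong)
    also have "B * U * mat_adjoint U = B"
      unfolding B by (rule unitary_cancel_right(1)[OF U mult_carrier_mat[OF mult_carrier_mat[OF v(1) rdiag_carrier] v(2)]])
    finally show "B = U * rdiag n (\<lambda>i. f (l i)) * mat_adjoint U" by simp
  qed
qed

lemma tr_N_mat_fun:
  assumes M: "diagonalizes n M U l" and n: "n > 0"
  shows "tr_N (mat_fun f M) = (1 / n) * (\<Sum>j<n. f (l j))"
proof -
  note U = diagonalizesD(1)[OF M]
  note u = unitaryD[OF U]
  let ?D = "rdiag n (\<lambda>i. f (l i))"
  have UD: "U * ?D \<in> carrier_mat n n" by (rule mult_carrier_mat[OF u(1) rdiag_carrier])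
  have d: "dim_row (U * ?D * mat_adjoint U) = n" using u(1) by simp
  have "(\<Sum>i<n. (U * ?D * mat_adjoint U) $$ (i, i)) =
      (\<Sum>i<n. \<Sum>j<n. complex_of_real (f (l j)) * (mat_adjoint U $$ (j, i) * U $$ (i, j)))"
  proof (intro sum.cong refl)
    fix i assume "i \<in> {..<n}"
    then have i: "i < n" by simp
    have "(U * ?D * mat_adjoint U) $$ (i, i) = (\<Sum>j<n. (U * ?D) $$ (i, j) * mat_adjoint U $$ (j, i))"
      by (rule mat_mult_index[OF UD u(2) i i])
    also have "\<dots> = (\<Sum>j<n. complex_of_real (f (l j)) * (mat_adjoint U $$ (j, i) * U $$ (i, j)))"
      using i by (intro sum.cong refl) (simp add: mat_diag_mult_right[OF u(1)] del: mat_adjoint_index)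
    finally show "(U * ?D * mat_adjoint U) $$ (i, i) =
        (\<Sum>j<n. complex_of_real (f (l j)) * (mat_adjoint U $$ (j, i) * U $$ (i, j)))" .
  qed
  also have "\<dots> = (\<Sum>j<n. \<Sum>i<n. complex_of_real (f (l j)) * (mat_adjoint U $$ (j, i) * U $$ (i, j)))"
    by (rule sum.swap)
  also have "\<dots> = (\<Sum>j<n. complex_of_real (f (l j)))"
  proof (intro sum.cong refl)
    fix j assume "j \<in> {..<n}"
    then have j: "j < n" by simp
    have "(\<Sum>i<n. mat_adjoint U $$ (j, i) * U $$ (i, j)) = (mat_adjoint U * U) $$ (j, j)"
      by (rule mat_mult_index[OF u(2,1) j j, symmetric])
    then show "(\<Sum>i<n. complex_of_real (f (l j)) * (mat_adjoint U $$ (j, i) * U $$ (i, j))) = complex_of_real (f (l j))"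
      using u(4) j by (simp only: sum_distrib_left[symmetric]) simp
  qed
  finally show ?thesis unfolding mat_fun_eq[OF M] tr_N_def d by simp
qed

text \<open>Similar matrices have the same characteristic polynomial, so its roots with multiplicity
  are the l i. The uniform law on this multiset is the image of the uniform law on the
  indices.\<close>

lemma emp_spectral_integral:
  assumes M: "diagonalizes n M U l" and n: "n > 0" and f: "f \<in> borel_measurable borel"
  shows "(\<integral>x. f x \<partial>emp_spectral M) = (1 / n) * (\<Sum>j<n. f (l j) :: real)"
proof -
  note U = diagonalizesD(1)[OF M]
  note u = unitaryD[OF U]
  note M_eq = diagonalizesD(2)[OF M]
  note Mc = diagonalizesD(3)[OF M]
  have "similar_mat_wit M (rdiag n l) U (mat_adjoint U)"
    by (rule similar_mat_witI[OF u(3,4) M_eq Mc rdiag_carrier u(1,2)])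
  then have "char_poly M = char_poly (rdiag n l)"
    by (intro char_poly_similar) (auto simp: similar_mat_def)
  also have "\<dots> = (\<Prod>a\<leftarrow>diag_mat (rdiag n l). [:- a, 1:])"
    by (rule char_poly_upper_triangular[of _ n]) (auto simp: upper_triangular_def mat_diag_def)
  also have "diag_mat (rdiag n l) = map (\<lambda>i. complex_of_real (l i)) [0..<n]"
    unfolding diag_mat_def by (auto simp: mat_diag_def)
  finally have "proots (char_poly M) = (\<Sum>p\<leftarrow>map (\<lambda>i. [:- complex_of_real (l i), 1:]) [0..<n]. proots p)"
    by (subst proots_prod_list[symmetric]) (auto simp: o_def)
  also have "\<dots> = mset (map (\<lambda>i. complex_of_real (l i)) [0..<n])"
    by (induction n) auto
  also have "\<dots> = image_mset (\<lambda>i. complex_of_real (l i)) (mset_set {..<n})"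
    by (simp add: mset_upt atLeast0LessThan)
  finally have "pmf_of_multiset (proots (char_poly M)) = map_pmf (\<lambda>i. complex_of_real (l i)) (pmf_of_set {..<n})"
    using n by (subst map_pmf_of_set) auto
  then have "(\<integral>x. f x \<partial>emp_spectral M) = (\<integral>z. f (Re z) \<partial>map_pmf (\<lambda>i. complex_of_real (l i)) (pmf_of_set {..<n}))"
    unfolding emp_spectral_def using f by (subst integral_distr) auto
  also have "\<dots> = (\<integral>i. f (l i) \<partial>pmf_of_set {..<n})" by simp
  also have "\<dots> = (\<Sum>j<n. f (l j)) / n" using n by (subst integral_pmf_of_set) auto
  finally show ?thesis by simp
qed

text \<open>The moduli \<open>\<bar>W\<^sub>i\<^sub>j\<bar>\<^sup>2\<close> form a doubly stochastic matrix, so that Cauchy-Schwarz applied to it bounds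
  the difference of the traces.\<close>

lemma trace_lipschitz:
  assumes M: "diagonalizes n M U l" and M': "diagonalizes n M' U' l'"
    and f: "\<And>x y :: real. \<bar>f x - f y\<bar> \<le> \<bar>x - y\<bar>"
  shows "\<bar>(\<Sum>j<n. f (l j)) - (\<Sum>i<n. f (l' i))\<bar> \<le> sqrt n * sqrt (frob2 n (M - M'))"
proof -
  define W where "W = mat_adjoint U' * U"
  note iw = diagonalizes_intertwine[OF M M', folded W_def]
  note w = unitaryD[OF iw(1)]
  note U = diagonalizesD(1)[OF M] and U' = diagonalizesD(1)[OF M']
  note u = unitaryD[OF U] and u' = unitaryD[OF U']
  have Mc: "M - M' \<in> carrier_mat n n"
    using diagonalizesD(3)[OF M'] by (rule minus_carrier_mat)
  define p where "p i j = (cmod (W $$ (i, j)))\<^sup>2" for i j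
  have col: "(\<Sum>i<n. p i j) = 1" if j: "j < n" for j
  proof -
    have "complex_of_real (\<Sum>i<n. p i j) = (\<Sum>i<n. mat_adjoint W $$ (j, i) * W $$ (i, j))"
      unfolding of_real_sum
    proof (intro sum.cong refl)
      fix i assume "i \<in> {..<n}"
      then have "mat_adjoint W $$ (j, i) = cnj (W $$ (i, j))" using w j by (intro mat_adjoint_index) auto
      then show "complex_of_real (p i j) = mat_adjoint W $$ (j, i) * W $$ (i, j)"
        by (simp only: p_def complex_norm_square mult.commute)
    qed
    also have "\<dots> = (mat_adjoint W * W) $$ (j, j)" by (rule mat_mult_index[OF w(2,1) j j, symmetric])
    also have "\<dots> = 1" using w(4) j by simp
    finally show ?thesis by (simp only: of_real_eq_1_iff)
  qed
  have row: "(\<Sum>j<n. p i j) = 1" if i: "i < n" for i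
  proof -
    have "complex_of_real (\<Sum>j<n. p i j) = (\<Sum>j<n. W $$ (i, j) * mat_adjoint W $$ (j, i))"
      unfolding of_real_sum
    proof (intro sum.cong refl)
      fix j assume "j \<in> {..<n}"
      then have "mat_adjoint W $$ (j, i) = cnj (W $$ (i, j))" using w i by (intro mat_adjoint_index) auto
      then show "complex_of_real (p i j) = W $$ (i, j) * mat_adjoint W $$ (j, i)"
        by (simp only: p_def complex_norm_square)
    qed
    also have "\<dots> = (W * mat_adjoint W) $$ (i, i)" by (rule mat_mult_index[OF w(1,2) i i, symmetric])
    also have "\<dots> = 1" using w(3) i by simp
    finally show ?thesis by (simp only: of_real_eq_1_iff)
  qed
  have p0: "p i j \<ge> 0" for i j by (simp add: p_def)
  \<comment> \<open>Unitary invariance of the Frobenius norm, with the entries in the two eigenbases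
    taken from \<open>intertwine_index\<close>.\<close>
  have fr: "(\<Sum>i<n. \<Sum>j<n. p i j * (l j - l' i)\<^sup>2) = frob2 n (M - M')"
  proof -
    have "frob2 n (M - M') = frob2 n (mat_adjoint U' * (M - M') * U)"
      using frob2_unitary_right[OF U, of "mat_adjoint U' * (M - M')"] frob2_unitary_left[OF unitary_adjoint[OF U'] Mc]
        mult_carrier_mat[OF u'(2) Mc] by simp
    also have "\<dots> = (\<Sum>i<n. \<Sum>j<n. p i j * (l j - l' i)\<^sup>2)"
      unfolding iw(2) frob2_def
      by (intro sum.cong refl, subst intertwine_index[OF w(1)])
        (auto simp: p_def norm_mult power_mult_distrib simp del: of_real_diff)
    finally show ?thesis by simp
  qed
  \<comment> \<open>Column sums spread one trace over all pairs (i, j), row sums the other, so that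
    they can be subtracted pair by pair with common weights.\<close>
  have 1: "(\<Sum>j<n. f (l j)) = (\<Sum>i<n. \<Sum>j<n. p i j * f (l j))"
    by (subst sum.swap) (simp add: sum_distrib_right[symmetric] col)
  have 2: "(\<Sum>i<n. f (l' i)) = (\<Sum>i<n. \<Sum>j<n. p i j * f (l' i))"
    by (simp add: sum_distrib_right[symmetric] row)
  define S where "S = {..<n} \<times> {..<n}"
  have "\<bar>(\<Sum>j<n. f (l j)) - (\<Sum>i<n. f (l' i))\<bar> = \<bar>\<Sum>(i, j)\<in>S. p i j * (f (l j) - f (l' i))\<bar>"
    unfolding 1 2 S_def sum.cartesian_product[symmetric]
    by (simp add: sum_subtractf[symmetric] right_diff_distrib)
  also have "\<dots> \<le> (\<Sum>(i, j)\<in>S. p i j * \<bar>f (l j) - f (l' i)\<bar>)"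
    by (intro order_trans[OF sum_abs] sum_mono) (auto simp: abs_mult p0)
  also have "\<dots> \<le> (\<Sum>(i, j)\<in>S. p i j * \<bar>l j - l' i\<bar>)"
    by (intro sum_mono) (auto intro!: mult_left_mono f p0)
  also have "\<dots> = (\<Sum>q\<in>S. \<bar>sqrt (p (fst q) (snd q))\<bar> * \<bar>sqrt (p (fst q) (snd q)) * (l (snd q) - l' (fst q))\<bar>)"
    by (intro sum.cong refl) (auto simp: abs_mult p0 mult.assoc[symmetric])
  also have "\<dots> \<le> L2_set (\<lambda>q. sqrt (p (fst q) (snd q))) S *
      L2_set (\<lambda>q. sqrt (p (fst q) (snd q)) * (l (snd q) - l' (fst q))) S"
    by (rule L2_set_mult_ineq)
  also have "L2_set (\<lambda>q. sqrt (p (fst q) (snd q))) S = sqrt n"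
  proof -
    have "(\<Sum>q\<in>S. (sqrt (p (fst q) (snd q)))\<^sup>2) = (\<Sum>(i, j)\<in>S. p i j)"
      by (intro sum.cong refl) (auto simp: p0)
    also have "\<dots> = n" unfolding S_def sum.cartesian_product[symmetric] by (simp add: row)
    finally show ?thesis by (simp add: L2_set_def)
  qed
  also have "L2_set (\<lambda>q. sqrt (p (fst q) (snd q)) * (l (snd q) - l' (fst q))) S = sqrt (frob2 n (M - M'))"
  proof -
    have "(\<Sum>q\<in>S. (sqrt (p (fst q) (snd q)) * (l (snd q) - l' (fst q)))\<^sup>2) = (\<Sum>(i, j)\<in>S. p i j * (l j - l' i)\<^sup>2)"
      by (intro sum.cong refl) (auto simp: p0 power_mult_distrib)
    also have "\<dots> = frob2 n (M - M')" unfolding S_def sum.cartesian_product[symmetric] by (rule fr)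
    finally show ?thesis by (simp add: L2_set_def)
  qed
  finally show ?thesis .
qed

lemma eigenvalue_le_frob2:
  assumes M: "diagonalizes n M U l" and j: "j < n"
  shows "\<bar>l j\<bar> \<le> sqrt (frob2 n M)"
proof -
  note U = diagonalizesD(1)[OF M]
  note u = unitaryD[OF U]
  note M_eq = diagonalizesD(2)[OF M]
  have "frob2 n M = frob2 n (U * rdiag n l * mat_adjoint U)" using M_eq by (rule arg_cong)
  also have "\<dots> = frob2 n (rdiag n l)"
    using frob2_unitary_right[OF unitary_adjoint[OF U], of "U * rdiag n l"]
      frob2_unitary_left[OF U rdiag_carrier] mult_carrier_mat[OF u(1) rdiag_carrier] by simp
  also have "\<dots> = (\<Sum>i<n. (l i)\<^sup>2)"
    unfolding frob2_def
  proof (intro sum.cong refl)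
    fix i assume "i \<in> {..<n}"
    then have "(\<Sum>k<n. (cmod (rdiag n l $$ (i, k)))\<^sup>2) = (\<Sum>k<n. if k = i then (l i)\<^sup>2 else 0)"
      by (intro sum.cong refl) (auto simp: mat_diag_def)
    also have "\<dots> = (l i)\<^sup>2" using \<open>i \<in> {..<n}\<close> by simp
    finally show "(\<Sum>k<n. (cmod (rdiag n l $$ (i, k)))\<^sup>2) = (l i)\<^sup>2" .
  qed
  finally have "(l j)\<^sup>2 \<le> frob2 n M" using j by (auto intro!: member_le_sum[of j "{..<n}" "\<lambda>i. (l i)\<^sup>2"])
  then have "sqrt ((l j)\<^sup>2) \<le> sqrt (frob2 n M)" by (rule real_sqrt_le_mono)
  then show ?thesis by simp
qed

lemma X_mat_carrier: "X_mat N A x \<in> carrier_mat N N" by (simp add: X_mat_def)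

lemma hermitian_X_mat:
  assumes A: "A \<in> carrier_mat N N" "hermitian A"
  shows "hermitian (X_mat N A x)"
  unfolding hermitian_def
proof (rule eq_matI)
  fix i j assume "i < dim_row (X_mat N A x)" "j < dim_col (X_mat N A x)"
  then have ij: "i < N" "j < N" by (auto simp: X_mat_def)
  have "A $$ (j, i) = cnj (A $$ (i, j))"
    using A ij mat_adjoint_index[of j A i] by (simp add: hermitian_def)
  moreover have "omega x j i = cnj (omega x i j)" by (auto simp: omega_def complex_eq_iff)
  ultimately show "mat_adjoint (X_mat N A x) $$ (i, j) = X_mat N A x $$ (i, j)"
    using ij by (subst mat_adjoint_index) (auto simp: X_mat_def)
qed (auto simp: X_mat_def)

text \<open>Each off-diagonal coordinate enters two entries, (i, j) and its conjugate (j, i). This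
  doubles the squared distance and is the origin of sqrt 2; the diagonal is overestimated by the
  same factor.\<close>

lemma frob2_X_mat_diff:
  assumes A: "\<And>i j. i < N \<Longrightarrow> j < N \<Longrightarrow> cmod (A $$ (i, j)) \<le> a" and N: "N > 0" and a: "a > 0"
  shows "sqrt (frob2 N (X_mat N A x - X_mat N A y)) \<le> sqrt 2 * a / sqrt N * L2_set (\<lambda>k. x k - y k) (idx N)"
proof -
  define d where "d = (\<lambda>k. (x k - y k)\<^sup>2)"
  have om: "(cmod (omega x i j - omega y i j))\<^sup>2 \<le> d (i, j) + d (j, i)" for i j
    by (auto simp: omega_def d_def cmod_power2 power2_commute)
  have e: "(cmod ((X_mat N A x - X_mat N A y) $$ (i, j)))\<^sup>2 \<le> a\<^sup>2 / N * (d (i, j) + d (j, i))"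
    if ij: "i < N" "j < N" for i j
  proof -
    have "(X_mat N A x - X_mat N A y) $$ (i, j) =
        complex_of_real (1 / sqrt N) * A $$ (i, j) * (omega x i j - omega y i j)"
      using ij by (simp add: X_mat_def right_diff_distrib)
    then have "(cmod ((X_mat N A x - X_mat N A y) $$ (i, j)))\<^sup>2 =
        ((cmod (A $$ (i, j)))\<^sup>2 / N) * (cmod (omega x i j - omega y i j))\<^sup>2"
      by (simp add: norm_mult power_mult_distrib norm_divide power_divide)
    also have "\<dots> \<le> (a\<^sup>2 / N) * (d (i, j) + d (j, i))"
      using A[OF ij] by (intro mult_mono om divide_right_mono power_mono) (auto simp: d_def)
    finally show ?thesis .
  qed
  have "frob2 N (X_mat N A x - X_mat N A y) \<le> (\<Sum>i<N. \<Sum>j<N. a\<^sup>2 / N * (d (i, j) + d (j, i)))"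
    unfolding frob2_def by (intro sum_mono e) auto
  also have "\<dots> = a\<^sup>2 / N * ((\<Sum>i<N. \<Sum>j<N. d (i, j)) + (\<Sum>i<N. \<Sum>j<N. d (j, i)))"
    by (simp only: sum.distrib sum_distrib_left distrib_left)
  also have "(\<Sum>i<N. \<Sum>j<N. d (j, i)) = (\<Sum>i<N. \<Sum>j<N. d (i, j))" by (rule sum.swap)
  also have "(\<Sum>i<N. \<Sum>j<N. d (i, j)) = (\<Sum>k\<in>idx N. d k)" by (simp add: sum.cartesian_product)
  also have "\<dots> = (L2_set (\<lambda>k. x k - y k) (idx N))\<^sup>2" by (simp add: L2_set_def d_def sum_nonneg)
  also have "a\<^sup>2 / N * ((L2_set (\<lambda>k. x k - y k) (idx N))\<^sup>2 + (L2_set (\<lambda>k. x k - y k) (idx N))\<^sup>2) =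
      (sqrt 2 * a / sqrt N * L2_set (\<lambda>k. x k - y k) (idx N))\<^sup>2"
    by (simp add: power_mult_distrib power_divide)
  finally have "sqrt (frob2 N (X_mat N A x - X_mat N A y)) \<le>
      sqrt ((sqrt 2 * a / sqrt N * L2_set (\<lambda>k. x k - y k) (idx N))\<^sup>2)" by (rule real_sqrt_le_mono)
  then show ?thesis using a by (simp add: abs_mult)
qed

section \<open>Concentration of the spectral measure\<close>

definition lip1 :: "(real \<Rightarrow> real) \<Rightarrow> bool"
  where "lip1 f \<longleftrightarrow> (\<forall>x y. \<bar>f x - f y\<bar> \<le> \<bar>x - y\<bar>)"

lemma Lip_b_iff: "f \<in> Lip_b b \<longleftrightarrow> lip1 f \<and> (\<forall>x. \<bar>f x\<bar> \<le> b)"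
  by (auto simp: Lip_b_def lip1_def lipschitz_on_def dist_real_def)

lemma lip1_measurable:
  assumes "lip1 f"
  shows "f \<in> borel_measurable borel"
proof -
  have "1-lipschitz_on UNIV f" using assms by (auto simp: lip1_def lipschitz_on_def dist_real_def)
  then have "continuous_on UNIV f" by (rule lipschitz_on_continuous_on)
  then show ?thesis by (rule borel_measurable_continuous_onI)
qed

lemma ell_mono:
  assumes "0 \<le> x" "x \<le> y"
  shows "ell x \<le> ell y"
proof (rule DERIV_nonneg_imp_nondecreasing[OF assms(2)])
  fix z assume z: "x \<le> z" "z \<le> y"
  have pos: "1 + z > 0" using assms(1) z(1) by linarith
  have "(ell has_real_derivative (ln (1 + z) + (1 + z) * (1 / (1 + z)) - 1)) (at z)"
    unfolding ell_def[abs_def] using pos by (auto intro!: derivative_eq_intros)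
  moreover have "ln (1 + z) + (1 + z) * (1 / (1 + z)) - 1 = ln (1 + z)" using pos by simp
  ultimately show "\<exists>d. (ell has_real_derivative d) (at z) \<and> 0 \<le> d"
    using assms(1) z(1) by (intro exI[of _ "ln (1 + z)"]) (simp add: ln_ge_zero)
qed

section \<open>Interpolation of Lipschitz functions by ramps\<close>

definition ramp :: "real \<Rightarrow> real \<Rightarrow> real \<Rightarrow> real"
  where "ramp u \<Delta> x = max 0 (min (x - u) \<Delta>)"

lemma lip1_ramp: "lip1 (ramp u \<Delta>)"
  unfolding lip1_def ramp_def by (auto simp: max_def min_def)

lemma ramp_bound: "\<Delta> \<ge> 0 \<Longrightarrow> \<bar>ramp u \<Delta> x\<bar> \<le> \<Delta>"
  by (auto simp: ramp_def)

text \<open>f enters only through its value at u and the slopes c, which are bounded by 1, while the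
  ramps are fixed. As c does not depend on m, the induction on m adds one ramp at the right end.
  Beyond both ends the interpolant is constant.\<close>

lemma interpolation:
  assumes f: "lip1 f" and \<Delta>: "\<Delta> > 0"
  obtains c where "\<And>k. \<bar>c k\<bar> \<le> 1"
    "\<And>m x. u \<le> x \<Longrightarrow> x \<le> u + real m * \<Delta> \<Longrightarrow>
      \<bar>f x - (f u + (\<Sum>k<m. c k * ramp (u + real k * \<Delta>) \<Delta> x))\<bar> \<le> 2 * \<Delta>"
    "\<And>m x. u + real m * \<Delta> \<le> x \<Longrightarrow> f u + (\<Sum>k<m. c k * ramp (u + real k * \<Delta>) \<Delta> x) = f (u + real m * \<Delta>)"
    "\<And>m x. x \<le> u \<Longrightarrow> f u + (\<Sum>k<m. c k * ramp (u + real k * \<Delta>) \<Delta> x) = f u"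
proof -
  define c where "c k = (f (u + real (Suc k) * \<Delta>) - f (u + real k * \<Delta>)) / \<Delta>" for k
  define s where "s m x = f u + (\<Sum>k<m. c k * ramp (u + real k * \<Delta>) \<Delta> x)" for m x
  have s_Suc: "s (Suc m) x = s m x + c m * ramp (u + real m * \<Delta>) \<Delta> x" for m x by (simp add: s_def)
  have c: "\<bar>c k\<bar> \<le> 1" for k
  proof -
    have "\<bar>f (u + real (Suc k) * \<Delta>) - f (u + real k * \<Delta>)\<bar> \<le> \<bar>(u + real (Suc k) * \<Delta>) - (u + real k * \<Delta>)\<bar>"
      using f unfolding lip1_def by blast
    also have "\<dots> = \<Delta>" using \<Delta> by (simp add: algebra_simps)
    finally show ?thesis using \<Delta> by (simp add: c_def)
  qed
  have right: "s m x = f (u + real m * \<Delta>)" if "u + real m * \<Delta> \<le> x" for m x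
    using that
  proof (induction m)
    case (Suc m)
    have "u + real m * \<Delta> \<le> x" "ramp (u + real m * \<Delta>) \<Delta> x = \<Delta>"
      using Suc.prems \<Delta> by (auto simp: ramp_def algebra_simps)
    then show ?case using Suc.IH \<Delta> by (simp add: s_Suc c_def)
  qed (simp add: s_def)
  have left: "s m x = f u" if "x \<le> u" for m x
  proof -
    have "ramp (u + real k * \<Delta>) \<Delta> x = 0" for k
    proof -
      have "0 \<le> real k * \<Delta>" using \<Delta> by simp
      then have "x - (u + real k * \<Delta>) \<le> 0" using that by linarith
      then show ?thesis using \<Delta> by (auto simp: ramp_def max_def min_def)
    qed
    then show ?thesis by (simp add: s_def)
  qed
  have mid: "\<bar>f x - s m x\<bar> \<le> 2 * \<Delta>" if "u \<le> x" "x \<le> u + real m * \<Delta>" for m x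
    using that
  proof (induction m)
    case 0
    then have "x = u" by simp
    then show ?case using \<Delta> by (simp add: s_def)
  next
    case (Suc m)
    show ?case
    proof (cases "x \<le> u + real m * \<Delta>")
      case True
      then have "ramp (u + real m * \<Delta>) \<Delta> x = 0" using \<Delta> by (simp add: ramp_def)
      then show ?thesis using Suc True by (simp add: s_Suc)
    next
      case False
      define v where "v = u + real m * \<Delta>"
      have v: "v < x" "x \<le> v + \<Delta>" using False Suc.prems by (auto simp: v_def algebra_simps)
      have "ramp v \<Delta> x = x - v" using v by (simp add: ramp_def)
      moreover have "s m x = f v" using right[of m x] v by (simp add: v_def)
      ultimately have "s (Suc m) x = f v + c m * (x - v)" by (simp add: s_Suc v_def)
      moreover have "\<bar>c m * (x - v)\<bar> \<le> \<Delta>"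
        using mult_mono[OF c[of m], of "\<bar>x - v\<bar>" \<Delta>] v by (simp add: abs_mult)
      moreover have "\<bar>f x - f v\<bar> \<le> \<Delta>"
      proof -
        have "\<bar>f x - f v\<bar> \<le> \<bar>x - v\<bar>" using f unfolding lip1_def by blast
        then show ?thesis using v by linarith
      qed
      ultimately show ?thesis by linarith
    qed
  qed
  show ?thesis by (rule that[of c]) (use c right left mid in \<open>auto simp: s_def\<close>)
qed

section \<open>Linear eigenvalue statistics as Lipschitz functions of the entries\<close>

locale matrix_model =
  fixes N :: nat and A :: "complex mat" and a :: real
  assumes N: "N \<ge> 1" and A: "A \<in> carrier_mat N N" "hermitian A" and a: "a > 0"
    and A_le: "\<And>i j. i < N \<Longrightarrow> j < N \<Longrightarrow> cmod (A $$ (i, j)) \<le> a"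
begin

text \<open>The order of the eigenvalues is arbitrary; they are used only through the symmetric sums
  \<open>tr\<close> and a bound common to all of them.\<close>

definition eig :: "(nat \<times> nat \<Rightarrow> real) \<Rightarrow> nat \<Rightarrow> real"
  where "eig x = (SOME l. \<exists>U. diagonalizes N (X_mat N A x) U l)"

lemma diagonalizes_eig: "\<exists>U. diagonalizes N (X_mat N A x) U (eig x)"
proof -
  have "\<exists>l. \<exists>U. diagonalizes N (X_mat N A x) U l"
    using spectral_theorem[OF X_mat_carrier hermitian_X_mat[OF A]] by blast
  from someI_ex[OF this] show ?thesis unfolding eig_def .
qed

definition tr :: "(real \<Rightarrow> real) \<Rightarrow> (nat \<times> nat \<Rightarrow> real) \<Rightarrow> real"
  where "tr f x = (1 / N) * (\<Sum>j<N. f (eig x j))"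

lemma tr_N_eq: "tr_N (mat_fun f (X_mat N A x)) = tr f x"
  using diagonalizes_eig[of x] tr_N_mat_fun N unfolding tr_def by fastforce

lemma emp_spectral_eq:
  assumes "lip1 f"
  shows "(\<integral>z. f z \<partial>emp_spectral (X_mat N A x)) = tr f x"
proof -
  obtain U where "diagonalizes N (X_mat N A x) U (eig x)" using diagonalizes_eig by blast
  from emp_spectral_integral[OF this _ lip1_measurable[OF assms]] show ?thesis using N by (simp add: tr_def)
qed

definition L where "L = sqrt 2 * a / N"

lemma L_pos: "L > 0" using a N by (simp add: L_def)

text \<open>The factor sqrt N of \<open>trace_lipschitz\<close> cancels against the normalisation of
  the matrix, and the 1 / N of the trace remains.\<close>

lemma lip_tr:
  assumes "lip1 f"
  shows "lip (idx N) L (tr f)"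
  unfolding lip_def
proof (intro allI)
  fix x y
  obtain U U' where U: "diagonalizes N (X_mat N A x) U (eig x)" "diagonalizes N (X_mat N A y) U' (eig y)"
    using diagonalizes_eig by blast
  have n: "real N > 0" using N by simp
  have "\<bar>(\<Sum>j<N. f (eig x j)) - (\<Sum>j<N. f (eig y j))\<bar> \<le> sqrt N * sqrt (frob2 N (X_mat N A x - X_mat N A y))"
    using assms by (intro trace_lipschitz[OF U]) (simp add: lip1_def)
  also have "\<dots> \<le> sqrt N * (sqrt 2 * a / sqrt N * L2_set (\<lambda>k. x k - y k) (idx N))"
    using N a A_le by (intro mult_left_mono frob2_X_mat_diff) auto
  also have "\<dots> = sqrt 2 * a * L2_set (\<lambda>k. x k - y k) (idx N)" using n by simp
  finally have "(1 / N) * \<bar>(\<Sum>j<N. f (eig x j)) - (\<Sum>j<N. f (eig y j))\<bar> \<le>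
      (1 / N) * (sqrt 2 * a * L2_set (\<lambda>k. x k - y k) (idx N))"
    by (intro mult_left_mono) auto
  moreover have "\<bar>tr f x - tr f y\<bar> = (1 / N) * \<bar>(\<Sum>j<N. f (eig x j)) - (\<Sum>j<N. f (eig y j))\<bar>"
    using n by (simp add: tr_def diff_divide_distrib[symmetric] del: of_nat_eq_0_iff)
  ultimately show "\<bar>tr f x - tr f y\<bar> \<le> L * L2_set (\<lambda>k. x k - y k) (idx N)" by (simp add: L_def)
qed

lemma tr_mono: "(\<And>z. f z \<le> g z) \<Longrightarrow> tr f x \<le> tr g x"
  unfolding tr_def by (intro mult_left_mono sum_mono) auto

lemma tr_const: "tr (\<lambda>_. c) x = c"
  using N by (simp add: tr_def)

lemma tr_add: "tr (\<lambda>z. f z + g z) x = tr f x + tr g x"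
  by (simp add: tr_def sum.distrib add_divide_distrib)

lemma tr_cmult: "tr (\<lambda>z. c * f z) x = c * tr f x"
  by (simp add: tr_def sum_distrib_left mult.left_commute)

lemma tr_sum: "tr (\<lambda>z. \<Sum>k\<in>K. f k z) x = (\<Sum>k\<in>K. tr (f k) x)"
  unfolding tr_def by (subst sum.swap) (simp add: sum_distrib_left)

lemma tr_bound: "(\<And>z. \<bar>f z\<bar> \<le> b) \<Longrightarrow> \<bar>tr f x\<bar> \<le> b"
  using tr_mono[of f "\<lambda>_. b" x] tr_mono[of "\<lambda>_. - b" f x] by (simp add: tr_const abs_le_iff minus_le_iff)

lemma tr_diff_le:
  assumes "\<And>z. \<bar>f z - g z\<bar> \<le> h z"
  shows "\<bar>tr f x - tr g x\<bar> \<le> tr h x"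
proof -
  have "tr f x \<le> tr (\<lambda>z. g z + h z) x" "tr g x \<le> tr (\<lambda>z. f z + h z) x"
    using assms by (auto intro!: tr_mono simp: abs_le_iff algebra_simps)
  then show ?thesis by (simp add: tr_add abs_le_iff)
qed

lemma eig_le:
  assumes "j < N"
  shows "\<bar>eig x j\<bar> \<le> sqrt 2 * a / sqrt N * L2_set x (idx N)"
proof -
  obtain U where "diagonalizes N (X_mat N A x) U (eig x)" using diagonalizes_eig by blast
  then have "\<bar>eig x j\<bar> \<le> sqrt (frob2 N (X_mat N A x))" using assms by (rule eigenvalue_le_frob2)
  \<comment> \<open>The matrix depends linearly on x and vanishes at 0, so the estimate for
    differences applies.\<close>
  also have "frob2 N (X_mat N A x) = frob2 N (X_mat N A x - X_mat N A (\<lambda>_. 0))"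
  proof -
    have "omega (\<lambda>_. 0) i j = 0" for i j by (auto simp: omega_def complex_eq_iff)
    then show ?thesis unfolding frob2_def by (intro sum.cong refl) (auto simp: X_mat_def)
  qed
  also have "sqrt \<dots> \<le> sqrt 2 * a / sqrt N * L2_set (\<lambda>k. x k - 0) (idx N)"
    using N a A_le by (intro frob2_X_mat_diff) auto
  finally show ?thesis by simp
qed

end

section \<open>Concentration for infinitely divisible entries\<close>

locale spectral_concentration = matrix_model N A a + bounded_id "idx N" \<beta> \<nu> P
  for N A a \<beta> \<nu> P +
  fixes b :: real
  assumes b: "b > 0"
begin

lemma chernoff_L:
  assumes F: "lip (idx N) L F" and B: "\<And>y. \<bar>F y\<bar> \<le> B" and x: "x \<ge> 0"
  shows "measure P {y\<in>space P. F y - (\<integral>y. F y \<partial>P) \<ge> x} \<le> exp (- (V / R\<^sup>2) * ell (R * x / (L * V)))"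
    "measure P {y\<in>space P. \<bar>F y - (\<integral>y. F y \<partial>P)\<bar> \<ge> x} \<le> 2 * exp (- (V / R\<^sup>2) * ell (R * x / (L * V)))"
proof -
  interpret P: prob_space P by (rule P)
  note [measurable_cong] = P(2)
  have [measurable]: "F \<in> borel_measurable (euclid (idx N))" by (rule lip_measurable[OF fin F])
  note c = chernoff_lip[OF fin P laplace_bound_P V_pos R_pos L_pos]
  show 1: "measure P {y\<in>space P. F y - (\<integral>y. F y \<partial>P) \<ge> x} \<le> exp (- (V / R\<^sup>2) * ell (R * x / (L * V)))"
    by (rule c[OF F B x])
  have "\<bar>- F y\<bar> \<le> B" for y using B[of y] by simp
  from c[OF lip_uminus[OF F] this x]
  have 2: "measure P {y\<in>space P. - F y - (\<integral>y. - F y \<partial>P) \<ge> x} \<le> exp (- (V / R\<^sup>2) * ell (R * x / (L * V)))" .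
  have "measure P {y\<in>space P. \<bar>F y - (\<integral>y. F y \<partial>P)\<bar> \<ge> x} \<le>
      measure P ({y\<in>space P. F y - (\<integral>y. F y \<partial>P) \<ge> x} \<union> {y\<in>space P. - F y - (\<integral>y. - F y \<partial>P) \<ge> x})"
    by (intro P.finite_measure_mono) auto
  also have "\<dots> \<le> measure P {y\<in>space P. F y - (\<integral>y. F y \<partial>P) \<ge> x} + measure P {y\<in>space P. - F y - (\<integral>y. - F y \<partial>P) \<ge> x}"
    by (intro measure_Un_le) auto
  finally show "measure P {y\<in>space P. \<bar>F y - (\<integral>y. F y \<partial>P)\<bar> \<ge> x} \<le> 2 * exp (- (V / R\<^sup>2) * ell (R * x / (L * V)))"
    using 1 2 by linarith
qed

lemma zero_Lip_b: "(\<lambda>_. 0) \<in> Lip_b b" using b by (simp add: Lip_b_iff lip1_def)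

text \<open>A pointwise supremum of functions with a common Lipschitz constant L has this constant
  again. Here the supremum is compared with its own mean, so a single application of the Chernoff
  bound suffices and no prefactor arises.\<close>

lemma d_W_concentration:
  assumes \<mu>: "prob_space \<mu>" "sets \<mu> = sets borel" and \<delta>: "\<delta> > 0"
  shows "measure P {x\<in>space P.
      d_W b (emp_spectral (X_mat N A x)) \<mu> - (\<integral>y. d_W b (emp_spectral (X_mat N A y)) \<mu> \<partial>P) \<ge> \<delta>}
    \<le> exp (- (V / R\<^sup>2) * ell (R * \<delta> / (L * V)))"
proof -
  interpret \<mu>: prob_space \<mu> by (rule \<mu>)
  define F where "F x = d_W b (emp_spectral (X_mat N A x)) \<mu>" for x
  define D where "D f x = \<bar>tr f x - (\<integral>z. f z \<partial>\<mu>)\<bar>" for f x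
  have F: "F x = (SUP f\<in>Lip_b b. D f x)" for x
    unfolding F_def d_W_def D_def by (intro SUP_cong refl) (simp add: emp_spectral_eq Lip_b_iff)
  have D2: "D f x \<le> 2 * b" if f: "f \<in> Lip_b b" for f x
  proof -
    have fb: "\<bar>f z\<bar> \<le> b" for z using f by (simp add: Lip_b_iff)
    have "f \<in> borel_measurable borel" using f by (intro lip1_measurable) (simp add: Lip_b_iff)
    then have "f \<in> borel_measurable \<mu>" by (simp only: measurable_cong_sets[OF \<mu>(2) refl])
    then have "integrable \<mu> f" using fb by (intro \<mu>.integrable_const_bound[where B=b]) auto
    then have "\<bar>\<integral>z. f z \<partial>\<mu>\<bar> \<le> (\<integral>z. b \<partial>\<mu>)"
      using fb by (intro order_trans[OF integral_abs_bound] integral_mono) auto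
    then have "\<bar>\<integral>z. f z \<partial>\<mu>\<bar> \<le> b" by (simp add: \<mu>.prob_space)
    then show ?thesis using tr_bound[of f b x, OF fb] unfolding D_def by linarith
  qed
  have bdd: "bdd_above ((\<lambda>f. D f x) ` Lip_b b)" for x using D2 by (intro bdd_aboveI2)
  have ne: "Lip_b b \<noteq> {}" using zero_Lip_b by auto
  have FB: "\<bar>F x\<bar> \<le> 2 * b" for x
  proof -
    have "F x \<le> 2 * b" unfolding F by (intro cSUP_least ne D2)
    moreover have "0 \<le> D (\<lambda>_. 0) x" by (simp add: D_def)
    then have "0 \<le> F x" unfolding F using cSUP_upper[OF zero_Lip_b bdd[of x]] by linarith
    ultimately show ?thesis by simp
  qed
  have le: "F x \<le> F y + L * L2_set (\<lambda>k. x k - y k) (idx N)" for x y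
    unfolding F[of x]
  proof (rule cSUP_least[OF ne])
    fix f assume f: "f \<in> Lip_b b"
    then have "lip1 f" by (simp add: Lip_b_iff)
    from lipD[OF lip_tr[OF this], of x y] have "D f x \<le> D f y + L * L2_set (\<lambda>k. x k - y k) (idx N)"
      unfolding D_def by linarith
    moreover have "D f y \<le> F y" unfolding F by (rule cSUP_upper[OF f bdd])
    ultimately show "D f x \<le> F y + L * L2_set (\<lambda>k. x k - y k) (idx N)" by linarith
  qed
  have "lip (idx N) L F" unfolding lip_def
  proof (intro allI)
    fix x y show "\<bar>F x - F y\<bar> \<le> L * L2_set (\<lambda>k. x k - y k) (idx N)"
      using le[of x y] le[of y x] unfolding L2_set_minus_commute[of y x] by linarith
  qed
  from chernoff_L(1)[OF this FB, of \<delta>] \<delta> show ?thesis by (simp add: F_def)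
qed

text \<open>Lipschitz substitute for \<open>b\<close> times the indicator of \<open>{z. M + b < \<bar>z\<bar>}\<close>.\<close>

definition outer :: "real \<Rightarrow> real \<Rightarrow> real"
  where "outer M z = min b (max 0 (\<bar>z\<bar> - M))"

lemma lip1_outer: "lip1 (outer M)"
  unfolding lip1_def outer_def by (auto simp: max_def min_def)

lemma outer_bound: "0 \<le> outer M z" "\<bar>outer M z\<bar> \<le> b"
  using b by (auto simp: outer_def)

context
  fixes \<delta> \<gamma> t0 :: real
  assumes \<delta>: "\<delta> > 0" and \<gamma>: "\<gamma> > 0" and tail: "\<nu>bar (idx N) \<nu> (p_gamma (idx N) \<nu> \<gamma>) \<le> 1/4"
    and t0: "t0 \<ge> 0" and t0_eq: "V / R\<^sup>2 * (t0 * R * exp (t0 * R) - exp (t0 * R) + 1) = ln (12 * b / \<delta>)"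
begin

definition s where "s = V / R * (exp (t0 * R) - 1)"
definition \<kappa> where "\<kappa> = sqrt 2 * a / sqrt N"
text \<open>On the event that the norm is at most G2 + 2 s, all eigenvalues lie in [- M, M].\<close>

definition M where "M = \<kappa> * (G2 (idx N) \<beta> \<nu> \<gamma> + 2 * s)"
text \<open>C(\<delta>, b) without the universal constant.\<close>

definition C0 where "C0 = \<kappa> * (G2 (idx N) \<beta> \<nu> \<gamma> + s) + b"

lemma s_nonneg: "s \<ge> 0" using V_pos R_pos t0 by (simp add: s_def)
lemma \<kappa>_nonneg: "\<kappa> \<ge> 0" using a by (simp add: \<kappa>_def)

lemma C0: "C0 \<ge> b" "C0 > 0" "M + b \<le> 2 * C0" "M \<ge> 0"
proof -
  have 1: "\<kappa> * G2 (idx N) \<beta> \<nu> \<gamma> \<ge> 0" "\<kappa> * s \<ge> 0"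
    using \<kappa>_nonneg s_nonneg G2_nonneg[OF \<gamma> tail] by auto
  then show "C0 \<ge> b" "C0 > 0" "M + b \<le> 2 * C0" "M \<ge> 0" using b
    unfolding C0_def M_def distrib_left by auto
qed

text \<open>Since R s / V = exp (t0 R) - 1, the equation for t0 says that V / R^2 times
  \<open>ell\<close> at this point is ln (12 b / \<delta>).\<close>

lemma exp_s: "exp (- (V / R\<^sup>2) * ell (R * s / V)) = \<delta> / (12 * b)"
proof -
  have "R * s / V = exp (t0 * R) - 1" using V_pos R_pos by (simp add: s_def)
  then have "ell (R * s / V) = t0 * R * exp (t0 * R) - exp (t0 * R) + 1"
    by (simp add: ell_def algebra_simps)
  then have "- (V / R\<^sup>2) * ell (R * s / V) = - ln (12 * b / \<delta>)" using t0_eq by simp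
  then show ?thesis using \<delta> b by (simp add: exp_minus)
qed

text \<open>The function \<open>outer M\<close> sees no eigenvalue unless the norm exceeds G2 + 2 s,
  and it is bounded by b. The assumption on \<delta> makes the probability \<delta> / (12 b) less
  than 1/2, as \<open>norm_tail\<close> demands.\<close>

lemma outer_mean:
  assumes \<delta>b: "\<delta> \<le> 2 * b"
  shows "(\<integral>x. tr (outer M) x \<partial>P) \<le> \<delta> / 12"
proof -
  interpret P: prob_space P by (rule P)
  note [measurable_cong] = P(2)
  let ?S = "{y\<in>space P. L2_set y (idx N) \<ge> G2 (idx N) \<beta> \<nu> \<gamma> + 2 * s}"
  have [measurable]: "tr (outer M) \<in> borel_measurable (euclid (idx N))"
    by (rule lip_measurable[OF fin lip_tr[OF lip1_outer]])
  have tb: "\<bar>tr (outer M) x\<bar> \<le> b" for x by (intro tr_bound outer_bound)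
  have le: "tr (outer M) x \<le> b * indicator ?S x" if x: "x \<in> space P" for x
  proof (cases "x \<in> ?S")
    case True
    then show ?thesis using tb[of x] by simp
  next
    case False
    then have "L2_set x (idx N) \<le> G2 (idx N) \<beta> \<nu> \<gamma> + 2 * s" using x by simp
    then have "\<kappa> * L2_set x (idx N) \<le> M" unfolding M_def using \<kappa>_nonneg by (intro mult_left_mono)
    then have "\<bar>eig x j\<bar> \<le> M" if "j < N" for j using eig_le[OF that, of x] by (simp add: \<kappa>_def)
    then have "tr (outer M) x = 0" using b by (simp add: tr_def outer_def)
    then show ?thesis using False by simp
  qed
  have "(\<integral>x. tr (outer M) x \<partial>P) \<le> (\<integral>x. b * indicator ?S x \<partial>P)"
    using tb by (intro integral_mono le P.integrable_const_bound[where B=b]) (auto simp: indicator_def b less_imp_le)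
  also have "\<dots> = b * measure P ?S" by simp
  also have "\<dots> \<le> b * (\<delta> / (12 * b))"
  proof (rule mult_left_mono)
    have "\<delta> / (12 * b) < 1/2" using \<delta>b b by (simp add: divide_less_eq)
    then show "measure P ?S \<le> \<delta> / (12 * b)"
      using norm_tail[OF \<gamma> tail s_nonneg] unfolding exp_s by simp
  qed (use b in simp)
  also have "\<dots> = \<delta> / 12" using b by simp
  finally show ?thesis .
qed

text \<open>The number of cells of width \<open>\<Delta>\<close> that cover the interval from - (M +
  b) to M + b. The constant 48 makes \<open>\<Delta>\<close> at most \<delta> / 24.\<close>

definition K where "K = nat \<lceil>48 * (M + b) / \<delta>\<rceil>"
definition \<Delta> where "\<Delta> = 2 * (M + b) / K"
definition node where "node k = ramp (- (M + b) + real k * \<Delta>) \<Delta>"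
definition dev where "dev h x = \<bar>tr h x - (\<integral>y. tr h y \<partial>P)\<bar>"

lemma K: "K > 0" "\<Delta> > 0" "\<Delta> \<le> \<delta> / 24" "real K * \<Delta> = 2 * (M + b)" "real K \<le> 48 * (M + b) / \<delta> + 1"
proof -
  have q: "48 * (M + b) / \<delta> > 0" using C0(4) b \<delta> by (simp add: add_nonneg_pos)
  then show K: "K > 0" by (simp add: K_def)
  show "\<Delta> > 0" using K C0(4) b by (simp add: \<Delta>_def add_nonneg_pos)
  show "real K * \<Delta> = 2 * (M + b)" using K by (simp add: \<Delta>_def)
  show "real K \<le> 48 * (M + b) / \<delta> + 1" using q unfolding K_def by linarith
  have "48 * (M + b) / \<delta> \<le> real K" unfolding K_def by linarith
  then have "48 * (M + b) \<le> real K * \<delta>" using \<delta> by (simp add: divide_le_eq)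
  then have "2 * (M + b) \<le> \<delta> / 24 * real K" by (simp add: mult.commute)
  then show "\<Delta> \<le> \<delta> / 24" using K by (simp add: \<Delta>_def divide_le_eq)
qed

lemma integrable_tr:
  assumes "lip1 h" "\<And>z. \<bar>h z\<bar> \<le> c"
  shows "integrable P (tr h)"
proof -
  interpret P: prob_space P by (rule P)
  note [measurable_cong] = P(2)
  have [measurable]: "tr h \<in> borel_measurable (euclid (idx N))"
    by (rule lip_measurable[OF fin lip_tr[OF assms(1)]])
  show ?thesis using tr_bound[OF assms(2)] by (intro P.integrable_const_bound[where B=c]) auto
qed

lemma node: "lip1 (node k)" "\<bar>node k z\<bar> \<le> \<Delta>"
  unfolding node_def using K(2) by (auto intro: lip1_ramp ramp_bound)

text \<open>The error of replacing f by its interpolant is paid both at x and in the mean: four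
  times \<open>\<Delta>\<close>, at most \<delta> / 6, and four times the mean of
  \<open>tr (outer M)\<close>, at most \<delta> / 3. Together they make up \<delta> / 2.\<close>

lemma dev_le_sum:
  assumes \<delta>b: "\<delta> \<le> 2 * b" and f: "f \<in> Lip_b b"
  shows "dev f x \<le> (\<Sum>k<K. dev (node k) x) + 2 * dev (outer M) x + \<delta> / 2"
proof -
  interpret P: prob_space P by (rule P)
  have f1: "lip1 f" and fb: "\<And>z. \<bar>f z\<bar> \<le> b" using f by (auto simp: Lip_b_iff)
  let ?u = "- (M + b)"
  obtain c where c: "\<And>k. \<bar>c k\<bar> \<le> 1"
    and mid: "\<And>m z. ?u \<le> z \<Longrightarrow> z \<le> ?u + real m * \<Delta> \<Longrightarrow> \<bar>f z - (f ?u + (\<Sum>k<m. c k * node k z))\<bar> \<le> 2 * \<Delta>"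
    and right: "\<And>m z. ?u + real m * \<Delta> \<le> z \<Longrightarrow> f ?u + (\<Sum>k<m. c k * node k z) = f (?u + real m * \<Delta>)"
    and left: "\<And>m z. z \<le> ?u \<Longrightarrow> f ?u + (\<Sum>k<m. c k * node k z) = f ?u"
    using interpolation[OF f1 K(2), of ?u] unfolding node_def by blast
  define g where "g z = f ?u + (\<Sum>k<K. c k * node k z)" for z
  have e: "?u + real K * \<Delta> = M + b" using K(4) by simp
  \<comment> \<open>Beyond the interval f and its interpolant both take values in [- b, b], and
    \<open>outer M\<close> has reached b exactly where the interval ends.\<close>
  have close: "\<bar>f z - g z\<bar> \<le> 2 * \<Delta> + 2 * outer M z" for z
  proof -
    consider "?u \<le> z" "z \<le> M + b" | "z < ?u" | "z > M + b" by linarith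
    then show ?thesis
    proof cases
      case 1
      then have "z \<le> ?u + real K * \<Delta>" using e by linarith
      from mid[OF 1(1) this] show ?thesis using outer_bound(1)[of M z] unfolding g_def by linarith
    next
      case 2
      then have "g z = f ?u" using left[of z K] by (simp add: g_def)
      moreover have "outer M z = b" using 2 b C0(4) by (auto simp: outer_def)
      ultimately show ?thesis using fb[of z] fb[of ?u] K(2) by linarith
    next
      case 3
      then have "?u + real K * \<Delta> \<le> z" using e by linarith
      from right[OF this] have "g z = f (M + b)" unfolding g_def e .
      moreover have "outer M z = b" using 3 b C0(4) by (auto simp: outer_def)
      ultimately show ?thesis using fb[of z] fb[of "M + b"] K(2) by linarith
    qed
  qed
  have tr_close: "\<bar>tr f y - tr g y\<bar> \<le> 2 * \<Delta> + 2 * tr (outer M) y" for y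
    using tr_diff_le[of f g "\<lambda>z. 2 * \<Delta> + 2 * outer M z" y, OF close]
    unfolding tr_add tr_cmult tr_const by simp
  have tr_g: "tr g y = f ?u + (\<Sum>k<K. c k * tr (node k) y)" for y
    unfolding g_def tr_add tr_const tr_sum tr_cmult ..
  have in_node: "integrable P (tr (node k))" for k by (rule integrable_tr[OF node])
  have in_outer: "integrable P (tr (outer M))" by (rule integrable_tr[OF lip1_outer outer_bound(2)])
  have in_f: "integrable P (tr f)" by (rule integrable_tr[OF f1 fb])
  have in_g: "integrable P (tr g)" unfolding tr_g[abs_def] using in_node by auto
  have E_g: "(\<integral>y. tr g y \<partial>P) = f ?u + (\<Sum>k<K. c k * (\<integral>y. tr (node k) y \<partial>P))"
    unfolding tr_g using in_node by (simp add: Bochner_Integration.integral_sum P.prob_space)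
  have dev_g: "dev g x \<le> (\<Sum>k<K. dev (node k) x)"
  proof -
    have "tr g x - (\<integral>y. tr g y \<partial>P) = (\<Sum>k<K. c k * (tr (node k) x - (\<integral>y. tr (node k) y \<partial>P)))"
      unfolding tr_g[of x] E_g by (simp add: right_diff_distrib sum_subtractf)
    then have "dev g x \<le> (\<Sum>k<K. \<bar>c k * (tr (node k) x - (\<integral>y. tr (node k) y \<partial>P))\<bar>)"
      unfolding dev_def by (simp only: sum_abs)
    also have "\<dots> \<le> (\<Sum>k<K. 1 * dev (node k) x)"
      unfolding abs_mult dev_def by (intro sum_mono mult_right_mono c) auto
    finally show ?thesis by simp
  qed
  have Ediff: "\<bar>(\<integral>y. tr f y \<partial>P) - (\<integral>y. tr g y \<partial>P)\<bar> \<le> 2 * \<Delta> + 2 * (\<integral>y. tr (outer M) y \<partial>P)"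
  proof -
    have eq: "(\<integral>y. tr f y \<partial>P) - (\<integral>y. tr g y \<partial>P) = (\<integral>y. tr f y - tr g y \<partial>P)"
      using in_f in_g by simp
    have "\<bar>\<integral>y. tr f y - tr g y \<partial>P\<bar> \<le> (\<integral>y. \<bar>tr f y - tr g y\<bar> \<partial>P)" by (rule integral_abs_bound)
    also have "\<dots> \<le> (\<integral>y. 2 * \<Delta> + 2 * tr (outer M) y \<partial>P)"
      using in_f in_g in_outer by (intro integral_mono tr_close) auto
    also have "\<dots> = 2 * \<Delta> + 2 * (\<integral>y. tr (outer M) y \<partial>P)"
      using in_outer by (simp add: P.prob_space)
    finally show ?thesis unfolding eq .
  qed
  have "tr (outer M) x \<le> dev (outer M) x + (\<integral>y. tr (outer M) y \<partial>P)" unfolding dev_def by linarith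
  moreover have "dev f x \<le> \<bar>tr f x - tr g x\<bar> + dev g x + \<bar>(\<integral>y. tr f y \<partial>P) - (\<integral>y. tr g y \<partial>P)\<bar>"
    unfolding dev_def by linarith
  ultimately show ?thesis using dev_g Ediff tr_close[of x] outer_mean[OF \<delta>b] K(3) by linarith
qed

text \<open>
  Half of \<open>\<delta>\<close> is spent on the interpolation error and on the mean of \<open>tr (outer M)\<close>; the other half is shared
  among \<open>K + 2 \<le> 102 C0 / \<delta>\<close> deviations, each two-sided. Any constant from 204 on would do.
\<close>
theorem trace_concentration:
  "measure P {x\<in>space P.
      (SUP f\<in>Lip_b b. \<bar>tr_N (mat_fun f (X_mat N A x)) - (\<integral>y. tr_N (mat_fun f (X_mat N A y)) \<partial>P)\<bar>) \<ge> \<delta>}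
    \<le> 224 * C0 / \<delta> * exp (- (V / R\<^sup>2) * ell (N * R * \<delta>\<^sup>2 / (sqrt 2 * a * (224 * C0) * V)))"
  (is "measure P ?S \<le> ?rhs")
proof -
  interpret P: prob_space P by (rule P)
  note [measurable_cong] = P(2)
  have S: "?S = {x\<in>space P. (SUP f\<in>Lip_b b. dev f x) \<ge> \<delta>}" by (simp add: dev_def tr_N_eq)
  have ne: "Lip_b b \<noteq> {}" using zero_Lip_b by auto
  have rhs0: "?rhs \<ge> 0" using C0(2) \<delta> by simp
  show ?thesis
  proof (cases "\<delta> \<le> 2 * b")
    \<comment> \<open>A deviation never exceeds 2 b, so the event is empty.\<close>
    case False
    have "(SUP f\<in>Lip_b b. dev f x) \<le> 2 * b" for x
    proof (rule cSUP_least[OF ne])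
      fix f assume f: "f \<in> Lip_b b"
      then have fb: "\<bar>f z\<bar> \<le> b" for z by (simp add: Lip_b_iff)
      have "\<bar>\<integral>y. tr f y \<partial>P\<bar> \<le> (\<integral>y. b \<partial>P)"
        using f integrable_tr[of f b] tr_bound[of f b]
        by (intro order_trans[OF integral_abs_bound] integral_mono) (auto simp: Lip_b_iff)
      then have "\<bar>\<integral>y. tr f y \<partial>P\<bar> \<le> b" by (simp add: P.prob_space)
      then show "dev f x \<le> 2 * b" using tr_bound[of f b x, OF fb] unfolding dev_def by linarith
    qed
    then have "?S = {}" unfolding S using False by (auto simp: not_le intro: le_less_trans)
    then have "measure P ?S = 0" by (simp only: measure_empty)
    then show ?thesis using rhs0 by linarith
  next
    case True
    \<comment> \<open>The remaining \<delta> / 2 is divided among K ramps and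
      \<open>outer M\<close>, which counts twice.\<close>
    define r where "r = \<delta> / (2 * (real K + 2))"
    define T where "T h = {x\<in>space P. dev h x \<ge> r}" for h
    have Tm: "T h \<in> sets P" if "lip1 h" for h
    proof -
      have [measurable]: "tr h \<in> borel_measurable (euclid (idx N))"
        by (rule lip_measurable[OF fin lip_tr[OF that]])
      show ?thesis unfolding T_def dev_def by measurable
    qed
    have r: "r > 0" using \<delta> by (simp add: r_def)
    have sub: "?S \<subseteq> (\<Union>k<K. T (node k)) \<union> T (outer M)"
    proof
      fix x assume x: "x \<in> ?S"
      then have xs: "x \<in> space P" and "(SUP f\<in>Lip_b b. dev f x) \<ge> \<delta>" unfolding S by auto
      moreover have "(SUP f\<in>Lip_b b. dev f x) \<le> (\<Sum>k<K. dev (node k) x) + 2 * dev (outer M) x + \<delta> / 2"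
        by (rule cSUP_least[OF ne dev_le_sum[OF True]])
      ultimately have big: "(\<Sum>k<K. dev (node k) x) + 2 * dev (outer M) x \<ge> \<delta> / 2" by linarith
      show "x \<in> (\<Union>k<K. T (node k)) \<union> T (outer M)"
      proof (rule ccontr)
        assume "x \<notin> (\<Union>k<K. T (node k)) \<union> T (outer M)"
        then have n: "\<And>k. k < K \<Longrightarrow> dev (node k) x < r" and o: "dev (outer M) x < r"
          using xs by (auto simp: T_def not_le)
        have "(\<Sum>k<K. dev (node k) x) \<le> (\<Sum>k<K. r)" using n by (intro sum_mono) (auto intro: less_imp_le)
        then have "\<delta> / 2 < real K * r + 2 * r" using big o by simp
        also have "\<dots> = (real K + 2) * r" by (simp add: distrib_right)
        also have "\<dots> = \<delta> / 2"
        proof -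
          have "q * (\<delta> / (2 * q)) = \<delta> / 2" if "q \<noteq> 0" for q :: real using that by simp
          from this[of "real K + 2"] show ?thesis by (simp add: r_def)
        qed
        finally show False by simp
      qed
    qed
    define E where "E = exp (- (V / R\<^sup>2) * ell (R * r / (L * V)))"
    have TE: "measure P (T h) \<le> 2 * E" if h: "lip1 h" "\<And>z. \<bar>h z\<bar> \<le> c" for h c
      unfolding T_def dev_def E_def
      by (rule chernoff_L(2)[OF lip_tr[OF h(1)] tr_bound[OF h(2)]]) (use r in simp_all)
    \<comment> \<open>The supremum runs over an uncountable class; should the event fail to be
      measurable, its measure is 0 by convention and the bound still holds.\<close>
    have "measure P ?S \<le> measure P ((\<Union>k<K. T (node k)) \<union> T (outer M))"
    proof (cases "?S \<in> sets P")
      case True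
      then show ?thesis using sub Tm node lip1_outer by (intro P.finite_measure_mono) auto
    qed (simp add: measure_notin_sets)
    also have "\<dots> \<le> measure P (\<Union>k<K. T (node k)) + measure P (T (outer M))"
      using Tm node lip1_outer by (intro measure_Un_le) auto
    also have "measure P (\<Union>k<K. T (node k)) \<le> (\<Sum>k<K. measure P (T (node k)))"
      using Tm node by (intro measure_UNION_le) auto
    also have "\<dots> \<le> (\<Sum>k<K. 2 * E)" by (intro sum_mono TE[OF node])
    also have "measure P (T (outer M)) \<le> 2 * E" by (rule TE[OF lip1_outer outer_bound(2)])
    finally have m: "measure P ?S \<le> 2 * (real K + 1) * E" by (simp add: algebra_simps)
    \<comment> \<open>This absorbs additive constants into multiples of C0 / \<delta>: K + 2 \<le>
      96 C0 / \<delta> + 3, and 3 \<le> 6 C0 / \<delta>.\<close>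
    have q: "1 \<le> 2 * C0 / \<delta>" using True C0(1) \<delta> by (simp add: le_divide_eq)
    have "48 * (M + b) / \<delta> \<le> 48 * (2 * C0) / \<delta>"
      using C0(3) \<delta> by (intro divide_right_mono mult_left_mono) auto
    then have K2: "real K + 2 \<le> 102 * C0 / \<delta>" using K(5) q by simp
    have "2 * (real K + 1) \<le> 224 * C0 / \<delta>"
      using K2 q by simp
    then have 1: "2 * (real K + 1) * E \<le> 224 * C0 / \<delta> * E"
      by (intro mult_right_mono) (simp_all add: E_def)
    \<comment> \<open>The deviation granted to each function is of order \<delta> divided by K,
      hence the square of \<delta> and the constant C(\<delta>, b) in the argument of
      \<open>ell\<close>.\<close>
    have "\<delta>\<^sup>2 / (224 * C0) \<le> r"
    proof -
      have "(real K + 2) * \<delta> \<le> 102 * C0" using K2 \<delta> by (simp add: le_divide_eq)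
      then have "2 * ((real K + 2) * \<delta>) \<le> 224 * C0" using C0(2) by linarith
      then have "\<delta> * (2 * ((real K + 2) * \<delta>)) \<le> \<delta> * (224 * C0)" using \<delta> by (intro mult_left_mono) auto
      then show ?thesis using C0(2) by (simp add: r_def field_simps power2_eq_square)
    qed
    then have "R / (L * V) * (\<delta>\<^sup>2 / (224 * C0)) \<le> R / (L * V) * r"
      using R_pos V_pos L_pos by (intro mult_left_mono) auto
    moreover have "R / (L * V) * (\<delta>\<^sup>2 / (224 * C0)) = N * R * \<delta>\<^sup>2 / (sqrt 2 * a * (224 * C0) * V)"
      using N a by (simp add: L_def mult_ac)
    ultimately have "N * R * \<delta>\<^sup>2 / (sqrt 2 * a * (224 * C0) * V) \<le> R * r / (L * V)" by simp
    moreover have "0 \<le> N * R * \<delta>\<^sup>2 / (sqrt 2 * a * (224 * C0) * V)"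
      using R_pos V_pos C0(2) a by (intro divide_nonneg_nonneg mult_nonneg_nonneg) auto
    ultimately have "ell (N * R * \<delta>\<^sup>2 / (sqrt 2 * a * (224 * C0) * V)) \<le> ell (R * r / (L * V))"
      by (intro ell_mono)
    then have "V / R\<^sup>2 * ell (N * R * \<delta>\<^sup>2 / (sqrt 2 * a * (224 * C0) * V)) \<le> V / R\<^sup>2 * ell (R * r / (L * V))"
      using V_pos by (intro mult_left_mono) auto
    then have "E \<le> exp (- (V / R\<^sup>2) * ell (N * R * \<delta>\<^sup>2 / (sqrt 2 * a * (224 * C0) * V)))"
      unfolding E_def by simp
    then have "224 * C0 / \<delta> * E \<le> ?rhs" using C0(2) \<delta> by (intro mult_left_mono) auto
    then show ?thesis using m 1 by linarith
  qed
qed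

end

end

lemma exp_ell_eq:
  assumes V: "V > 0" and R: "R > 0" and a: "a > 0" and n: "n > (0::real)"
  shows "exp (- (V / R\<^sup>2) * ell (R * \<delta> / (sqrt 2 * a / n * V))) =
    exp (n * \<delta> / (sqrt 2 * a * R)
      - (n * \<delta> / (sqrt 2 * a * R) + V / R\<^sup>2) * ln (1 + n * R * \<delta> / (sqrt 2 * a * V)))"
proof -
  define y where "y = n * R * \<delta> / (sqrt 2 * a * V)"
  have 1: "R * \<delta> / (sqrt 2 * a / n * V) = y" using n by (simp add: y_def mult_ac)
  have 2: "n * \<delta> / (sqrt 2 * a * R) = V / R\<^sup>2 * y"
    using V R by (simp add: y_def power2_eq_square)
  show ?thesis unfolding 1 2 y_def[symmetric] by (simp add: ell_def algebra_simps)
qed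

text \<open>As a function of t0, the left-hand side of the equation for t0 has its minimum 0 at 0.
  For \<delta> \<le> 12 b, \<open>t0 \<ge> 0\<close> selects the root on the increasing branch; for
  \<delta> > 12 b there is no root.\<close>

theorem corollary1p5:
  shows "\<exists>C>0. \<forall>(N::nat) (A::complex mat) (a::real) (b::real)
      (\<beta>::nat \<times> nat \<Rightarrow> real) (\<nu>::(nat \<times> nat \<Rightarrow> real) measure) (P::(nat \<times> nat \<Rightarrow> real) measure).
    N \<ge> 1 \<longrightarrow>
    A \<in> carrier_mat N N \<longrightarrow> hermitian A \<longrightarrow>
    a > 0 \<longrightarrow> (\<forall>i<N. \<forall>j<N. cmod (A $$ (i, j)) \<le> a) \<longrightarrow>
    b > 0 \<longrightarrow>
    ID (idx N) \<beta> \<nu> P \<longrightarrow> bounded_supp (idx N) \<nu> \<longrightarrow>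
    (let R = supp_radius (idx N) \<nu>; V2 = Vsq (idx N) \<nu> R; n = real N in
      (\<forall>\<delta> \<gamma> t0. \<delta> > 0 \<longrightarrow>
        \<gamma> > 0 \<longrightarrow> \<nu>bar (idx N) \<nu> (p_gamma (idx N) \<nu> \<gamma>) \<le> 1/4 \<longrightarrow>
        t0 \<ge> 0 \<longrightarrow>
        V2 / R\<^sup>2 * (t0 * R * exp (t0 * R) - exp (t0 * R) + 1) = ln (12 * b / \<delta>) \<longrightarrow>
        (let C\<delta>b = C * (sqrt 2 * a / sqrt n
                      * (G2 (idx N) \<beta> \<nu> \<gamma> + V2 / R * (exp (t0 * R) - 1)) + b) in
          measure P {x\<in>space P.
            (SUP f\<in>Lip_b b. \<bar>tr_N (mat_fun f (X_mat N A x))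
                - (\<integral>y. tr_N (mat_fun f (X_mat N A y)) \<partial>P)\<bar>) \<ge> \<delta>}
          \<le> C\<delta>b / \<delta> * exp (- (V2 / R\<^sup>2) * ell (n * R * \<delta>\<^sup>2 / (sqrt 2 * a * C\<delta>b * V2)))))
      \<and>
      (\<forall>\<mu> \<delta>. prob_space \<mu> \<longrightarrow> sets \<mu> = sets borel \<longrightarrow> \<delta> > 0 \<longrightarrow>
        measure P {x\<in>space P.
          d_W b (emp_spectral (X_mat N A x)) \<mu>
            - (\<integral>y. d_W b (emp_spectral (X_mat N A y)) \<mu> \<partial>P) \<ge> \<delta>}
        \<le> exp (n * \<delta> / (sqrt 2 * a * R)
            - (n * \<delta> / (sqrt 2 * a * R) + V2 / R\<^sup>2) * ln (1 + n * R * \<delta> / (sqrt 2 * a * V2)))))"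
proof (rule exI[of _ 224], intro conjI allI impI)
  show "(224::real) > 0" by simp
  fix N :: nat and A :: "complex mat" and a b :: real and \<beta> :: "nat \<times> nat \<Rightarrow> real"
    and \<nu> P :: "(nat \<times> nat \<Rightarrow> real) measure"
  assume asm: "N \<ge> 1" "A \<in> carrier_mat N N" "hermitian A" "a > 0"
    "\<forall>i<N. \<forall>j<N. cmod (A $$ (i, j)) \<le> a" "b > 0" "ID (idx N) \<beta> \<nu> P" "bounded_supp (idx N) \<nu>"
  interpret spectral_concentration N A a \<beta> \<nu> P b
    by unfold_locales (use asm in auto)
  have n: "real N > 0" using asm(1) by simp
  show "let R = supp_radius (idx N) \<nu>; V2 = Vsq (idx N) \<nu> R; n = real N in
      (\<forall>\<delta> \<gamma> t0. \<delta> > 0 \<longrightarrow>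
        \<gamma> > 0 \<longrightarrow> \<nu>bar (idx N) \<nu> (p_gamma (idx N) \<nu> \<gamma>) \<le> 1/4 \<longrightarrow>
        t0 \<ge> 0 \<longrightarrow>
        V2 / R\<^sup>2 * (t0 * R * exp (t0 * R) - exp (t0 * R) + 1) = ln (12 * b / \<delta>) \<longrightarrow>
        (let C\<delta>b = 224 * (sqrt 2 * a / sqrt n
                      * (G2 (idx N) \<beta> \<nu> \<gamma> + V2 / R * (exp (t0 * R) - 1)) + b) in
          measure P {x\<in>space P.
            (SUP f\<in>Lip_b b. \<bar>tr_N (mat_fun f (X_mat N A x))
                - (\<integral>y. tr_N (mat_fun f (X_mat N A y)) \<partial>P)\<bar>) \<ge> \<delta>}
          \<le> C\<delta>b / \<delta> * exp (- (V2 / R\<^sup>2) * ell (n * R * \<delta>\<^sup>2 / (sqrt 2 * a * C\<delta>b * V2)))))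
      \<and>
      (\<forall>\<mu> \<delta>. prob_space \<mu> \<longrightarrow> sets \<mu> = sets borel \<longrightarrow> \<delta> > 0 \<longrightarrow>
        measure P {x\<in>space P.
          d_W b (emp_spectral (X_mat N A x)) \<mu>
            - (\<integral>y. d_W b (emp_spectral (X_mat N A y)) \<mu> \<partial>P) \<ge> \<delta>}
        \<le> exp (n * \<delta> / (sqrt 2 * a * R)
            - (n * \<delta> / (sqrt 2 * a * R) + V2 / R\<^sup>2) * ln (1 + n * R * \<delta> / (sqrt 2 * a * V2))))"
    unfolding Let_def
  proof (intro conjI allI impI)
    fix \<delta> \<gamma> t0 :: real
    assume i: "\<delta> > 0" "\<gamma> > 0" "\<nu>bar (idx N) \<nu> (p_gamma (idx N) \<nu> \<gamma>) \<le> 1/4" "t0 \<ge> 0"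
      "V / R\<^sup>2 * (t0 * R * exp (t0 * R) - exp (t0 * R) + 1) = ln (12 * b / \<delta>)"
    show "measure P {x\<in>space P.
            (SUP f\<in>Lip_b b. \<bar>tr_N (mat_fun f (X_mat N A x))
                - (\<integral>y. tr_N (mat_fun f (X_mat N A y)) \<partial>P)\<bar>) \<ge> \<delta>}
          \<le> 224 * (sqrt 2 * a / sqrt (real N)
                      * (G2 (idx N) \<beta> \<nu> \<gamma> + V / R * (exp (t0 * R) - 1)) + b) / \<delta> *
            exp (- (V / R\<^sup>2) * ell (real N * R * \<delta>\<^sup>2 / (sqrt 2 * a *
              (224 * (sqrt 2 * a / sqrt (real N)
                      * (G2 (idx N) \<beta> \<nu> \<gamma> + V / R * (exp (t0 * R) - 1)) + b)) * V)))"
      using trace_concentration[OF i] by (simp only: C0_def[OF i] \<kappa>_def[OF i] s_def[OF i])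
  next
    fix \<mu> :: "real measure" and \<delta> :: real
    assume "prob_space \<mu>" "sets \<mu> = sets borel" "\<delta> > 0"
    from d_W_concentration[OF this]
    show "measure P {x\<in>space P.
          d_W b (emp_spectral (X_mat N A x)) \<mu>
            - (\<integral>y. d_W b (emp_spectral (X_mat N A y)) \<mu> \<partial>P) \<ge> \<delta>}
        \<le> exp (real N * \<delta> / (sqrt 2 * a * R)
            - (real N * \<delta> / (sqrt 2 * a * R) + V / R\<^sup>2) * ln (1 + real N * R * \<delta> / (sqrt 2 * a * V)))"
      unfolding L_def exp_ell_eq[OF V_pos R_pos a n] .
  qed
qed

end
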